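(* Let $d\ge 1$, $\nu>0$, $\ell>0$, $\sigma>0$, and let $\mathcal{O}\subseteq\mathbb{T}^d$ be a non-empty open set. Let $Z$ be a centred Gaussian process on $\mathbb{T}^d=\mathbb{R}^d/\mathbb{Z}^d$ with covariance $$k_\nu(x,x') = c_{\nu,\sigma}\sum_{n\in\mathbb{Z}^d}\left(\frac{\sqrt{2\nu}\,\|x-x'+n\|}{\ell}\right)^{\nu}K_\nu\left(\frac{\sqrt{2\nu}\,\|x-x'+n\|}{\ell}\right),\qquad c_{\nu,\sigma}=\sigma^2\,\frac{2^{1-\nu}}{\Gamma(\nu)} .$$ Then $Z$ has samples in $C^{\nu^-}_{loc}(\mathcal{O})$ and no more; that is, $Z$ has samples in $C^{\nu^-}_{loc}(\mathcal{O})$, and for every $\nu'>\nu$ it does not have samples in $C^{\nu'^-}_{loc}(\mathcal{O})$.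
   Context: $K_\nu$ is the modified Bessel function of the second kind; $z^\nu K_\nu(z)$ is extended to $z=0$ by its limit $2^{\nu-1}\Gamma(\nu)$. $\|\cdot\|$ is the Euclidean norm. For $n\in\mathbb{N}_0$, $\gamma\in[0,1]$ and $\mathcal{O}$ open, the local Hölder space $C^{n,\gamma}_{loc}(\mathcal{O})$ is the space of functions $f$ on $\mathcal{O}$ for which $\partial^\alpha f$ exists for all multi-indices $|\alpha|\le n$ and such that for every compact $K\subset\mathcal{O}$ there is $C_K>0$ with $|\partial^\alpha f(x)-\partial^\alpha f(y)|\le C_K\|x-y\|^\gamma$ for all $x,y\in K$ and $|\alpha|=n$ (on the torus this is read in local charts, $\mathbb{T}^d$ being locally isometric to $\mathbb{R}^d$). The local almost-Hölder space is $$C^{(n+\gamma)^-}_{loc}(\mathcal{O})=\bigcap_{n'+\gamma'<n+\gamma}C^{n',\gamma'}_{loc}(\mathcal{O}),\qquad n'\in\mathbb{N}_0,\ \gamma'\in[0,1].$$ A process "has samples in" a function space if it has a modification whose sample paths, restricted to $\mathcal{O}$, lie in that space almost surely. *)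

theory Defs
  imports "HOL-Probability.Probability"
begin

text \<open>The flat torus \<open>\<real>\<^sup>d / \<int>\<^sup>d\<close> with \<open>d = CARD('n)\<close> and its quotient topology.\<close>

definition int_vec :: "int ^ 'n \<Rightarrow> real ^ 'n" where
  "int_vec m = (\<chi> i. of_int (m $ i))"

definition torus_rel :: "real ^ 'n \<Rightarrow> real ^ 'n \<Rightarrow> bool" where
  "torus_rel x y \<longleftrightarrow> (\<exists>m. x - y = int_vec m)"

lemma int_vec_add: "int_vec (m + k) = int_vec m + int_vec k"
  by (simp add: int_vec_def vec_eq_iff)

lemma int_vec_minus: "int_vec (- m) = - int_vec m"
  by (simp add: int_vec_def vec_eq_iff)

lemma int_vec_0: "int_vec 0 = 0"
  by (simp add: int_vec_def vec_eq_iff)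

lemma equivp_torus_rel: "equivp torus_rel"
proof (rule equivpI)
  show "reflp (torus_rel :: real ^ 'n \<Rightarrow> _)"
    by (rule reflpI) (metis torus_rel_def diff_self int_vec_0)
  show "symp (torus_rel :: real ^ 'n \<Rightarrow> _)"
    by (rule sympI) (metis torus_rel_def minus_diff_eq int_vec_minus)
  show "transp (torus_rel :: real ^ 'n \<Rightarrow> _)"
  proof (rule transpI)
    fix x y z :: "real ^ 'n"
    assume "torus_rel x y" "torus_rel y z"
    then obtain m k where "x - y = int_vec m" "y - z = int_vec k"
      by (auto simp: torus_rel_def)
    then have "x - z = int_vec (m + k)"
      by (simp add: int_vec_add algebra_simps)
    then show "torus_rel x z"
      by (auto simp: torus_rel_def)
  qed
qed

quotient_type 'n torus = "real ^ ('n :: finite)" / torus_rel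
  morphisms rep_torus to_torus
  by (rule equivp_torus_rel)

instantiation torus :: (finite) topological_space
begin

definition open_torus :: "'a torus set \<Rightarrow> bool" where
  "open_torus U \<longleftrightarrow> open (to_torus -` U)"

instance
proof
  show "open (UNIV :: 'a torus set)"
    by (simp add: open_torus_def)
  show "open (S \<inter> T)" if "open S" "open T" for S T :: "'a torus set"
    using that by (simp add: open_torus_def vimage_Int open_Int)
  show "open (\<Union> K)" if "\<forall>S\<in>K. open S" for K :: "'a torus set set"
    using that by (auto simp: open_torus_def vimage_Union)
qed

end

text \<open>
  Partial derivatives and local Hoelder spaces on \<open>\<real>\<^sup>d\<close>. A multi-index \<open>\<alpha>\<close> of order \<open>k\<close> is
  represented by the words of length \<open>k\<close> over the coordinates in which \<open>i\<close> occurs \<open>\<alpha>\<^sub>i\<close> times, one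
  word for each order of differentiation; quantifying over all words of length \<open>k\<close> thus covers
  all \<open>|\<alpha>| = k\<close>.
\<close>

definition partial_deriv :: "'n \<Rightarrow> (real ^ 'n \<Rightarrow> real) \<Rightarrow> real ^ 'n \<Rightarrow> real" where
  "partial_deriv i f x = deriv (\<lambda>t. f (x + t *\<^sub>R axis i 1)) 0"

definition has_partial_deriv_on :: "'n \<Rightarrow> (real ^ 'n \<Rightarrow> real) \<Rightarrow> (real ^ 'n) set \<Rightarrow> bool" where
  "has_partial_deriv_on i f V \<longleftrightarrow> (\<forall>x\<in>V. (\<lambda>t. f (x + t *\<^sub>R axis i 1)) differentiable (at 0))"

primrec iter_partial :: "'n list \<Rightarrow> (real ^ 'n \<Rightarrow> real) \<Rightarrow> real ^ 'n \<Rightarrow> real" where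
  "iter_partial [] f = f"
| "iter_partial (i # is) f = partial_deriv i (iter_partial is f)"

primrec iter_partial_exists :: "'n list \<Rightarrow> (real ^ 'n \<Rightarrow> real) \<Rightarrow> (real ^ 'n) set \<Rightarrow> bool" where
  "iter_partial_exists [] f V \<longleftrightarrow> True"
| "iter_partial_exists (i # is) f V \<longleftrightarrow>
     iter_partial_exists is f V \<and> has_partial_deriv_on i (iter_partial is f) V"

text \<open>
  Only the values of a function on the open set \<open>V\<close> matter. For \<open>\<gamma> = 0\<close> and \<open>x = y\<close> the value
  \<open>0 powr 0 = 0\<close> is harmless, as the left-hand side vanishes.
\<close>

definition holder_loc :: "nat \<Rightarrow> real \<Rightarrow> (real ^ 'n) set \<Rightarrow> (real ^ 'n \<Rightarrow> real) set" where
  "holder_loc n \<gamma> V = {f.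
     (\<forall>is. length is \<le> n \<longrightarrow> iter_partial_exists is f V) \<and>
     (\<forall>K. compact K \<and> K \<subseteq> V \<longrightarrow>
        (\<exists>C>0. \<forall>x\<in>K. \<forall>y\<in>K. \<forall>is. length is = n \<longrightarrow>
           \<bar>iter_partial is f x - iter_partial is f y\<bar> \<le> C * norm (x - y) powr \<gamma>))}"

text \<open>
  On the torus the local charts are the inverses of the projection \<open>to_torus\<close> restricted to open
  sets on which it is injective, so that \<open>f \<circ> to_torus\<close> on \<open>V\<close> is \<open>f\<close> read in a chart.
\<close>

definition torus_holder_loc :: "nat \<Rightarrow> real \<Rightarrow> ('n :: finite) torus set \<Rightarrow> ('n torus \<Rightarrow> real) set" where
  "torus_holder_loc n \<gamma> U = {f. \<forall>V. open V \<and> inj_on to_torus V \<and> to_torus ` V \<subseteq> U \<longrightarrow>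
     f \<circ> to_torus \<in> holder_loc n \<gamma> V}"

definition torus_almost_holder_loc :: "real \<Rightarrow> ('n :: finite) torus set \<Rightarrow> ('n torus \<Rightarrow> real) set" where
  "torus_almost_holder_loc s U =
     {f. \<forall>n \<gamma>. 0 \<le> \<gamma> \<and> \<gamma> \<le> 1 \<and> real n + \<gamma> < s \<longrightarrow> f \<in> torus_holder_loc n \<gamma> U}"

text \<open>
  The modified Bessel function of the second kind for \<open>z > 0\<close>, by its classical integral
  representation \<open>K\<^sub>\<nu>(z) = \<integral>\<^sub>0\<^sup>\<infinity> exp (- z cosh t) cosh (\<nu> t) dt\<close> (DLMF 10.32.9), valid for
  every real \<open>\<nu>\<close>, integer orders included.
\<close>

definition bessel_K :: "real \<Rightarrow> real \<Rightarrow> real" where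
  "bessel_K \<nu> z = (LBINT t:{0..}. exp (- z * cosh t) * cosh (\<nu> * t))"

text \<open>The function \<open>z\<^sup>\<nu> K\<^sub>\<nu>(z)\<close> on \<open>z \<ge> 0\<close>, with its limit as value at \<open>0\<close>.\<close>

definition powr_bessel_K :: "real \<Rightarrow> real \<Rightarrow> real" where
  "powr_bessel_K \<nu> z = (if z = 0 then 2 powr (\<nu> - 1) * Gamma \<nu> else z powr \<nu> * bessel_K \<nu> z)"

definition matern_const :: "real \<Rightarrow> real \<Rightarrow> real" where
  "matern_const \<nu> \<sigma> = \<sigma>\<^sup>2 * (2 powr (1 - \<nu>) / Gamma \<nu>)"

lift_definition torus_matern :: "real \<Rightarrow> real \<Rightarrow> real \<Rightarrow> ('n :: finite) torus \<Rightarrow> 'n torus \<Rightarrow> real"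
  is "\<lambda>\<nu> l \<sigma> x x'. matern_const \<nu> \<sigma> *
        (\<Sum>\<^sub>\<infinity>m\<in>UNIV. powr_bessel_K \<nu> (sqrt (2 * \<nu>) * norm (x - x' + int_vec m) / l))"
proof -
  fix \<nu> l \<sigma> :: real and x1 x2 y1 y2 :: "real ^ 'n"
  assume "torus_rel x1 x2" "torus_rel y1 y2"
  then obtain a b where ab: "x1 - x2 = int_vec a" "y1 - y2 = int_vec b"
    by (auto simp: torus_rel_def)
  define F where
    "F = (\<lambda>m. powr_bessel_K \<nu> (sqrt (2 * \<nu>) * norm (x2 - y2 + int_vec m) / l))"
  have shift: "x1 - y1 + int_vec m = x2 - y2 + int_vec (m + (a - b))" for m
    using ab int_vec_add[of m "a - b"] int_vec_add[of a "- b"] int_vec_minus[of b]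
    by (simp add: algebra_simps)
  have "bij (\<lambda>m. m + (a - b))"
    by (rule bij_betwI[where g = "\<lambda>m. m - (a - b)"]) auto
  then have "(\<Sum>\<^sub>\<infinity>m\<in>UNIV. F (m + (a - b))) = (\<Sum>\<^sub>\<infinity>m\<in>UNIV. F m)"
    by (rule infsum_reindex_bij_betw)
  then show "matern_const \<nu> \<sigma> *
        (\<Sum>\<^sub>\<infinity>m\<in>UNIV. powr_bessel_K \<nu> (sqrt (2 * \<nu>) * norm (x1 - y1 + int_vec m) / l)) =
      matern_const \<nu> \<sigma> *
        (\<Sum>\<^sub>\<infinity>m\<in>UNIV. powr_bessel_K \<nu> (sqrt (2 * \<nu>) * norm (x2 - y2 + int_vec m) / l))"
    unfolding F_def shift by simp
qed

text \<open>
  Gaussian random variables include the degenerate (almost surely constant) ones, and a process is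
  Gaussian if all finite linear combinations of its values are.
\<close>

definition gaussian_rv :: "'a measure \<Rightarrow> ('a \<Rightarrow> real) \<Rightarrow> bool" where
  "gaussian_rv M X \<longleftrightarrow> X \<in> borel_measurable M \<and>
     ((\<exists>\<mu>. AE \<omega> in M. X \<omega> = \<mu>) \<or> (\<exists>\<mu> s. s > 0 \<and> distributed M lborel X (normal_density \<mu> s)))"

definition gaussian_process :: "'a measure \<Rightarrow> ('i \<Rightarrow> 'a \<Rightarrow> real) \<Rightarrow> bool" where
  "gaussian_process M Z \<longleftrightarrow> prob_space M \<and>
     (\<forall>A c. finite A \<longrightarrow> gaussian_rv M (\<lambda>\<omega>. \<Sum>x\<in>A. c x * Z x \<omega>))"

definition centred_process :: "'a measure \<Rightarrow> ('i \<Rightarrow> 'a \<Rightarrow> real) \<Rightarrow> bool" where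
  "centred_process M Z \<longleftrightarrow> (\<forall>x. (\<integral>\<omega>. Z x \<omega> \<partial>M) = 0)"

definition process_covariance :: "'a measure \<Rightarrow> ('i \<Rightarrow> 'a \<Rightarrow> real) \<Rightarrow> 'i \<Rightarrow> 'i \<Rightarrow> real" where
  "process_covariance M Z x y =
     (\<integral>\<omega>. (Z x \<omega> - (\<integral>\<omega>'. Z x \<omega>' \<partial>M)) * (Z y \<omega> - (\<integral>\<omega>'. Z y \<omega>' \<partial>M)) \<partial>M)"

definition modification_of :: "'a measure \<Rightarrow> ('i \<Rightarrow> 'a \<Rightarrow> real) \<Rightarrow> ('i \<Rightarrow> 'a \<Rightarrow> real) \<Rightarrow> bool" where
  "modification_of M Z Y \<longleftrightarrow>
     (\<forall>x. Y x \<in> borel_measurable M \<and> (AE \<omega> in M. Y x \<omega> = Z x \<omega>))"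

definition has_samples_in :: "'a measure \<Rightarrow> ('i \<Rightarrow> 'a \<Rightarrow> real) \<Rightarrow> ('i \<Rightarrow> real) set \<Rightarrow> bool" where
  "has_samples_in M Z S \<longleftrightarrow>
     (\<exists>Y. modification_of M Z Y \<and> (AE \<omega> in M. (\<lambda>x. Y x \<omega>) \<in> S))"

end

theory Submission
  imports Defs
begin

text \<open>
  Writing \<open>z\<^sup>\<nu> K\<^sub>\<nu>(z)\<close> as a mixture of Gaussians in \<open>z\<close> makes the covariance a mixture of products of
  one-dimensional periodic Gaussians, whose Fourier coefficients are explicit and positive by Poisson
  summation. Regularity: let \<open>I\<^sub>k\<close> be the sampling operator on the grid of mesh of order \<open>4\<^bsup>-k\<^esup>\<close> built from
  the de la Vallee Poussin kernel. It reproduces frequencies up to \<open>4\<^sup>k\<close>, so \<open>Z - I\<^sub>k Z\<close> has variance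
  \<open>O(4\<^bsup>-2k\<nu>\<^esup>)\<close>, and \<open>I\<^bsub>k+1\<^esub> Z - I\<^sub>k Z = I\<^bsub>k+1\<^esub> (Z - I\<^sub>k Z)\<close> is a trigonometric polynomial determined by the
  residual at polynomially many grid points. Gaussian tails and Borel--Cantelli bound it by
  \<open>4\<^bsup>-ks\<^esup>\<close> for every \<open>s < \<nu>\<close>, and summing over \<open>k\<close> gives the modification. Optimality: a finite difference
  of order exceeding \<open>\<nu>\<close> with step \<open>h\<close> has variance at least of order \<open>h\<^bsup>2\<nu>\<^esup>\<close>, whereas smoother samples
  would make it almost surely \<open>o(h\<^sup>\<nu>)\<close>, which is impossible for Gaussian variables.
\<close>

text \<open>Everything is built from finite linear combinations of point values, whose laws the
  covariance determines; hence sampling in place of spectral projection. A sharp frequency cutoff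
  would have an operator norm growing with the bandwidth, whereas the product of two Dirichlet
  kernels has absolute sums bounded uniformly in the grid. Its frequencies reach
  \<open>3 * N\<close>: the \<open>8 * N\<close> grid points leave no aliasing, and the ratio 4
  between levels, being at least 3, makes each operator reproduce the range of the previous one. The
  mixture makes all estimates one-dimensional and explicit. At mixing variable \<open>u\<close>
  frequencies beyond \<open>N\<close> carry a factor \<open>exp (- c * N^2 * exp u)\<close>, and
  integrating it against \<open>exp (\<nu> * u)\<close> produces the power
  \<open>N powr (- 2 * \<nu>)\<close>. Both variance bounds are inequalities for fixed
  \<open>u\<close> that are integrated at the end.\<close>

section \<open>Fourier series of the periodic Gaussian\<close>

text \<open>The concentration argument for uniqueness of Fourier series: if \<open>f x0 > 0\<close>,
  the trigonometric polynomial \<open>q ^ N\<close> peaks at \<open>x0\<close>, so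
  \<open>f * q ^ N\<close> cannot integrate to 0 for large \<open>N\<close>. The phase
  \<open>\<phi>\<close> covers sines together with cosines.\<close>

lemma fourier_zero_aux:
  fixes f :: "real \<Rightarrow> real"
  assumes cont: "continuous_on UNIV f"
    and ortho: "\<And>(n::int) \<phi>. integral {0..1} (\<lambda>s. f s * cos (2 * pi * n * s + \<phi>)) = 0"
    and x0: "0 < x0" "x0 < 1"
  shows "f x0 \<le> 0"
proof (rule ccontr)
  assume "\<not> f x0 \<le> 0"
  then have fpos: "f x0 > 0" by simp
  define c where "c = f x0 / 2"
  have c: "c > 0" using fpos by (simp add: c_def)
  have "isCont f x0" using cont by (simp add: continuous_on_eq_continuous_at)
  then obtain d0 where d0: "d0 > 0" "\<And>s. \<bar>s - x0\<bar> < d0 \<Longrightarrow> \<bar>f s - f x0\<bar> < c"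
    using c unfolding continuous_at_eps_delta dist_real_def by blast
  \<comment> \<open>The bound by \<open>x0\<close> and \<open>1 - x0\<close> keeps the window inside
    the unit interval; it also keeps the remaining points of that interval at distance at least
    \<open>d\<close> from \<open>x0\<close> modulo 1, as \<open>q\<close> has period 1.\<close>
  define d where "d = min (d0/2) (min x0 (1 - x0))"
  have d: "d > 0" "d \<le> x0" "d \<le> 1 - x0" "d < d0"
    using d0(1) x0 by (auto simp: d_def)
  have fc: "f s > c" if "\<bar>s - x0\<bar> \<le> d" for s
  proof -
    have "\<bar>f s - f x0\<bar> < c" using d0(2)[of s] that d by simp
    then show ?thesis unfolding c_def by linarith
  qed
  have d_half: "d \<le> 1/2" using d by linarith
  obtain B where B: "\<And>s. s \<in> {0..1} \<Longrightarrow> \<bar>f s\<bar> \<le> B" "B > 0"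
  proof -
    have "bounded (f ` {0..1})"
      by (intro compact_imp_bounded compact_continuous_image continuous_on_subset[OF cont]) auto
    then obtain B where "B > 0" "\<forall>x\<in>f ` {0..1}. norm x \<le> B" unfolding bounded_pos by blast
    then show thesis by (intro that) auto
  qed
  define q where "q s = (1 + cos (2 * pi * (s - x0))) / 2" for s
  \<comment> \<open>The values of \<open>q\<close> at distance \<open>d\<close> and
    \<open>d / 2\<close> from \<open>x0\<close>; the strict gap between them decides the comparison
    in \<open>key\<close>.\<close>
  define \<eta> where "\<eta> = (1 + cos (2 * pi * d)) / 2"
  define \<eta>' where "\<eta>' = (1 + cos (pi * d)) / 2"
  have q01: "0 \<le> q s" "q s \<le> 1" for s
  proof -
    have "-1 \<le> cos (2 * pi * (s - x0))" "cos (2 * pi * (s - x0)) \<le> 1" by simp_all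
    then have "0 \<le> 1 + cos (2 * pi * (s - x0))" "1 + cos (2 * pi * (s - x0)) \<le> 2" by linarith+
    then show "0 \<le> q s" "q s \<le> 1" unfolding q_def by simp_all
  qed
  have eta0: "0 \<le> \<eta>" 
  proof -
    have "0 \<le> 1 + cos (2 * pi * d)" using cos_ge_minus_one[of "2 * pi * d"] by linarith
    then show ?thesis by (simp add: \<eta>_def)
  qed
  have eta_less: "\<eta> < \<eta>'"
  proof -
    have "cos (2 * pi * d) < cos (pi * d)"
    proof (rule cos_monotone_0_pi)
      have "pi * (2 * d) \<le> pi * 1" by (rule mult_left_mono) (use d_half in auto)
      then show "2 * pi * d \<le> pi" by (simp add: mult_ac)
    qed (use d in auto)
    then show ?thesis by (simp add: \<eta>_def \<eta>'_def)
  qed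
  have q_far: "q s \<le> \<eta>" if "s \<in> {0..1}" "\<bar>s - x0\<bar> \<ge> d" for s
  proof -
    have "cos (2 * pi * (s - x0)) = cos (2 * pi * \<bar>s - x0\<bar>)"
      using cos_abs_real[of "2 * pi * (s - x0)"] by (simp add: abs_mult)
    moreover have "cos (2 * pi * \<bar>s - x0\<bar>) \<le> cos (2 * pi * d)"
    proof (cases "\<bar>s - x0\<bar> \<le> 1/2")
      case True
      then show ?thesis using that d by (intro cos_monotone_0_pi_le) auto
    next
      case False
      have "cos (2 * pi * \<bar>s - x0\<bar>) = cos (2 * pi * (1 - \<bar>s - x0\<bar>))"
        using cos_diff[of "2 * pi" "2 * pi * \<bar>s - x0\<bar>"] by (simp add: algebra_simps)
      also have "\<dots> \<le> cos (2 * pi * d)"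
        using that d False by (intro cos_monotone_0_pi_le) auto
      finally show ?thesis .
    qed
    ultimately show ?thesis by (simp add: q_def \<eta>_def)
  qed
  have q_near: "q s \<ge> \<eta>'" if "\<bar>s - x0\<bar> \<le> d / 2" for s
  proof -
    have "cos (2 * pi * (s - x0)) = cos (2 * pi * \<bar>s - x0\<bar>)"
      using cos_abs_real[of "2 * pi * (s - x0)"] by (simp add: abs_mult)
    moreover have "cos (2 * pi * \<bar>s - x0\<bar>) \<ge> cos (pi * d)"
    proof (intro cos_monotone_0_pi_le)
      show "2 * pi * \<bar>s - x0\<bar> \<le> pi * d" using that by (simp add: mult_le_cancel_left)
      show "pi * d \<le> pi" using d_half by simp
    qed auto
    ultimately show ?thesis by (simp add: q_def \<eta>'_def)
  qed
  have cf: "continuous_on S f" for S using cont continuous_on_subset by blast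
  have cq: "continuous_on S q" for S unfolding q_def by (intro continuous_intros) auto
  have intg: "(\<lambda>s. f s * q s ^ N * cos (a * s + \<phi>)) integrable_on {0..1}" for N a \<phi>
    by (intro integrable_continuous_real continuous_intros cf cq)
  \<comment> \<open>Multiplication by \<open>q\<close> moves the frequency by at most one and the
    phase by \<open>2 * pi * x0\<close>, so the induction closes once all \<open>n\<close> and
    \<open>\<phi>\<close> are quantified.\<close>
  have ort: "integral {0..1} (\<lambda>s. f s * q s ^ N * cos (2 * pi * of_int n * s + \<phi>)) = 0" for N n \<phi>
  proof (induction N arbitrary: n \<phi>)
    case 0
    then show ?case using ortho[of n \<phi>] by simp
  next
    case (Suc N)
    have eq: "f s * q s ^ Suc N * cos (2 * pi * of_int n * s + \<phi>) =
      (1/2) * (f s * q s ^ N * cos (2 * pi * of_int n * s + \<phi>)) +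
      (1/4) * (f s * q s ^ N * cos (2 * pi * of_int (n+1) * s + (\<phi> - 2 * pi * x0))) +
      (1/4) * (f s * q s ^ N * cos (2 * pi * of_int (n-1) * s + (\<phi> + 2 * pi * x0)))" for s
    proof -
      have e: "cos (2 * pi * (s - x0)) * cos (2 * pi * of_int n * s + \<phi>) =
        (cos (2 * pi * of_int (n-1) * s + (\<phi> + 2 * pi * x0)) + cos (2 * pi * of_int (n+1) * s + (\<phi> - 2 * pi * x0))) / 2"
        unfolding cos_times_cos
        using cos_minus[of "2 * pi * of_int (n-1) * s + (\<phi> + 2 * pi * x0)"]
        by (simp add: algebra_simps)
      have "f s * q s ^ Suc N * cos (2 * pi * of_int n * s + \<phi>) =
         f s * q s ^ N * ((cos (2 * pi * of_int n * s + \<phi>) + cos (2 * pi * (s - x0)) * cos (2 * pi * of_int n * s + \<phi>)) / 2)"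
        by (simp add: q_def field_simps)
      then show ?thesis unfolding e by (simp add: field_simps)
    qed
    have "((\<lambda>s. f s * q s ^ N * cos (2 * pi * of_int n * s + \<phi>)) has_integral 0) {0..1}" for n \<phi>
      using integrable_integral[OF intg[of N "2 * pi * of_int n" \<phi>]] unfolding Suc.IH .
    then have "((\<lambda>s. f s * q s ^ Suc N * cos (2 * pi * of_int n * s + \<phi>)) has_integral
        ((1/2) * 0 + (1/4) * 0 + (1/4) * 0)) {0..1}"
      unfolding eq by (intro has_integral_add has_integral_mult_right)
    then show ?case by (simp add: integral_unique)
  qed
  \<comment> \<open>Adding the constant \<open>B * \<eta> ^ N\<close> makes the integrand
    nonnegative on the whole interval; the integral may then be restricted to a window of length
    \<open>d\<close>, where the integrand is at least \<open>c * \<eta>' ^ N\<close>.\<close>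
  have key: "d * c * \<eta>' ^ N \<le> B * \<eta> ^ N" for N
  proof -
    let ?A = "{x0 - d/2..x0 + d/2}"
    let ?g = "\<lambda>s. f s * q s ^ N + B * \<eta> ^ N"
    have ig: "?g integrable_on S" if "S = {a..b}" for S a b
      unfolding that by (intro integrable_continuous_real continuous_intros cf cq)
    have sub: "?A \<subseteq> {0..1}" using d by auto
    have gpos: "0 \<le> ?g s" if "s \<in> {0..1}" for s
    proof (cases "\<bar>s - x0\<bar> \<le> d")
      case True
      then show ?thesis using fc[OF True] c q01 B eta0 by simp
    next
      case False
      have "q s ^ N \<le> \<eta> ^ N" using q_far[OF that] False q01 by (intro power_mono) auto
      then have "\<bar>f s * q s ^ N\<bar> \<le> B * \<eta> ^ N"
        using B(1)[OF that] q01[of s] B(2) unfolding abs_mult by (intro mult_mono) auto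
      then show ?thesis by linarith
    qed
    have "d * c * \<eta>' ^ N = integral ?A (\<lambda>s. c * \<eta>' ^ N)" using d by simp
    also have "\<dots> \<le> integral ?A ?g"
    proof (rule integral_le)
      fix s assume "s \<in> ?A"
      then have s: "\<bar>s - x0\<bar> \<le> d/2" unfolding abs_le_iff atLeastAtMost_iff by linarith
      then have "c * \<eta>' ^ N \<le> f s * q s ^ N"
        using fc[of s] q_near[OF s] eta_less eta0 c d by (intro mult_mono power_mono) auto
      then show "c * \<eta>' ^ N \<le> ?g s" using B eta0 by (simp add: add_increasing2)
    qed (use ig in auto)
    also have "\<dots> \<le> integral {0..1} ?g"
      by (rule integral_subset_le[OF sub]) (use ig gpos in auto)
    also have "\<dots> = integral {0..1} (\<lambda>s. f s * q s ^ N) + B * \<eta> ^ N"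
      using intg[of N 0 0] by (subst Henstock_Kurzweil_Integration.integral_add) auto
    also have "integral {0..1} (\<lambda>s. f s * q s ^ N) = 0" using ort[of N 0 0] by simp
    finally show ?thesis by simp
  qed
  have "(\<lambda>N. B * (\<eta> / \<eta>') ^ N) \<longlonglongrightarrow> B * 0"
    using eta0 eta_less by (intro tendsto_mult tendsto_const LIMSEQ_power_zero) auto
  moreover have "d * c \<le> B * (\<eta> / \<eta>') ^ N" for N
    using key[of N] eta0 eta_less by (simp add: field_simps)
  ultimately have "d * c \<le> 0" by (intro LIMSEQ_le_const[of _ 0 "d*c"]) auto
  then show False using d c by (simp add: mult_le_0_iff)
qed

text \<open>Both \<open>f\<close> and \<open>- f\<close> fall under the previous lemma; the
  endpoints follow by continuity and the rest of the line by periodicity.\<close>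

lemma fourier_zero:
  fixes f :: "real \<Rightarrow> real"
  assumes cont: "continuous_on UNIV f" and per: "\<And>s (m::int). f (s + m) = f s"
    and ortho: "\<And>(n::int) \<phi>. integral {0..1} (\<lambda>s. f s * cos (2 * pi * n * s + \<phi>)) = 0"
  shows "f x = 0"
proof -
  have 1: "f x = 0" if "0 < x" "x < 1" for x
  proof -
    have "f x \<le> 0" using fourier_zero_aux[OF cont ortho that] .
    moreover have "- f x \<le> 0"
      using fourier_zero_aux[of "\<lambda>s. - f s", OF _ _ that] ortho cont
      by (simp add: continuous_on_minus)
    ultimately show ?thesis by linarith
  qed
  have "f x = 0" if "x \<in> closure {0<..<1}" for x
    using continuous_constant_on_closure[of "{0<..<1}" f 0 x] continuous_on_subset[OF cont] 1 that by auto
  then have 2: "f x = 0" if "0 \<le> x" "x \<le> 1" for x using that by simp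
  have "f x = f (x + of_int (- \<lfloor>x\<rfloor>))" by (rule per[symmetric])
  also have "\<dots> = 0" by (rule 2) linarith+
  finally show ?thesis .
qed

section \<open>The theta function: convergence, bounds and continuity\<close>

lemma sums_infsum_int:
  fixes f :: "int \<Rightarrow> real"
  assumes "f summable_on UNIV"
  shows "(\<lambda>k. f (int k) + f (- int k - 1)) sums infsum f UNIV"
proof -
  have U: "UNIV = range int \<union> range (\<lambda>k. - int k - 1)"
  proof -
    have "x \<in> range int \<union> range (\<lambda>k. - int k - 1)" for x
    proof (cases "x \<ge> 0")
      case True
      then show ?thesis by (metis UnI1 nonneg_int_cases rangeI)
    next
      case False
      then have "x = - int (nat (- x - 1)) - 1" by simp
      then show ?thesis by blast
    qed
    then show ?thesis by blast
  qed
  have D: "range int \<inter> range (\<lambda>k. - int k - 1) = {}" by auto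
  have i1: "inj int" "inj (\<lambda>k. - int k - 1)" by (auto simp: inj_on_def)
  have s1: "f summable_on range int" "f summable_on range (\<lambda>k. - int k - 1)"
    using assms summable_on_subset_banach by blast+
  have "(f has_sum infsum f (range int)) (range int)" using s1 by simp
  then have 1: "(\<lambda>k. f (int k)) sums infsum f (range int)"
    unfolding has_sum_reindex[OF i1(1)] comp_def by (rule has_sum_imp_sums)
  have "(f has_sum infsum f (range (\<lambda>k. - int k - 1))) (range (\<lambda>k. - int k - 1))" using s1 by simp
  then have 2: "(\<lambda>k. f (- int k - 1)) sums infsum f (range (\<lambda>k. - int k - 1))"
    unfolding has_sum_reindex[OF i1(2)] comp_def by (rule has_sum_imp_sums)
  have "infsum f UNIV = infsum f (range int) + infsum f (range (\<lambda>k. - int k - 1))"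
    unfolding U by (rule infsum_Un_disjoint[OF s1 D])
  then show ?thesis using sums_add[OF 1 2] by simp
qed

lemma summable_on_nonneg_bounded:
  fixes f g :: "'a \<Rightarrow> real"
  assumes "f summable_on A" and "\<And>x. x \<in> A \<Longrightarrow> g x \<le> f x" and "\<And>x. x \<in> A \<Longrightarrow> 0 \<le> g x"
  shows "g summable_on A"
proof -
  have "(\<lambda>x. norm (g x)) summable_on A"
    by (rule Infinite_Sum.abs_summable_on_comparison_test'[OF assms(1)]) (use assms(2,3) in auto)
  then show ?thesis by (rule summable_on_iff_abs_summable_on_real[THEN iffD2])
qed

lemma summable_on_int_inverse_squares:
  "(\<lambda>m::int. 1 / (1 + (of_int m)\<^sup>2) :: real) summable_on UNIV"
proof -
  have U: "UNIV = range int \<union> range (\<lambda>k. - int k)"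
  proof -
    have "x \<in> range int \<union> range (\<lambda>k. - int k)" for x
      by (cases x rule: int_cases2) auto
    then show ?thesis by blast
  qed
  have i1: "inj int" "inj (\<lambda>k. - int k)" by (auto simp: inj_on_def)
  have "summable (\<lambda>k. 1 / (1 + (real k)\<^sup>2))"
  proof (rule summable_comparison_test_ev)
    show "summable (\<lambda>k. inverse (real k ^ 2))" by (rule inverse_power_summable) simp
    show "\<forall>\<^sub>F k in sequentially. norm (1 / (1 + (real k)\<^sup>2)) \<le> inverse (real k ^ 2)"
      using eventually_gt_at_top[of "0::nat"]
      by eventually_elim (auto simp: inverse_eq_divide intro!: divide_left_mono mult_pos_pos add_pos_nonneg)
  qed
  then have s: "(\<lambda>k. 1 / (1 + (real k)\<^sup>2)) summable_on UNIV"
    by (intro norm_summable_imp_summable_on) simp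
  have "(\<lambda>m::int. 1 / (1 + (of_int m)\<^sup>2) :: real) summable_on range int"
    using s unfolding summable_on_reindex[OF i1(1)] by (simp add: comp_def)
  moreover have "(\<lambda>m::int. 1 / (1 + (of_int m)\<^sup>2) :: real) summable_on range (\<lambda>k. - int k)"
    using s unfolding summable_on_reindex[OF i1(2)] by (simp add: comp_def)
  ultimately show ?thesis unfolding U by (rule summable_on_union)
qed

text \<open>The Jacobi theta function, in the form of the Gaussian with rate \<open>b\<close>
  periodised over the integers.\<close>

definition theta :: "real \<Rightarrow> real \<Rightarrow> real" where
  "theta b s = (\<Sum>\<^sub>\<infinity>m\<in>UNIV. exp (- b * (s + of_int m)\<^sup>2))"

definition int_inverse_squares_sum :: real where
  "int_inverse_squares_sum = (\<Sum>\<^sub>\<infinity>m\<in>(UNIV::int set). 1 / (1 + (of_int m)\<^sup>2))"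

text \<open>From \<open>m^2 \<le> 2 * (s + m)^2 + 2 * s^2\<close> and
  \<open>exp (- x) \<le> 1 / (1 + x)\<close>. What matters is that at \<open>s = 0\<close> the
  constant grows only like \<open>1 / b\<close> for small \<open>b\<close>: in the mixture
  \<open>b\<close> is of order \<open>exp (- u)\<close>, and the weight has to absorb this
  growth.\<close>

lemma exp_minus_square_le:
  fixes b s :: real
  assumes "b > 0"
  shows "exp (- b * (s + of_int m)\<^sup>2) \<le> exp (b * s\<^sup>2) * ((1 + 2 / b) * (1 / (1 + (of_int m)\<^sup>2)))"
proof -
  let ?m = "of_int m :: real"
  have "?m\<^sup>2 \<le> 2 * (s + ?m)\<^sup>2 + 2 * s\<^sup>2"
    using zero_le_power2[of "?m + 2 * s"] by (simp add: power2_eq_square algebra_simps)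
  then have "- b * (s + ?m)\<^sup>2 \<le> b * s\<^sup>2 - b * ?m\<^sup>2 / 2"
    using mult_left_mono[of "?m\<^sup>2" "2 * (s + ?m)\<^sup>2 + 2 * s\<^sup>2" b] assms by (simp add: algebra_simps)
  then have "exp (- b * (s + ?m)\<^sup>2) \<le> exp (b * s\<^sup>2) * exp (- (b * ?m\<^sup>2 / 2))"
    by (simp add: exp_diff[symmetric] exp_minus[symmetric] exp_add[symmetric])
  also have "exp (- (b * ?m\<^sup>2 / 2)) \<le> 1 / (1 + b * ?m\<^sup>2 / 2)"
  proof -
    have "1 + b * ?m\<^sup>2 / 2 \<le> exp (b * ?m\<^sup>2 / 2)" by (rule exp_ge_add_one_self)
    moreover have "0 < 1 + b * ?m\<^sup>2 / 2" using assms by (simp add: add_pos_nonneg)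
    ultimately show ?thesis by (simp add: exp_minus field_simps)
  qed
  also have "\<dots> \<le> (1 + 2 / b) * (1 / (1 + ?m\<^sup>2))"
  proof -
    have 1: "0 < 1 + b * ?m\<^sup>2 / 2" "0 < 1 + ?m\<^sup>2" using assms by (simp_all add: add_pos_nonneg)
    have "(1 + ?m\<^sup>2) \<le> (1 + 2 / b) * (1 + b * ?m\<^sup>2 / 2)"
      using assms by (simp add: field_simps)
    then show ?thesis using 1 by (simp add: field_simps)
  qed
  finally show ?thesis by simp
qed

lemma theta_summable:
  fixes b s :: real
  assumes "b > 0"
  shows "(\<lambda>m::int. exp (- b * (s + of_int m)\<^sup>2)) summable_on UNIV"
proof (rule summable_on_nonneg_bounded)
  show "(\<lambda>m::int. exp (b * s\<^sup>2) * ((1 + 2 / b) * (1 / (1 + (of_int m)\<^sup>2)))) summable_on UNIV"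
    by (intro summable_on_cmult_right summable_on_int_inverse_squares)
qed (use exp_minus_square_le[OF assms] in auto)

lemma theta_0_le:
  assumes "b > 0"
  shows "theta b 0 \<le> (1 + 2 / b) * int_inverse_squares_sum"
proof -
  have "theta b 0 \<le> (\<Sum>\<^sub>\<infinity>m\<in>(UNIV::int set). (1 + 2 / b) * (1 / (1 + (of_int m)\<^sup>2)))"
    unfolding theta_def
    using exp_minus_square_le[OF assms, of 0] theta_summable[OF assms, of 0]
    by (intro infsum_mono summable_on_cmult_right summable_on_int_inverse_squares) auto
  also have "\<dots> = (1 + 2 / b) * int_inverse_squares_sum"
    unfolding int_inverse_squares_sum_def by (rule infsum_cmult_right') 
  finally show ?thesis .
qed

lemma theta_0_ge_1:
  assumes "b > 0"
  shows "theta b 0 \<ge> 1"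
proof -
  have "(\<Sum>m\<in>{0::int}. exp (- b * (0 + of_int m)\<^sup>2)) \<le> theta b 0"
    unfolding theta_def by (intro finite_sum_le_infsum theta_summable assms) auto
  then show ?thesis by simp
qed

lemma theta_periodic: "theta b (s + of_int m) = theta b s"
proof -
  have "theta b s = (\<Sum>\<^sub>\<infinity>k\<in>range (\<lambda>k. k + m). exp (- b * (s + of_int k)\<^sup>2))"
    by (simp add: theta_def surj_plus_right)
  also have "\<dots> = theta b (s + of_int m)"
    unfolding theta_def by (subst infsum_reindex) (auto simp: inj_on_def comp_def add_ac)
  finally show ?thesis ..
qed

text \<open>The characteristic function of the standard normal law, rescaled by
  \<open>sqrt (2 * b)\<close> and rotated by \<open>cis \<phi>\<close>.\<close>

lemma has_bochner_integral_gaussian_cos: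
  fixes b t \<phi> :: real
  assumes "b > 0"
  shows "has_bochner_integral lborel (\<lambda>x. exp (- b * x\<^sup>2) * cos (t * x + \<phi>))
           (sqrt (pi / b) * exp (- t\<^sup>2 / (4 * b)) * cos \<phi>)"
proof -
  interpret N: prob_space std_normal_distribution
    using real_dist_normal_dist real_distribution.axioms(1) by blast
  define T where "T = t / sqrt (2 * b)"
  have "(CLINT x|std_normal_distribution. iexp (T * x)) = complex_of_real (exp (- (T^2) / 2))"
    using char_std_normal_distribution by (simp add: char_def fun_eq_iff)
  then have char: "has_bochner_integral std_normal_distribution (\<lambda>x. iexp (T * x)) (complex_of_real (exp (- (T^2) / 2)))"
    using N.integrable_iexp[of "\<lambda>x. T * x"] by (simp add: has_bochner_integral_iff)
  have "has_bochner_integral std_normal_distribution (\<lambda>x. Re (iexp (T * x) * cis \<phi>)) (Re (complex_of_real (exp (- (T^2) / 2)) * cis \<phi>))"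
    by (intro has_bochner_integral_Re has_bochner_integral_mult_left char) 
  then have 1: "has_bochner_integral std_normal_distribution (\<lambda>x. cos (T * x + \<phi>)) (exp (- (T^2) / 2) * cos \<phi>)"
    unfolding cis_conv_exp[symmetric] cis_mult by simp
  have "has_bochner_integral lborel (\<lambda>x. std_normal_density x *\<^sub>R cos (T * x + \<phi>)) (exp (- (T^2) / 2) * cos \<phi>)"
    using 1 unfolding has_bochner_integral_iff
    by (simp add: integrable_density integral_density normal_density_nonneg)
  then have "has_bochner_integral lborel (\<lambda>x. std_normal_density (0 + sqrt (2 * b) * x) *\<^sub>R cos (T * (0 + sqrt (2 * b) * x) + \<phi>))
      ((exp (- (T^2) / 2) * cos \<phi>) /\<^sub>R \<bar>sqrt (2 * b)\<bar>)"
    by (subst (asm) lborel_has_bochner_integral_real_affine_iff[where c="sqrt (2 * b)" and t=0]) (use assms in auto)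
  then have "has_bochner_integral lborel (\<lambda>x. sqrt (2 * pi) * (std_normal_density (0 + sqrt (2 * b) * x) *\<^sub>R cos (T * (0 + sqrt (2 * b) * x) + \<phi>)))
      (sqrt (2 * pi) * ((exp (- (T^2) / 2) * cos \<phi>) /\<^sub>R \<bar>sqrt (2 * b)\<bar>))"
    by (rule has_bochner_integral_mult_right)
  moreover have "sqrt (2 * pi) * (std_normal_density (0 + sqrt (2 * b) * x) *\<^sub>R cos (T * (0 + sqrt (2 * b) * x) + \<phi>))
      = exp (- b * x\<^sup>2) * cos (t * x + \<phi>)" for x
    using assms by (simp add: std_normal_density_def T_def power_mult_distrib)
  moreover have "sqrt (2 * pi) * ((exp (- (T^2) / 2) * cos \<phi>) /\<^sub>R \<bar>sqrt (2 * b)\<bar>) = sqrt (pi / b) * exp (- t\<^sup>2 / (4 * b)) * cos \<phi>"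
    using assms by (simp add: T_def power_divide real_sqrt_mult real_sqrt_divide field_simps)
  ultimately show ?thesis by (simp only:)
qed

text \<open>The first \<open>P\<close> pairs exhaust the integers from \<open>- P\<close> to
  \<open>P - 1\<close>, so the corresponding translates of the unit interval tile
  \<open>{- P..P}\<close> exactly.\<close>

abbreviation theta_pair :: "real \<Rightarrow> real \<Rightarrow> nat \<Rightarrow> real" where
  "theta_pair b s k \<equiv> exp (- b * (s + of_int (int k))\<^sup>2) + exp (- b * (s + of_int (- int k - 1))\<^sup>2)"

lemma theta_uniform_limit:
  assumes "b > 0" "R \<ge> 0"
  shows "uniform_limit {-R..R} (\<lambda>P s. \<Sum>k<P. theta_pair b s k)
    (theta b) sequentially"
proof -
  define c where "c = exp (b * R\<^sup>2) * (1 + 2 / b)"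
  define M where "M k = c * (1 / (1 + (of_int (int k))\<^sup>2)) + c * (1 / (1 + (of_int (- int k - 1))\<^sup>2))" for k
  have c0: "c \<ge> 0" using assms by (simp add: c_def)
  have "summable M"
    unfolding M_def
    by (rule sums_summable[OF sums_infsum_int]) (intro summable_on_cmult_right summable_on_int_inverse_squares)
  moreover have 1: "exp (- b * (s + of_int m)\<^sup>2) \<le> c * (1 / (1 + (of_int m)\<^sup>2))" if "s \<in> {-R..R}" for s m
  proof -
    have "s\<^sup>2 \<le> R\<^sup>2" using that by (metis abs_le_iff abs_le_square_iff abs_of_nonneg assms(2) atLeastAtMost_iff minus_le_iff)
    then have "exp (b * s\<^sup>2) * (1 + 2 / b) \<le> c" unfolding c_def
      using assms by (intro mult_right_mono) (simp_all add: mult_left_mono)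
    then have "exp (b * s\<^sup>2) * (1 + 2 / b) * (1 / (1 + (of_int m)\<^sup>2)) \<le> c * (1 / (1 + (of_int m)\<^sup>2))"
      by (rule mult_right_mono) simp
    then show ?thesis using exp_minus_square_le[OF assms(1), of s m] by simp
  qed
  have 2: "norm (theta_pair b s k) \<le> M k"
    if "s \<in> {-R..R}" for s k
  proof -
    have "0 \<le> exp (- b * (s + of_int (int k))\<^sup>2)" "0 \<le> exp (- b * (s + of_int (- int k - 1))\<^sup>2)" by simp_all
    then show ?thesis unfolding M_def real_norm_def
      using 1[OF that, of "int k"] 1[OF that, of "- int k - 1"] by linarith
  qed
  ultimately have "uniform_limit {-R..R} (\<lambda>P s. \<Sum>k<P. theta_pair b s k)
    (\<lambda>s. \<Sum>k. theta_pair b s k) sequentially"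
    by (intro Weierstrass_m_test[where M = M])
  moreover have "(\<Sum>k. theta_pair b s k) = theta b s" for s
    using sums_infsum_int[OF theta_summable[OF assms(1), of s]] unfolding theta_def by (simp add: sums_iff)
  ultimately show ?thesis by simp
qed

lemma theta_continuous_on: "b > 0 \<Longrightarrow> continuous_on A (theta b)"
proof (rule continuous_on_subset[OF _ subset_UNIV])
  assume b: "b > 0"
  have "isCont (theta b) x" for x
  proof -
    have "continuous_on {-(\<bar>x\<bar> + 1)..\<bar>x\<bar> + 1} (theta b)"
      by (rule uniform_limit_theorem[OF always_eventually theta_uniform_limit[OF b]])
         (auto intro!: continuous_intros)
    then show ?thesis
      by (rule continuous_on_interior) (auto simp: abs_if)
  qed
  then show "continuous_on UNIV (theta b)" by (simp add: continuous_at_imp_continuous_on)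
qed

section \<open>Fourier coefficients of theta and Poisson summation\<close>

lemma integral_cos_int:
  fixes m :: int
  shows "integral {0..1} (\<lambda>s. cos (2 * pi * of_int m * s + \<phi>)) = (if m = 0 then cos \<phi> else 0)"
proof (cases "m = 0")
  case False
  let ?F = "\<lambda>s. sin (2 * pi * of_int m * s + \<phi>) / (2 * pi * of_int m)"
  have "((\<lambda>s. cos (2 * pi * of_int m * s + \<phi>)) has_integral (?F 1 - ?F 0)) {0..1}"
    by (rule fundamental_theorem_of_calculus)
       (use False in \<open>auto intro!: derivative_eq_intros simp flip: has_real_derivative_iff_has_vector_derivative\<close>)
  moreover have "sin (2 * pi * of_int m + \<phi>) = sin \<phi>"
    using sin_int_2pin[of m] cos_int_2pin[of m] by (simp add: sin_add mult_ac)
  ultimately show ?thesis using False by (simp add: integral_unique)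
qed simp

text \<open>Unfolding: since the cosine factor has period 1, summing over integer translates turns
  an integral over one period into an integral over the line.\<close>

lemma theta_fourier_coeff:
  fixes n :: int
  assumes b: "b > 0"
  shows "integral {0..1} (\<lambda>s. theta b s * cos (2 * pi * of_int n * s + \<phi>))
     = sqrt (pi / b) * exp (- pi\<^sup>2 * (of_int n)\<^sup>2 / b) * cos \<phi>"
proof -
  define C where "C s = cos (2 * pi * of_int n * s + \<phi>)" for s
  have Cper: "C (s + of_int m) = C s" for s m
  proof -
    have "C (s + of_int m) = cos ((2 * pi * of_int n * s + \<phi>) + 2 * pi * of_int (n * m))"
      by (simp add: C_def algebra_simps)
    also have "\<dots> = C s"
      using sin_int_2pin[of "n*m"] cos_int_2pin[of "n*m"] by (simp add: C_def cos_add)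
    finally show ?thesis .
  qed
  have Ccont: "continuous_on S C" for S unfolding C_def by (intro continuous_intros)
  define g where "g x = exp (- b * x\<^sup>2) * C x" for x
  have gcont: "continuous_on S g" for S unfolding g_def by (intro continuous_intros Ccont)
  have gi: "g integrable_on {a..c}" for a c by (intro integrable_continuous_real gcont)
  have gsh: "integral {0..1} (\<lambda>s. g (s + of_int m)) = integral {of_int m..of_int m + 1} g" for m
    using integral_shift_real_ivl[where a="of_int m" and b="of_int m + 1" and c="of_int m" and f=g] by simp
  define S where "S P s = (\<Sum>k<P. theta_pair b s k) * C s" for P s
  have S_eq: "S P s = (\<Sum>k<P. g (s + of_int (int k)) + g (s + of_int (- int k - 1)))" for P s
    unfolding S_def g_def Cper sum_distrib_right distrib_right ..
  have Scont: "continuous_on A (S P)" for A P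
    unfolding S_def by (intro continuous_intros Ccont)
  have S_int: "integral {0..1} (S P) = integral {- real P..real P} g" for P
  proof (induction P)
    case 0
    then show ?case by (simp add: S_def)
  next
    case (Suc P)
    have i: "(\<lambda>s. g (s + of_int m)) integrable_on {0..1}" for m
      by (intro integrable_continuous_real continuous_on_compose2[OF gcont[of UNIV]] continuous_intros) auto
    have "integral {0..1} (S (Suc P)) = integral {0..1} (\<lambda>s. S P s + (g (s + of_int (int P)) + g (s + of_int (- int P - 1))))"
      by (intro arg_cong[where f="integral {0..1}"] ext) (simp only: S_eq sum.lessThan_Suc)
    also have "\<dots> = integral {0..1} (S P) + (integral {0..1} (\<lambda>s. g (s + of_int (int P))) + integral {0..1} (\<lambda>s. g (s + of_int (- int P - 1))))"
      by (rule integral_unique, intro has_integral_add integrable_integral i integrable_continuous_real Scont)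
    also have "\<dots> = integral {- real P..real P} g + (integral {real P..real P + 1} g + integral {- real P - 1..- real P} g)"
      unfolding Suc.IH gsh by simp
    also have "\<dots> = integral {- real (Suc P)..real (Suc P)} g"
    proof -
      have "integral {- real P - 1..- real P} g + integral {- real P..real P} g = integral {- real P - 1..real P} g"
        by (rule Henstock_Kurzweil_Integration.integral_combine) (auto intro: gi)
      moreover have "integral {- real P - 1..real P} g + integral {real P..real P + 1} g = integral {- real P - 1..real P + 1} g"
        by (rule Henstock_Kurzweil_Integration.integral_combine) (auto intro: gi)
      moreover have "- real (Suc P) = - real P - 1" "real (Suc P) = real P + 1" by simp_all
      ultimately show ?thesis by (simp only:)
    qed
    finally show ?case .
  qed
  have ul: "uniform_limit {0..1} S (\<lambda>s. theta b s * C s) sequentially"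
  proof -
    have "uniform_limit {0..1} (\<lambda>P s. \<Sum>k<P. theta_pair b s k) (theta b) sequentially"
      by (rule uniform_limit_on_subset[OF theta_uniform_limit[OF b, of 1]]) auto
    then show ?thesis unfolding S_def
      by (intro uniform_lim_mult uniform_limit_const compact_imp_bounded compact_continuous_image theta_continuous_on[OF b] Ccont) auto
  qed
  obtain I J where IJ: "\<And>P. (S P has_integral I P) {0..1}" "((\<lambda>s. theta b s * C s) has_integral J) {0..1}" "I \<longlonglongrightarrow> J"
    by (rule uniform_limit_integral[OF ul]) (auto intro: Scont)
  have hb: "has_bochner_integral lborel g (sqrt (pi / b) * exp (- (2 * pi * of_int n)\<^sup>2 / (4 * b)) * cos \<phi>)"
    unfolding g_def C_def by (rule has_bochner_integral_gaussian_cos[OF b])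
  have gint: "integrable lborel g" using hb by (simp add: has_bochner_integral_iff)
  \<comment> \<open>The same sequence \<open>I\<close> converges to the integral over the period by
    uniform convergence, and to the integral over the line by dominated convergence.\<close>
  have "(\<lambda>P. LINT x|lborel. indicator {- real P..real P} x * g x) \<longlonglongrightarrow> (LINT x|lborel. g x)"
  proof (rule integral_dominated_convergence[where w="\<lambda>x. norm (g x)"])
    show "AE x in lborel. (\<lambda>P. indicator {- real P..real P} x * g x) \<longlonglongrightarrow> g x"
    proof (rule AE_I2)
      fix x
      have "\<forall>\<^sub>F P in sequentially. real P \<ge> \<bar>x\<bar>"
        using filterlim_real_sequentially by (auto simp: filterlim_at_top)
      then have "\<forall>\<^sub>F P in sequentially. indicator {- real P..real P} x * g x = g x"
        by eventually_elim (auto simp: abs_le_iff)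
      then show "(\<lambda>P. indicator {- real P..real P} x * g x) \<longlonglongrightarrow> g x" by (rule tendsto_eventually)
    qed
  qed (use gint in \<open>auto simp: indicator_def\<close>)
  moreover have "(LINT x|lborel. indicator {- real P..real P} x * g x) = I P" for P
  proof -
    have "set_integrable lborel {- real P..real P} g"
      using gint integrable_mult_indicator[of "{- real P..real P}" lborel g] unfolding set_integrable_def by simp
    from set_borel_integral_eq_integral(2)[OF this]
    show ?thesis using S_int[of P] IJ(1)[of P] by (simp add: set_lebesgue_integral_def integral_unique)
  qed
  ultimately have "I \<longlonglongrightarrow> (LINT x|lborel. g x)" by simp
  then have "J = (LINT x|lborel. g x)" using IJ(3) LIMSEQ_unique by blast
  also have "\<dots> = sqrt (pi / b) * exp (- (2 * pi * of_int n)\<^sup>2 / (4 * b)) * cos \<phi>"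
    using hb by (simp add: has_bochner_integral_iff)
  finally show ?thesis using IJ(2) by (simp add: C_def integral_unique power_mult_distrib)
qed

text \<open>Natural indices suffice because the coefficients at \<open>n\<close> and
  \<open>- n\<close> agree; this is the source of the factor 2 in the cosine series.\<close>

definition theta_coeff :: "real \<Rightarrow> nat \<Rightarrow> real" where
  "theta_coeff b n = sqrt (pi / b) * exp (- pi\<^sup>2 * (real n)\<^sup>2 / b)"

lemma theta_coeff_pos: "b > 0 \<Longrightarrow> theta_coeff b n > 0"
  by (simp add: theta_coeff_def)

lemma summable_theta_coeff:
  assumes "b > 0"
  shows "summable (theta_coeff b)"
proof -
  have "(\<lambda>m::int. exp (- (pi\<^sup>2 / b) * (0 + of_int m)\<^sup>2)) summable_on UNIV"
    by (rule theta_summable) (use assms in simp)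
  then have "(\<lambda>m::int. exp (- (pi\<^sup>2 / b) * (0 + of_int m)\<^sup>2)) summable_on range int"
    using summable_on_subset_banach by blast
  then have "(\<lambda>n::nat. exp (- (pi\<^sup>2 / b) * (real n)\<^sup>2)) summable_on UNIV"
    by (subst (asm) summable_on_reindex) (auto simp: comp_def)
  then have "summable (\<lambda>n::nat. exp (- (pi\<^sup>2 / b) * (real n)\<^sup>2))"
    by (rule summable_on_imp_summable)
  then show ?thesis unfolding theta_coeff_def by (intro summable_mult) simp
qed

text \<open>The theta function and its cosine series are continuous, of period 1, and have equal
  Fourier coefficients, so \<open>fourier_zero\<close> applies to their difference.\<close>

lemma theta_poisson:
  assumes b: "b > 0"
  shows "(\<lambda>n. 2 * theta_coeff b (Suc n) * cos (2 * pi * real (Suc n) * s)) sums (theta b s - theta_coeff b 0)"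
proof -
  define t where "t n s = 2 * theta_coeff b (Suc n) * cos (2 * pi * real (Suc n) * s)" for n s
  define S where "S s = (\<Sum>n. t n s)" for s
  have sm: "summable (\<lambda>n. 2 * theta_coeff b (Suc n))"
    using summable_theta_coeff[OF b] by (intro summable_mult) (subst summable_Suc_iff)
  have tb: "norm (t n s) \<le> 2 * theta_coeff b (Suc n)" for n s
    using theta_coeff_pos[OF b, of "Suc n"] by (simp add: t_def abs_mult)
  have ul: "uniform_limit UNIV (\<lambda>P s. \<Sum>n<P. t n s) S sequentially"
    unfolding S_def by (rule Weierstrass_m_test[OF tb sm])
  have tcont: "continuous_on A (t n)" for A n unfolding t_def by (intro continuous_intros)
  have "continuous_on UNIV S"
    by (rule uniform_limit_theorem[OF always_eventually ul]) (auto intro!: continuous_intros tcont)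
  then have Scont: "continuous_on A S" for A using continuous_on_subset by blast
  have tper: "t n (s + of_int m) = t n s" for n s m
  proof -
    have "cos (2 * pi * real (Suc n) * (s + of_int m)) = cos (2 * pi * real (Suc n) * s + 2 * pi * of_int (int (Suc n) * m))"
      by (simp add: algebra_simps)
    also have "\<dots> = cos (2 * pi * real (Suc n) * s)"
      using sin_int_2pin[of "int (Suc n) * m"] cos_int_2pin[of "int (Suc n) * m"] by (simp add: cos_add)
    finally show ?thesis by (simp only: t_def)
  qed
  have S_coeff: "integral {0..1} (\<lambda>s. S s * cos (2 * pi * of_int n * s + \<phi>))
      = (if n = 0 then 0 else theta_coeff b (nat \<bar>n\<bar>) * cos \<phi>)" for n \<phi>
  proof -
    let ?C = "\<lambda>s. cos (2 * pi * of_int n * s + \<phi>)"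
    have Cc: "continuous_on A ?C" for A by (intro continuous_intros)
    have "uniform_limit {0..1} (\<lambda>P s. (\<Sum>n<P. t n s) * ?C s) (\<lambda>s. S s * ?C s) sequentially"
      by (intro uniform_lim_mult uniform_limit_const uniform_limit_on_subset[OF ul] compact_imp_bounded
           compact_continuous_image Scont Cc) auto
    then obtain I J where IJ: "\<And>P. ((\<lambda>s. (\<Sum>n<P. t n s) * ?C s) has_integral I P) {0..1}"
        "((\<lambda>s. S s * ?C s) has_integral J) {0..1}" "I \<longlonglongrightarrow> J"
      by (rule uniform_limit_integral) (auto intro!: continuous_intros tcont)
    have tk: "integral {0..1} (\<lambda>s. t k s * ?C s) = (if int (Suc k) = \<bar>n\<bar> then theta_coeff b (Suc k) * cos \<phi> else 0)" for k
    proof -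
      have ci: "(\<lambda>s. cos (2 * pi * of_int m * s + \<psi>)) integrable_on {0..1}" for m \<psi>
        by (intro integrable_continuous_real continuous_intros)
      have "t k s * ?C s = theta_coeff b (Suc k) * (cos (2 * pi * of_int (n - int (Suc k)) * s + \<phi>) + cos (2 * pi * of_int (n + int (Suc k)) * s + \<phi>))" for s
        unfolding t_def mult.assoc cos_times_cos
        using cos_minus[of "2 * pi * (real (Suc k) * s) - (2 * pi * (of_int n * s) + \<phi>)"]
        by (simp add: algebra_simps)
      then have "integral {0..1} (\<lambda>s. t k s * ?C s) = theta_coeff b (Suc k) *
         (integral {0..1} (\<lambda>s. cos (2 * pi * of_int (n - int (Suc k)) * s + \<phi>)) + integral {0..1} (\<lambda>s. cos (2 * pi * of_int (n + int (Suc k)) * s + \<phi>)))"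
        by (simp only: integral_mult_right Henstock_Kurzweil_Integration.integral_add[OF ci ci])
      then show ?thesis unfolding integral_cos_int by auto
    qed
    have "I P = (\<Sum>k<P. integral {0..1} (\<lambda>s. t k s * ?C s))" for P
      using IJ(1)[of P] unfolding sum_distrib_right
      by (subst Henstock_Kurzweil_Integration.integral_sum[symmetric])
         (auto intro!: integrable_continuous_real continuous_intros tcont simp: integral_unique)
    then have I_eq: "I P = (\<Sum>k<P. if int (Suc k) = \<bar>n\<bar> then theta_coeff b (Suc k) * cos \<phi> else 0)" for P
      unfolding tk .
    have "I P = (if n = 0 then 0 else theta_coeff b (nat \<bar>n\<bar>) * cos \<phi>)" if "P \<ge> nat \<bar>n\<bar>" for P
    proof (cases "n = 0")
      case False
      define k0 where "k0 = nat \<bar>n\<bar> - 1"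
      have k0: "Suc k0 = nat \<bar>n\<bar>" using False by (simp add: k0_def)
      have "int (Suc k) = \<bar>n\<bar> \<longleftrightarrow> k = k0" for k using k0 by linarith
      then show ?thesis using False k0 that unfolding I_eq by simp
    qed (simp add: I_eq)
    then have "\<forall>\<^sub>F P in sequentially. I P = (if n = 0 then 0 else theta_coeff b (nat \<bar>n\<bar>) * cos \<phi>)"
      using eventually_ge_at_top by (rule eventually_mono[rotated])
    then have "I \<longlonglongrightarrow> (if n = 0 then 0 else theta_coeff b (nat \<bar>n\<bar>) * cos \<phi>)" by (rule tendsto_eventually)
    then have "J = (if n = 0 then 0 else theta_coeff b (nat \<bar>n\<bar>) * cos \<phi>)" using IJ(3) LIMSEQ_unique by blast
    then show ?thesis using IJ(2) integral_unique by blast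
  qed
  have "theta b s - theta_coeff b 0 - S s = 0"
  proof (rule fourier_zero[where f = "\<lambda>s. theta b s - theta_coeff b 0 - S s"])
    show "continuous_on UNIV (\<lambda>s. theta b s - theta_coeff b 0 - S s)"
      by (intro continuous_intros theta_continuous_on b Scont)
    show "theta b (s + of_int m) - theta_coeff b 0 - S (s + of_int m) = theta b s - theta_coeff b 0 - S s" for s m
      unfolding theta_periodic S_def tper ..
    fix n :: int and \<phi> :: real
    let ?C = "\<lambda>s. cos (2 * pi * of_int n * s + \<phi>)"
    have Cc: "continuous_on A ?C" for A by (intro continuous_intros)
    have "integral {0..1} (\<lambda>s. (theta b s - theta_coeff b 0 - S s) * ?C s)
        = integral {0..1} (\<lambda>s. theta b s * ?C s) - theta_coeff b 0 * integral {0..1} ?C - integral {0..1} (\<lambda>s. S s * ?C s)"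
      unfolding left_diff_distrib
      by (subst Henstock_Kurzweil_Integration.integral_diff
          integral_mult_right, (intro integrable_diff integrable_continuous_real continuous_intros theta_continuous_on b Scont)+)+ simp
    also have "\<dots> = 0"
      unfolding theta_fourier_coeff[OF b] integral_cos_int S_coeff by (auto simp: theta_coeff_def)
    finally show "integral {0..1} (\<lambda>s. (theta b s - theta_coeff b 0 - S s) * ?C s) = 0" .
  qed
  then have "theta b s - theta_coeff b 0 = S s" by simp
  moreover have "summable (\<lambda>n. t n s)"
    by (rule summable_comparison_test'[OF sm tb])
  ultimately show ?thesis unfolding S_def t_def by (simp add: summable_sums)
qed

section \<open>Sampling with the de la Vallee Poussin kernel\<close>

lemma sum_cis_roots:
  fixes l :: int and M :: nat
  assumes "M > 0"
  shows "(\<Sum>j<M. cis (2 * pi * of_int l * real j / real M)) = (if int M dvd l then of_nat M else 0)"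
proof -
  define w where "w = cis (2 * pi * of_int l / real M)"
  have pw: "cis (2 * pi * of_int l * real j / real M) = w ^ j" for j
    unfolding w_def Complex.DeMoivre by (intro arg_cong[where f=cis]) simp
  show ?thesis
  proof (cases "int M dvd l")
    case True
    then obtain q where "l = int M * q" by blast
    then have "2 * pi * of_int l / real M = 2 * pi * of_int q" using assms by simp
    then have "w = 1" by (simp only: w_def cis_multiple_2pi[OF Ints_of_int])
    then show ?thesis using True by (simp add: pw)
  next
    case False
    have "w \<noteq> 1"
    proof
      assume "w = 1"
      then have "cos (2 * pi * of_int l / real M) = 1" by (simp add: w_def complex_eq_iff)
      then obtain q :: int where "2 * pi * of_int l / real M = of_int q * 2 * pi" using cos_one_2pi_int by blast
      then have "real_of_int l = of_int (q * int M)" using assms by (simp add: field_simps)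
      then have "l = q * int M" by linarith
      then show False using False by simp
    qed
    moreover have "w ^ M = 1"
    proof -
      have "real M * (2 * pi * of_int l / real M) = 2 * pi * of_int l" using assms by simp
      then show ?thesis by (simp only: w_def Complex.DeMoivre cis_multiple_2pi[OF Ints_of_int])
    qed
    ultimately show ?thesis using False by (simp add: pw geometric_sum)
  qed
qed

text \<open>Below the aliasing threshold \<open>M\<close> the grid integrates exponentials exactly,
  from whatever offset \<open>x\<close>.\<close>

lemma sum_cis_shifted:
  fixes l :: int and M :: nat and x :: real
  assumes "M > 0" "\<bar>l\<bar> < int M"
  shows "(\<Sum>j<M. cis (2 * pi * of_int l * (x - real j / real M))) = (if l = 0 then of_nat M else 0)"
proof -
  have "(\<Sum>j<M. cis (2 * pi * of_int l * (x - real j / real M)))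
      = cis (2 * pi * of_int l * x) * (\<Sum>j<M. cis (2 * pi * of_int (- l) * real j / real M))"
    unfolding sum_distrib_left cis_mult by (intro sum.cong refl arg_cong[where f=cis]) (simp add: algebra_simps)
  also have "\<dots> = (if l = 0 then of_nat M else 0)"
    unfolding sum_cis_roots[OF assms(1)] using assms(2) by (auto dest: zdvd_imp_le dvd_imp_le_int)
  finally show ?thesis .
qed

abbreviation freqs :: "nat \<Rightarrow> int set" where
  "freqs N \<equiv> {- int N..int N}"

text \<open>Differences of frequencies are at most \<open>2 * b < M\<close>, so the exponentials are
  orthogonal on the grid.\<close>

lemma discrete_parseval:
  fixes a :: "int \<Rightarrow> complex"
  assumes M: "M > 2 * b"
  shows "(\<Sum>j<M. (cmod (\<Sum>n\<in>freqs b. a n * cis (2 * pi * of_int n * (x - real j / real M))))\<^sup>2)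
    = real M * (\<Sum>n\<in>freqs b. (cmod (a n))\<^sup>2)"
proof -
  let ?I = "freqs b"
  let ?y = "\<lambda>j. x - real j / real M"
  have e: "complex_of_real ((cmod (\<Sum>n\<in>?I. a n * cis (2 * pi * of_int n * y)))\<^sup>2)
    = (\<Sum>n\<in>?I. \<Sum>m\<in>?I. a n * cnj (a m) * cis (2 * pi * of_int (n - m) * y))" for y
    unfolding complex_norm_square cnj_sum sum_product
    by (intro sum.cong refl) (simp add: cis_cnj cis_mult algebra_simps)
  have "complex_of_real (\<Sum>j<M. (cmod (\<Sum>n\<in>?I. a n * cis (2 * pi * of_int n * ?y j)))\<^sup>2)
     = (\<Sum>j<M. \<Sum>n\<in>?I. \<Sum>m\<in>?I. a n * cnj (a m) * cis (2 * pi * of_int (n - m) * ?y j))"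
    unfolding of_real_sum e ..
  also have "\<dots> = (\<Sum>n\<in>?I. \<Sum>m\<in>?I. a n * cnj (a m) * (\<Sum>j<M. cis (2 * pi * of_int (n - m) * ?y j)))"
    unfolding sum_distrib_left by (subst sum.swap, intro sum.cong refl, subst sum.swap) simp
  also have "\<dots> = (\<Sum>n\<in>?I. \<Sum>m\<in>?I. if m = n then a n * cnj (a m) * of_nat M else 0)"
  proof (intro sum.cong refl)
    fix n m assume "n \<in> ?I" "m \<in> ?I"
    then have "\<bar>n - m\<bar> < int M" using M by auto
    then show "a n * cnj (a m) * (\<Sum>j<M. cis (2 * pi * of_int (n - m) * ?y j)) = (if m = n then a n * cnj (a m) * of_nat M else 0)"
      using sum_cis_shifted[of M "n - m" x] M by auto
  qed
  also have "\<dots> = (\<Sum>n\<in>?I. a n * cnj (a n) * of_nat M)"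
    by (intro sum.cong refl) simp
  also have "\<dots> = complex_of_real (real M * (\<Sum>n\<in>?I. (cmod (a n))\<^sup>2))"
    by (simp add: sum_distrib_left complex_norm_square[symmetric] mult_ac del: of_real_power)
  finally show ?thesis using of_real_eq_iff by blast
qed

text \<open>The de la Vallee Poussin kernel for the grid of \<open>8N\<close> equispaced points: the product of the
  Dirichlet kernels of orders \<open>N\<close> and \<open>2N\<close>, so that its Fourier coefficients are constant on
  \<open>|n| \<le> N\<close>. The index \<open>r\<close> counts derivatives.\<close>

definition vp_complex :: "nat \<Rightarrow> nat \<Rightarrow> real \<Rightarrow> complex" where
  "vp_complex N r x = (\<Sum>p\<in>freqs N. \<Sum>q\<in>freqs (2*N).
     (2 * pi * \<i> * of_int (p + q)) ^ r * cis (2 * pi * of_int (p + q) * x)) / of_nat ((2 * N + 1) * (8 * N))"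

definition vp :: "nat \<Rightarrow> nat \<Rightarrow> real \<Rightarrow> real" where
  "vp N r x = Re (vp_complex N r x)"

lemma vp_periodic: "vp N r (x + of_int m) = vp N r x"
proof -
  have "cis (2 * pi * of_int l * (x + of_int m)) = cis (2 * pi * of_int l * x)" for l
  proof -
    have "cis (2 * pi * of_int l * (x + of_int m)) = cis (2 * pi * of_int l * x) * cis (2 * pi * of_int (l * m))"
      by (simp add: cis_mult algebra_simps)
    then show ?thesis by (simp only: cis_multiple_2pi[OF Ints_of_int]) simp
  qed
  then show ?thesis by (simp only: vp_def vp_complex_def)
qed

lemma vp_has_derivative: "(vp N r has_real_derivative vp N (Suc r) x) (at x)"
proof -
  have "((\<lambda>x. cis (a * x)) has_vector_derivative (\<i> * a * cis (a * x))) (at x)" for a :: real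
  proof -
    have "((\<lambda>x. Complex (cos (a * x)) (sin (a * x))) has_vector_derivative Complex (- a * sin (a * x)) (a * cos (a * x))) (at x)"
      unfolding has_vector_derivative_complex_iff by (auto intro!: derivative_eq_intros)
    then show ?thesis by (simp add: cis.ctr complex_eq_iff[of "\<i> * a * _"] has_vector_derivative_complex_iff)
  qed
  then have "((\<lambda>x. c * cis (2 * pi * of_int l * x)) has_vector_derivative (c * (\<i> * complex_of_real (2 * pi * of_int l) * cis (2 * pi * of_int l * x)))) (at x)" for c l
    by (intro has_vector_derivative_mult_right)
  then have "((\<lambda>x. c * cis (2 * pi * of_int l * x)) has_vector_derivative (c * (2 * pi * \<i> * of_int l) * cis (2 * pi * of_int l * x))) (at x)" for c l
    by (rule back_subst[where P="\<lambda>D. (_ has_vector_derivative D) _"]) simp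
  then have "((\<lambda>x. (2 * pi * \<i> * of_int l) ^ r * cis (2 * pi * of_int l * x)) has_vector_derivative ((2 * pi * \<i> * of_int l) ^ Suc r * cis (2 * pi * of_int l * x))) (at x)" for l
    unfolding power_Suc2 .
  then have "(vp_complex N r has_vector_derivative vp_complex N (Suc r) x) (at x)"
    unfolding vp_complex_def by (intro has_vector_derivative_divide has_vector_derivative_sum)
  then show ?thesis
    unfolding vp_def by (simp add: has_vector_derivative_complex_iff)
qed

lemma sum_swap3:
  "(\<Sum>p\<in>A. \<Sum>q\<in>B. \<Sum>i\<in>C. f p q i) = (\<Sum>i\<in>C. \<Sum>p\<in>A. \<Sum>q\<in>B. f p q i)"
proof -
  have "(\<Sum>p\<in>A. \<Sum>q\<in>B. \<Sum>i\<in>C. f p q i) = (\<Sum>p\<in>A. \<Sum>i\<in>C. \<Sum>q\<in>B. f p q i)"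
    by (intro sum.cong refl sum.swap)
  also have "\<dots> = (\<Sum>i\<in>C. \<Sum>p\<in>A. \<Sum>q\<in>B. f p q i)" by (rule sum.swap)
  finally show ?thesis .
qed

text \<open>The Leibniz rule: expanding \<open>(p + q) ^ r\<close> binomially separates the two
  Dirichlet kernels and prepares the Cauchy--Schwarz inequality.\<close>

lemma vp_complex_norm_le:
  "cmod (vp_complex N r x) \<le> (2 * pi) ^ r / real ((2 * N + 1) * (8 * N)) *
    (\<Sum>i\<le>r. real (r choose i) *
      (cmod (\<Sum>p\<in>freqs N. of_int p ^ i * cis (2 * pi * of_int p * x)) *
       cmod (\<Sum>q\<in>freqs (2*N). of_int q ^ (r - i) * cis (2 * pi * of_int q * x))))"
proof -
  let ?A = "\<lambda>i. \<Sum>p\<in>freqs N. of_int p ^ i * cis (2 * pi * of_int p * x)"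
  let ?B = "\<lambda>i. \<Sum>q\<in>freqs (2*N). of_int q ^ i * cis (2 * pi * of_int q * x)"
  have "(\<Sum>p\<in>freqs N. \<Sum>q\<in>freqs (2*N).
     (2 * pi * \<i> * of_int (p + q)) ^ r * cis (2 * pi * of_int (p + q) * x))
    = (\<Sum>p\<in>freqs N. \<Sum>q\<in>freqs (2*N). \<Sum>i\<le>r. (2 * pi * \<i>) ^ r * of_nat (r choose i) *
        ((of_int p ^ i * cis (2 * pi * of_int p * x)) * (of_int q ^ (r - i) * cis (2 * pi * of_int q * x))))"
  proof (intro sum.cong refl)
    fix p q :: int
    have "(2 * pi * \<i> * of_int (p + q)) ^ r = (2 * pi * \<i>) ^ r * (\<Sum>i\<le>r. of_nat (r choose i) * of_int p ^ i * of_int q ^ (r - i))"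
      by (simp add: power_mult_distrib binomial_ring)
    moreover have "cis (2 * pi * of_int (p + q) * x) = cis (2 * pi * of_int p * x) * cis (2 * pi * of_int q * x)"
      by (simp add: cis_mult algebra_simps)
    ultimately show "(2 * pi * \<i> * of_int (p + q)) ^ r * cis (2 * pi * of_int (p + q) * x)
      = (\<Sum>i\<le>r. (2 * pi * \<i>) ^ r * of_nat (r choose i) *
        ((of_int p ^ i * cis (2 * pi * of_int p * x)) * (of_int q ^ (r - i) * cis (2 * pi * of_int q * x))))"
      by (simp only: sum_distrib_left sum_distrib_right mult_ac)
  qed
  also have "\<dots> = (\<Sum>i\<le>r. (2 * pi * \<i>) ^ r * of_nat (r choose i) * (?A i * ?B (r - i)))"
  proof -
    have e: "c * (?A i * ?B k) = (\<Sum>p\<in>freqs N. \<Sum>q\<in>freqs (2*N).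
        c * ((of_int p ^ i * cis (2 * pi * of_int p * x)) * (of_int q ^ k * cis (2 * pi * of_int q * x))))" for c i k
      by (subst sum_product) (simp only: sum_distrib_left)
    show ?thesis by (subst sum_swap3, intro sum.cong refl) (rule e[symmetric])
  qed
  finally have "vp_complex N r x = (\<Sum>i\<le>r. (2 * pi * \<i>) ^ r * of_nat (r choose i) * (?A i * ?B (r - i))) / of_nat ((2 * N + 1) * (8 * N))"
    by (simp only: vp_complex_def)
  then have "cmod (vp_complex N r x) = cmod (\<Sum>i\<le>r. (2 * pi * \<i>) ^ r * of_nat (r choose i) * (?A i * ?B (r - i))) / real ((2 * N + 1) * (8 * N))"
    by (simp only: norm_divide norm_of_nat)
  also have "\<dots> \<le> (\<Sum>i\<le>r. (2 * pi) ^ r * real (r choose i) * (cmod (?A i) * cmod (?B (r - i)))) / real ((2 * N + 1) * (8 * N))"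
    by (intro divide_right_mono order.trans[OF norm_sum] sum_mono) (simp_all add: norm_mult norm_power)
  finally show ?thesis by (simp add: sum_distrib_left mult_ac sum_divide_distrib)
qed

text \<open>Cauchy--Schwarz, and the discrete Parseval identity for both factors, valid as
  \<open>8 * N > 2 * (2 * N)\<close>. Working with square sums avoids the logarithm in the absolute
  sum of a single Dirichlet kernel.\<close>

lemma sum_norm_trig_product_le:
  fixes x :: real
  assumes N: "N > 0"
  shows "(\<Sum>j<8*N. cmod (\<Sum>p\<in>freqs N. of_int p ^ i * cis (2 * pi * of_int p * (x - real j / real (8*N)))) *
       cmod (\<Sum>q\<in>freqs (2*N). of_int q ^ k * cis (2 * pi * of_int q * (x - real j / real (8*N)))))
    \<le> real (8*N) * real (2 * (2 * N + 1)) * (real N ^ i * real (2 * N) ^ k)" (is "(\<Sum>j<_. ?a j * ?b j) \<le> _")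
proof -
  have bd: "(\<Sum>j<8*N. (cmod (\<Sum>p\<in>freqs b. of_int p ^ i * cis (2 * pi * of_int p * (x - real j / real (8*N)))))\<^sup>2)
     \<le> real (8*N) * (real (2 * b + 1) * (real b ^ i)\<^sup>2)" if "8 * N > 2 * b" for b i
  proof -
    have "(\<Sum>p\<in>freqs b. (cmod (of_int p ^ i))\<^sup>2) \<le> (\<Sum>p\<in>freqs b. (real b ^ i)\<^sup>2)"
    proof (rule sum_mono)
      fix p assume "p \<in> freqs b"
      then have "\<bar>of_int p\<bar> \<le> real b" by auto
      then have "\<bar>of_int p\<bar> ^ i \<le> real b ^ i" by (intro power_mono) auto
      then show "(cmod (of_int p ^ i))\<^sup>2 \<le> (real b ^ i)\<^sup>2" by (intro power_mono) (auto simp: norm_power)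
    qed
    also have "\<dots> = real (2 * b + 1) * (real b ^ i)\<^sup>2" by simp
    finally show ?thesis unfolding discrete_parseval[OF that] by (intro mult_left_mono) auto
  qed
  have "(\<Sum>j<8*N. ?a j * ?b j)\<^sup>2 \<le> (\<Sum>j<8*N. (?a j)\<^sup>2) * (\<Sum>j<8*N. (?b j)\<^sup>2)"
    by (rule Cauchy_Schwarz_ineq_sum)
  also have "\<dots> \<le> (real (8*N) * (real (2 * N + 1) * (real N ^ i)\<^sup>2)) * (real (8*N) * (real (2 * (2*N) + 1) * (real (2*N) ^ k)\<^sup>2))"
    by (intro mult_mono bd sum_nonneg) (use N in auto)
  also have "\<dots> \<le> (real (8*N) * real (2 * (2 * N + 1)) * (real N ^ i * real (2 * N) ^ k))\<^sup>2"
  proof -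
    let ?K = "real (8*N)" and ?u = "real (2 * N + 1)" and ?v = "real (2 * (2*N) + 1)"
      and ?w = "real (2 * (2 * N + 1))" and ?A = "real N ^ i" and ?B = "real (2*N) ^ k"
    have g1: "(K * (u * A\<^sup>2)) * (K * (v * B\<^sup>2)) = (K * (A * B))\<^sup>2 * (u * v)"
      and g2: "(K * w * (A * B))\<^sup>2 = (K * (A * B))\<^sup>2 * w\<^sup>2" for K u v w A B :: real
      by (simp_all add: power2_eq_square)
    have "?u * ?v \<le> ?w\<^sup>2" by (simp add: power2_eq_square algebra_simps)
    then have "(?K * (?A * ?B))\<^sup>2 * (?u * ?v) \<le> (?K * (?A * ?B))\<^sup>2 * ?w\<^sup>2"
      by (rule mult_left_mono) simp
    then show ?thesis unfolding g1 g2 .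
  qed
  finally show ?thesis by (rule power2_le_imp_le) simp
qed

text \<open>A Lebesgue constant 2 independent of \<open>N\<close> and \<open>x\<close>. Each
  derivative costs the largest frequency \<open>2 * pi * (3 * N)\<close>, because the terms
  \<open>N ^ i * (2 * N) ^ (r - i)\<close> sum binomially to \<open>(3 * N) ^ r\<close>.\<close>

lemma sum_abs_vp_le:
  assumes N: "N > 0"
  shows "(\<Sum>j<8*N. \<bar>vp N r (x - real j / real (8*N))\<bar>) \<le> 2 * (2 * pi * (3 * real N)) ^ r"
proof -
  let ?a = "\<lambda>i j. cmod (\<Sum>p\<in>freqs N. of_int p ^ i * cis (2 * pi * of_int p * (x - real j / real (8*N))))"
  let ?b = "\<lambda>k j. cmod (\<Sum>q\<in>freqs (2*N). of_int q ^ k * cis (2 * pi * of_int q * (x - real j / real (8*N))))"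
  let ?c = "(2 * pi) ^ r / real ((2 * N + 1) * (8 * N))"
  have "(\<Sum>j<8*N. \<bar>vp N r (x - real j / real (8*N))\<bar>) \<le> (\<Sum>j<8*N. ?c * (\<Sum>i\<le>r. real (r choose i) * (?a i j * ?b (r - i) j)))"
    unfolding vp_def by (intro sum_mono order.trans[OF abs_Re_le_cmod] vp_complex_norm_le)
  also have "\<dots> = ?c * (\<Sum>i\<le>r. real (r choose i) * (\<Sum>j<8*N. ?a i j * ?b (r - i) j))"
    unfolding sum_distrib_left by (subst sum.swap) simp
  also have "\<dots> \<le> ?c * (\<Sum>i\<le>r. real (r choose i) * (real (8*N) * real (2 * (2 * N + 1)) * (real N ^ i * real (2 * N) ^ (r - i))))"
    by (intro mult_left_mono sum_mono sum_norm_trig_product_le N) auto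
  also have "(\<Sum>i\<le>r. real (r choose i) * (real (8*N) * real (2 * (2 * N + 1)) * (real N ^ i * real (2 * N) ^ (r - i))))
     = (real (8*N) * real (2 * (2 * N + 1))) * (3 * real N) ^ r"
  proof -
    have e: "(3 * real N) ^ r = (\<Sum>i\<le>r. real (r choose i) * real N ^ i * real (2 * N) ^ (r - i))"
      by (subst binomial_ring[symmetric]) simp
    show ?thesis unfolding e sum_distrib_left by (intro sum.cong refl) (simp only: mult_ac)
  qed
  also have "?c * ((real (8*N) * real (2 * (2 * N + 1))) * (3 * real N) ^ r) = 2 * (2 * pi * (3 * real N)) ^ r"
  proof -
    have g: "P / (u * K) * ((K * (2 * u)) * T) = 2 * (P * T)" if "K > 0" "u > 0" for K u P T :: real
      using that by (simp add: field_simps)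
    have e1: "?c = (2 * pi) ^ r / (real (2 * N + 1) * real (8 * N))" by (simp only: of_nat_mult)
    have e2: "real (8*N) * real (2 * (2 * N + 1)) = real (8*N) * (2 * real (2 * N + 1))" by simp
    have e3: "(2 * pi * (3 * real N)) ^ r = (2 * pi) ^ r * (3 * real N) ^ r" by (rule power_mult_distrib)
    show ?thesis unfolding e1 e2 e3 by (rule g) (use N in simp_all)
  qed
  finally show ?thesis .
qed

section \<open>Reproduction properties of the kernel\<close>

lemma vp_complex_real: "vp_complex N 0 x = of_real (vp N 0 x)"
proof -
  let ?g = "\<lambda>p q. sin (2 * pi * of_int (p + q) * x)"
  let ?S = "\<Sum>p\<in>freqs N. \<Sum>q\<in>freqs (2*N). ?g p q"
  have r: "(\<Sum>p\<in>freqs b. h (- p)) = (\<Sum>p\<in>freqs b. h p)" for b and h :: "int \<Rightarrow> real"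
    by (rule sum.reindex_bij_witness[where i=uminus and j=uminus]) auto
  have "?S = (\<Sum>p\<in>freqs N. \<Sum>q\<in>freqs (2*N). ?g (-p) (-q))"
    by (subst r[symmetric], subst (2) r[symmetric]) simp
  also have "\<dots> = (\<Sum>p\<in>freqs N. \<Sum>q\<in>freqs (2*N). - ?g p q)"
    by (intro sum.cong refl) (simp add: sin_minus[symmetric] algebra_simps)
  finally have "?S = 0" by (simp add: sum_negf)
  then have "Im (vp_complex N 0 x) = 0" by (simp add: vp_complex_def)
  then show ?thesis by (simp add: vp_def complex_eq_iff)
qed

text \<open>The coefficient of the kernel at frequency \<open>m\<close> counts the \<open>p\<close>
  for which \<open>m - p\<close> is admissible as \<open>q\<close>. For
  \<open>\<bar>m\<bar> \<le> N\<close> all \<open>2 * N + 1\<close> values qualify, which explains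
  the normalisation of \<open>vp_complex\<close>.\<close>

lemma vp_reproduces_cis:
  fixes m :: int
  assumes N: "N > 0" and m: "\<bar>m\<bar> \<le> int N"
  shows "(\<Sum>j<8*N. vp_complex N 0 (x - real j / real (8*N)) * cis (2 * pi * of_int m * (real j / real (8*N)))) = cis (2 * pi * of_int m * x)"
proof -
  let ?I = "freqs N" and ?J = "freqs (2*N)"
  let ?e = "\<lambda>l y. cis (2 * pi * of_int l * y)" and ?j = "\<lambda>j. real j / real (8*N)"
  let ?d = "of_nat ((2 * N + 1) * (8 * N)) :: complex"
  have one: "(\<Sum>j<8*N. ?e (p + q) (x - ?j j) * ?e m (?j j)) = (if q = m - p then of_nat (8*N) * ?e m x else 0)"
    if "p \<in> ?I" "q \<in> ?J" for p q
  proof -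
    have "?e (p + q) (x - ?j j) * ?e m (?j j) = ?e m x * ?e (p + q - m) (x - ?j j)" for j
      unfolding cis_mult by (intro arg_cong[where f=cis]) (simp add: algebra_simps)
    then have "(\<Sum>j<8*N. ?e (p + q) (x - ?j j) * ?e m (?j j)) = ?e m x * (\<Sum>j<8*N. ?e (p + q - m) (x - ?j j))"
      by (simp only: sum_distrib_left)
    also have "(\<Sum>j<8*N. ?e (p + q - m) (x - ?j j)) = (if p + q - m = 0 then of_nat (8*N) else 0)"
    proof (rule sum_cis_shifted)
      show "8 * N > 0" using N by simp
      have "-int N \<le> m" "m \<le> int N" using m by linarith+
      \<comment> \<open>The frequency is at most \<open>N + 2 * N + N = 4 * N\<close>, hence no
        aliasing on \<open>8 * N\<close> points.\<close>
      then show "\<bar>p + q - m\<bar> < int (8 * N)" using that N by auto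
    qed
    finally show ?thesis by (auto simp: algebra_simps)
  qed
  have "(\<Sum>j<8*N. vp_complex N 0 (x - ?j j) * ?e m (?j j))
    = (\<Sum>j<8*N. \<Sum>p\<in>?I. \<Sum>q\<in>?J. ?e (p + q) (x - ?j j) * ?e m (?j j)) / ?d"
    unfolding vp_complex_def power_0 mult_1 times_divide_eq_left sum_divide_distrib[symmetric] sum_distrib_right ..
  also have "(\<Sum>j<8*N. \<Sum>p\<in>?I. \<Sum>q\<in>?J. ?e (p + q) (x - ?j j) * ?e m (?j j))
     = (\<Sum>p\<in>?I. \<Sum>q\<in>?J. \<Sum>j<8*N. ?e (p + q) (x - ?j j) * ?e m (?j j))"
    by (subst sum.swap, intro sum.cong refl, rule sum.swap)
  also have "\<dots> = (\<Sum>p\<in>?I. \<Sum>q\<in>?J. if q = m - p then of_nat (8*N) * ?e m x else 0)"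
    by (intro sum.cong refl one)
  also have "\<dots> = (\<Sum>p\<in>?I. of_nat (8*N) * ?e m x)"
  proof (intro sum.cong refl)
    fix p assume p: "p \<in> ?I"
    have "m - p \<in> ?J" using p m by auto
    then show "(\<Sum>q\<in>?J. if q = m - p then of_nat (8*N) * ?e m x else 0) = of_nat (8*N) * ?e m x" by simp
  qed
  also have "\<dots> = ?d * ?e m x" by (simp add: algebra_simps)
  also have "?d * ?e m x / ?d = ?e m x"
  proof -
    have "?d \<noteq> 0" using N by (simp only: of_nat_eq_0_iff) simp
    then show ?thesis by (rule nonzero_mult_div_cancel_left)
  qed
  finally show ?thesis .
qed

lemma vp_reproduces_cos:
  fixes m :: int
  assumes N: "N > 0" and m: "\<bar>m\<bar> \<le> int N"
  shows "(\<Sum>j<8*N. vp N 0 (x - real j / real (8*N)) * cos (2 * pi * of_int m * (real j / real (8*N) - s))) = cos (2 * pi * of_int m * (x - s))"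
proof -
  let ?j = "\<lambda>j. real j / real (8*N)"
  have "(\<Sum>j<8*N. vp_complex N 0 (x - ?j j) * cis (2 * pi * of_int m * (?j j - s)))
     = cis (- (2 * pi * of_int m * s)) * (\<Sum>j<8*N. vp_complex N 0 (x - ?j j) * cis (2 * pi * of_int m * ?j j))"
    unfolding sum_distrib_left
  proof (intro sum.cong refl)
    fix j
    have "cis (2 * pi * of_int m * (?j j - s)) = cis (- (2 * pi * of_int m * s)) * cis (2 * pi * of_int m * ?j j)"
      unfolding cis_mult by (intro arg_cong[where f=cis]) (simp add: algebra_simps)
    then show "vp_complex N 0 (x - ?j j) * cis (2 * pi * of_int m * (?j j - s)) =
      cis (- (2 * pi * of_int m * s)) * (vp_complex N 0 (x - ?j j) * cis (2 * pi * of_int m * ?j j))"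
      by (simp only: mult_ac)
  qed
  also have "\<dots> = cis (2 * pi * of_int m * (x - s))"
    unfolding vp_reproduces_cis[OF assms] cis_mult by (intro arg_cong[where f=cis]) (simp add: algebra_simps)
  finally have "Re (\<Sum>j<8*N. vp_complex N 0 (x - ?j j) * cis (2 * pi * of_int m * (?j j - s))) = cos (2 * pi * of_int m * (x - s))"
    by simp
  then show ?thesis by (simp add: vp_complex_real)
qed

text \<open>The frequencies of \<open>vp N\<close> are at most \<open>3 * N\<close> and so lie in
  the range that \<open>vp N'\<close> reproduces.\<close>

lemma vp_reproduces_vp:
  assumes N: "N > 0" and N': "3 * N \<le> N'"
  shows "(\<Sum>j<8*N'. vp N' 0 (x - real j / real (8*N')) * vp N 0 (real j / real (8*N') - s)) = vp N 0 (x - s)"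
proof -
  let ?I = "freqs N" and ?J = "freqs (2*N)"
  let ?j = "\<lambda>j. real j / real (8*N')" and ?d = "real ((2 * N + 1) * (8 * N))"
  have vp_cos: "vp N 0 y = (\<Sum>p\<in>?I. \<Sum>q\<in>?J. cos (2 * pi * of_int (p + q) * y)) / ?d" for y
    unfolding vp_def vp_complex_def by (simp add: Re_divide_of_nat del: of_nat_mult)
  have "(\<Sum>j<8*N'. vp N' 0 (x - ?j j) * vp N 0 (?j j - s))
    = (\<Sum>j<8*N'. \<Sum>p\<in>?I. \<Sum>q\<in>?J. vp N' 0 (x - ?j j) * cos (2 * pi * of_int (p + q) * (?j j - s))) / ?d"
    unfolding vp_cos[of "_ - s"] times_divide_eq_right sum_divide_distrib[symmetric] sum_distrib_left ..
  also have "(\<Sum>j<8*N'. \<Sum>p\<in>?I. \<Sum>q\<in>?J. vp N' 0 (x - ?j j) * cos (2 * pi * of_int (p + q) * (?j j - s)))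
    = (\<Sum>p\<in>?I. \<Sum>q\<in>?J. \<Sum>j<8*N'. vp N' 0 (x - ?j j) * cos (2 * pi * of_int (p + q) * (?j j - s)))"
    by (subst sum.swap, intro sum.cong refl, rule sum.swap)
  also have "\<dots> = (\<Sum>p\<in>?I. \<Sum>q\<in>?J. cos (2 * pi * of_int (p + q) * (x - s)))"
    by (intro sum.cong refl vp_reproduces_cos) (use N N' in auto)
  finally show ?thesis by (simp only: vp_cos)
qed

section \<open>The Matern covariance as a mixture of periodic Gaussians\<close>

text \<open>Euler's integral after the substitution \<open>t = exp u\<close>. The logarithmic
  variable puts all mixture integrals on the whole line, where scaling becomes translation.\<close>

lemma has_bochner_integral_Gamma_exp:
  fixes \<nu> :: real
  assumes "\<nu> > 0"
  shows "has_bochner_integral lborel (\<lambda>u. exp (\<nu> * u - exp u)) (Gamma \<nu>)"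
proof -
  let ?f = "\<lambda>t. t powr (\<nu> - 1) / exp t" and ?F = "\<lambda>u. exp (\<nu> * u - exp u) :: real"
  have hi: "(?f has_integral Gamma \<nu>) {0<..}"
  proof -
    have "{x \<in> {0<..} - {0..}. ?f x \<noteq> 0} = {}" by auto
    then have n1: "negligible {x \<in> {0<..} - {0..}. ?f x \<noteq> 0}" by (simp only: negligible_empty)
    have n2: "negligible {x \<in> {0..} - {0<..}. ?f x \<noteq> 0}"
      by (rule negligible_subset[of "{0}"]) auto
    show ?thesis using Gamma_integral_real[OF assms] has_integral_spike_set_eq[OF n1 n2] by blast
  qed
  have ai: "?f absolutely_integrable_on {0<..}"
    by (rule nonnegative_absolutely_integrable_1) (use hi in auto)
  have r: "exp ` UNIV = {0::real<..}"
  proof (intro equalityI subsetI)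
    fix x :: real assume "x \<in> {0<..}"
    then have "x = exp (ln x)" by simp
    then show "x \<in> exp ` UNIV" by (rule image_eqI) simp
  qed auto
  have e: "\<bar>exp u\<bar> * ?f (exp u) = ?F u" for u :: real
    by (simp add: powr_def exp_diff[symmetric] exp_add[symmetric] algebra_simps)
  have "(\<lambda>u. \<bar>exp u\<bar> * ?f (exp u)) absolutely_integrable_on UNIV \<and> integral UNIV (\<lambda>u. \<bar>exp u\<bar> * ?f (exp u)) = Gamma \<nu>"
    by (subst has_absolute_integral_change_of_variables_1'[of UNIV exp exp])
       (use ai hi r in \<open>auto intro!: derivative_eq_intros simp: integral_unique inj_on_def\<close>)
  then have 1: "?F absolutely_integrable_on UNIV" "integral UNIV ?F = Gamma \<nu>" unfolding e by auto
  have m: "?F \<in> borel_measurable lborel" by measurable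
  have 2: "integrable lborel ?F"
    using 1(1) integrable_completion[OF m] by (simp add: set_integrable_def)
  moreover have "integral\<^sup>L lborel ?F = Gamma \<nu>"
    using has_integral_integral_lborel[OF 2] 1(2) by (simp add: integral_unique)
  ultimately show ?thesis by (simp add: has_bochner_integral_iff)
qed

lemma has_bochner_integral_Gamma_exp_scaled:
  fixes \<nu> c :: real
  assumes "\<nu> > 0" "c > 0"
  shows "has_bochner_integral lborel (\<lambda>u. exp (\<nu> * u - c * exp u)) (c powr (- \<nu>) * Gamma \<nu>)"
proof -
  have "has_bochner_integral lborel (\<lambda>u. exp (\<nu> * (ln c + 1 * u) - exp (ln c + 1 * u))) (Gamma \<nu> /\<^sub>R \<bar>1\<bar>)"
    using has_bochner_integral_Gamma_exp[OF assms(1)]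
    by (subst (asm) lborel_has_bochner_integral_real_affine_iff[where c=1 and t="ln c"]) auto
  then have "has_bochner_integral lborel (\<lambda>u. c powr (- \<nu>) * exp (\<nu> * (ln c + 1 * u) - exp (ln c + 1 * u))) (c powr (- \<nu>) * (Gamma \<nu> /\<^sub>R \<bar>1\<bar>))"
    by (rule has_bochner_integral_mult_right)
  moreover have "c powr (- \<nu>) * exp (\<nu> * (ln c + 1 * u) - exp (ln c + 1 * u)) = exp (\<nu> * u - c * exp u)" for u
  proof -
    have e: "exp (ln c + 1 * u) = c * exp u" using assms by (simp add: exp_add)
    have "c powr (- \<nu>) = exp (- \<nu> * ln c)" using assms by (simp add: powr_def)
    then show ?thesis unfolding e by (simp only: mult_exp_exp) (simp add: algebra_simps)
  qed
  ultimately show ?thesis by simp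
qed

text \<open>The substitution \<open>u = ln z + t\<close> turns the exponent into
  \<open>\<nu> * t - z * cosh t\<close> and releases \<open>z powr \<nu>\<close>; folding the line
  at 0 gives the factor \<open>cosh (\<nu> * t)\<close> of the Bessel integral. For fixed
  \<open>u\<close> the integrand is Gaussian in \<open>z\<close>, and the value at
  \<open>z = 0\<close> is the Gamma integral.\<close>

lemma powr_bessel_K_integral:
  assumes nu: "\<nu> > 0" and z: "z \<ge> 0"
  shows "powr_bessel_K \<nu> z = (1/2) * (LINT u|lborel. exp (\<nu> * u - exp u / 2) * exp (- (z\<^sup>2 / 2) * exp (- u)))"
proof (cases "z = 0")
  case True
  have "(LINT u|lborel. exp (\<nu> * u - exp u / 2)) = (1/2) powr (- \<nu>) * Gamma \<nu>"
    using has_bochner_integral_Gamma_exp_scaled[OF nu, of "1/2"] by (simp add: has_bochner_integral_iff)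
  also have "(1/2::real) powr (- \<nu>) = 2 powr \<nu>" by (simp add: powr_divide powr_minus field_simps)
  finally show ?thesis using True by (simp add: powr_bessel_K_def powr_diff)
next
  case False
  then have z: "z > 0" using z by simp
  let ?F = "\<lambda>u. exp (\<nu> * u - exp u / 2) * exp (- (z\<^sup>2 / 2) * exp (- u))"
  define E where "E t = exp (\<nu> * t - z * cosh t)" for t
  have Fint: "integrable lborel ?F"
  proof (rule Bochner_Integration.integrable_bound)
    show "integrable lborel (\<lambda>u. exp (\<nu> * u - (1/2) * exp u))"
      using has_bochner_integral_Gamma_exp_scaled[OF nu, of "1/2"] by (simp add: has_bochner_integral_iff)
    show "AE u in lborel. norm (?F u) \<le> norm (exp (\<nu> * u - (1/2) * exp u))"
      by (auto simp: mult_le_cancel_left2)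
  qed measurable
  have FE: "?F (ln z + 1 * t) = z powr \<nu> * E t" for t
  proof -
    have "?F (ln z + 1 * t) = exp (\<nu> * (ln z + t) - (z * exp t) / 2 - (z\<^sup>2 / 2) * (exp (- t) / z))"
    proof -
      have e1: "exp (ln z + 1 * t) = z * exp t" using z by (simp add: exp_add)
      have e2: "exp (- (ln z + 1 * t)) = exp (- t) / z" 
      proof -
        have "- (ln z + 1 * t) = - t - ln z" by simp
        then show ?thesis using z by (simp only: exp_diff exp_ln)
      qed
      show ?thesis unfolding e1 e2 mult_exp_exp by simp
    qed
    also have "\<nu> * (ln z + t) - (z * exp t) / 2 - (z\<^sup>2 / 2) * (exp (- t) / z) = \<nu> * ln z + (\<nu> * t - z * cosh t)"
      using z by (simp add: cosh_def power2_eq_square field_simps)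
    finally show ?thesis using z by (simp add: E_def powr_def exp_add mult_ac)
  qed
  have "has_bochner_integral lborel (\<lambda>t. ?F (ln z + 1 * t)) ((LINT u|lborel. ?F u) /\<^sub>R \<bar>1\<bar>)"
    by (subst lborel_has_bochner_integral_real_affine_iff[symmetric]) (use Fint in \<open>auto simp: has_bochner_integral_iff\<close>)
  then have 1: "has_bochner_integral lborel (\<lambda>t. z powr \<nu> * E t) (LINT u|lborel. ?F u)"
    unfolding FE by simp
  have "integrable lborel (\<lambda>t. z powr (- \<nu>) * (z powr \<nu> * E t))"
    using 1 by (intro integrable_mult_right) (simp add: has_bochner_integral_iff)
  moreover have "z powr (- \<nu>) * (z powr \<nu> * E t) = E t" for t
    using z by (simp add: powr_minus field_simps)
  ultimately have Eint: "integrable lborel E" by simp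
  have Eint': "integrable lborel (\<lambda>t. E (- t))"
    using lborel_integrable_real_affine[OF Eint, of "-1" 0] by simp
  have 2: "z powr \<nu> * (LINT t|lborel. E t) = (LINT u|lborel. ?F u)"
    using 1 by (simp add: has_bochner_integral_iff)
  have i1: "integrable lborel (\<lambda>t. indicator {0..} t * E t)" "integrable lborel (\<lambda>t. indicator {..0} t * E t)"
      "integrable lborel (\<lambda>t. indicator {0..} t * E (- t))"
    using integrable_mult_indicator[OF _ Eint, of "{0..}"] integrable_mult_indicator[OF _ Eint, of "{..0}"]
      integrable_mult_indicator[OF _ Eint', of "{0..}"] by simp_all
  have c: "indicator {0..} t * (exp (- z * cosh t) * cosh (\<nu> * t)) = (1/2) * (indicator {0..} t * E t + indicator {0..} t * E (- t))" for t :: real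
    by (simp add: E_def cosh_def[of "\<nu> * t"] exp_diff exp_minus field_simps)
  have "bessel_K \<nu> z = (LINT t|lborel. (1/2) * (indicator {0..} t * E t + indicator {0..} t * E (- t)))"
    unfolding bessel_K_def set_lebesgue_integral_def real_scaleR_def c ..
  also have "\<dots> = (1/2) * ((LINT t|lborel. indicator {0..} t * E t) + (LINT t|lborel. indicator {0..} t * E (- t)))"
    using i1 by simp
  also have "(LINT t|lborel. indicator {0..} t * E (- t)) = (LINT t|lborel. indicator {..0} t * E t)"
    using lborel_integral_real_affine[where f="\<lambda>t. indicator {..0} t * E t" and c="-1" and t=0]
    by (simp add: indicator_def)
  also have "(LINT t|lborel. indicator {0..} t * E t) + (LINT t|lborel. indicator {..0} t * E t)
     = (LINT t|lborel. indicator {0..} t * E t + indicator {..0} t * E t)"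
    using i1 by simp
  also have "\<dots> = (LINT t|lborel. E t)"
  proof (rule integral_cong_AE)
    show "AE t in lborel. indicator {0..} t * E t + indicator {..0} t * E t = E t"
      using AE_lborel_singleton[of "0::real"] by eventually_elim (auto simp: indicator_def)
    show "(\<lambda>t. indicator {0..} t * E t + indicator {..0} t * E t) \<in> borel_measurable lborel"
      using i1 by (intro borel_measurable_add) auto
    show "E \<in> borel_measurable lborel" using Eint by auto
  qed
  finally show ?thesis unfolding powr_bessel_K_def 2[symmetric] using False by simp
qed

text \<open>Exchange of integral and unordered sum: by nonnegativity \<open>g\<close> bounds every
  finite partial sum, so it also serves as the dominating function.\<close>

lemma has_sum_integral_nonneg:
  fixes f :: "'b::countable \<Rightarrow> 'a \<Rightarrow> real"
  assumes meas: "\<And>m. f m \<in> borel_measurable M" and nn: "\<And>m x. 0 \<le> f m x"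
    and sum: "\<And>x. ((\<lambda>m. f m x) has_sum g x) UNIV" and g: "integrable M g"
  shows "((\<lambda>m. LINT x|M. f m x) has_sum (LINT x|M. g x)) UNIV"
proof -
  have fin_le: "(\<Sum>m\<in>F. f m x) \<le> g x" if "finite F" for F x
    using finite_sum_le_has_sum[OF sum[of x] that] nn by auto
  have fint: "integrable M (f m)" for m
    by (rule Bochner_Integration.integrable_bound[OF g meas]) (use fin_le[of "{m}"] nn in \<open>auto intro!: AE_I2 order.trans[OF _ abs_ge_self]\<close>)
  have fin_int: "(\<Sum>m\<in>F. LINT x|M. f m x) \<le> (LINT x|M. g x)" if "finite F" for F
  proof -
    have "(\<Sum>m\<in>F. LINT x|M. f m x) = (LINT x|M. (\<Sum>m\<in>F. f m x))"
      by (rule Bochner_Integration.integral_sum[symmetric]) (rule fint)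
    also have "\<dots> \<le> (LINT x|M. g x)"
      by (intro integral_mono Bochner_Integration.integrable_sum fint g fin_le that)
    finally show ?thesis .
  qed
  have nni: "0 \<le> (LINT x|M. f m x)" for m using nn by (simp add: integral_nonneg_AE)
  have sm: "(\<lambda>m. LINT x|M. f m x) summable_on UNIV"
    by (rule nonneg_bdd_above_summable_on) (use nni fin_int in \<open>auto intro!: bdd_aboveI2\<close>)
  have "infsum (\<lambda>m. LINT x|M. f m x) UNIV \<le> (LINT x|M. g x)"
    by (rule infsum_le_finite_sums[OF sm]) (use fin_int in auto)
  moreover have "(LINT x|M. g x) \<le> infsum (\<lambda>m. LINT x|M. f m x) UNIV"
  proof -
    \<comment> \<open>Initial segments of an enumeration are cofinal among the finite sets, which
      turns the unordered sum into a limit along a sequence.\<close>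
    define F where "F n = {m::'b. to_nat m < n}" for n
    have finF: "finite (F n)" for n
      unfolding F_def by (rule finite_imageD[of to_nat]) (auto intro: finite_subset[of _ "{..<n}"] simp: inj_on_def)
    have "(\<lambda>n. LINT x|M. (\<Sum>m\<in>F n. f m x)) \<longlonglongrightarrow> (LINT x|M. g x)"
    proof (rule integral_dominated_convergence[where w=g])
      show "AE x in M. (\<lambda>n. \<Sum>m\<in>F n. f m x) \<longlonglongrightarrow> g x"
      proof (rule AE_I2)
        fix x
        have "filterlim F (finite_subsets_at_top UNIV) sequentially"
          unfolding filterlim_finite_subsets_at_top
        proof (intro allI impI)
          fix X :: "'b set" assume "finite X \<and> X \<subseteq> UNIV"
          then have fX: "finite X" by simp
          define N where "N = (if X = {} then 0 else Suc (Max (to_nat ` X)))"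
          have "X \<subseteq> F n" if "n \<ge> N" for n
          proof
            fix m assume m: "m \<in> X"
            then have "to_nat m \<le> Max (to_nat ` X)" using fX by simp
            then show "m \<in> F n" using that m by (auto simp: F_def N_def split: if_splits)
          qed
          then show "\<forall>\<^sub>F y in sequentially. finite (F y) \<and> X \<subseteq> F y \<and> F y \<subseteq> UNIV"
            using finF by (auto simp: eventually_sequentially)
        qed
        with sum[of x] show "(\<lambda>n. \<Sum>m\<in>F n. f m x) \<longlonglongrightarrow> g x"
          unfolding has_sum_def by (rule filterlim_compose)
      qed
      show "AE x in M. norm (\<Sum>m\<in>F n. f m x) \<le> g x" for n
        using fin_le[OF finF] nn by (auto simp: abs_of_nonneg sum_nonneg)
    qed (use g meas in auto)
    moreover have "(LINT x|M. (\<Sum>m\<in>F n. f m x)) \<le> infsum (\<lambda>m. LINT x|M. f m x) UNIV" for n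
      using fint finite_sum_le_infsum[OF sm finF] nni by (subst Bochner_Integration.integral_sum) auto
    ultimately show ?thesis by (intro LIMSEQ_le_const2) auto
  qed
  ultimately have "infsum (\<lambda>m. LINT x|M. f m x) UNIV = (LINT x|M. g x)" by linarith
  then show ?thesis using sm by (metis has_sum_infsum)
qed

text \<open>All Fourier coefficients are positive, so every term of the cosine series is largest at
  0.\<close>

lemma theta_le_theta_0:
  assumes b: "b > 0"
  shows "theta b s \<le> theta b 0"
proof -
  have "theta b s - theta_coeff b 0 \<le> theta b 0 - theta_coeff b 0"
  proof (rule sums_le[OF _ theta_poisson[OF b] theta_poisson[OF b]])
    fix n
    have "theta_coeff b (Suc n) * cos (2 * pi * real (Suc n) * s) \<le> theta_coeff b (Suc n) * 1"
      using theta_coeff_pos[OF b] by (intro mult_left_mono) (auto simp: less_imp_le)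
    then show "2 * theta_coeff b (Suc n) * cos (2 * pi * real (Suc n) * s) \<le> 2 * theta_coeff b (Suc n) * cos (2 * pi * real (Suc n) * 0)"
      by simp
  qed
  then show ?thesis by simp
qed

lemma theta_nonneg: "b > 0 \<Longrightarrow> theta b s \<ge> 0"
  unfolding theta_def by (intro infsum_nonneg) auto

text \<open>Measurability in \<open>u\<close> is obtained by rewriting the unordered sum as a
  series.\<close>

lemma theta_measurable [measurable]:
  assumes "\<beta> > 0"
  shows "(\<lambda>u. theta (\<beta> * exp (- u)) s) \<in> borel_measurable lborel"
proof -
  have "theta (\<beta> * exp (- u)) s = (\<Sum>k. exp (- (\<beta> * exp (- u)) * (s + of_int (int k))\<^sup>2) + exp (- (\<beta> * exp (- u)) * (s + of_int (- int k - 1))\<^sup>2))" for u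
    using sums_infsum_int[OF theta_summable[of "\<beta> * exp (- u)" s]] assms unfolding theta_def by (simp add: sums_iff)
  then show ?thesis by simp
qed

abbreviation theta_prod :: "real \<Rightarrow> real ^ 'n \<Rightarrow> real" where
  "theta_prod b x \<equiv> \<Prod>i\<in>UNIV. theta b (x $ i)"

text \<open>The squared norm is additive over coordinates, so the lattice sum of Gaussians factors
  into one-dimensional theta functions.\<close>

lemma theta_prod_has_sum:
  fixes x :: "real ^ 'n"
  assumes b: "b > 0"
  shows "((\<lambda>m. exp (- b * (norm (x + int_vec m))\<^sup>2)) has_sum theta_prod b x) UNIV"
proof -
  let ?f = "\<lambda>i k. exp (- b * (x $ i + of_int k)\<^sup>2)"
  have s: "?f i summable_on UNIV" for i by (rule theta_summable[OF b])
  have "(\<lambda>k. norm (?f i k)) summable_on UNIV" for i using s[of i] by simp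
  then have "infsum (\<lambda>g. \<Prod>i\<in>UNIV. ?f i (g i)) (PiE UNIV (\<lambda>_. UNIV)) = (\<Prod>i\<in>UNIV. infsum (?f i) UNIV)"
    by (intro infsum_prod_PiE_abs) auto
  then have 1: "infsum (\<lambda>g. \<Prod>i\<in>UNIV. ?f i (g i)) UNIV = theta_prod b x"
    unfolding theta_def by simp
  have pos: "0 < theta b (x $ i)" for i
  proof -
    have "sum (?f i) {0} \<le> theta b (x $ i)" unfolding theta_def by (intro finite_sum_le_infsum s) auto
    then show ?thesis by (smt (verit) exp_gt_zero sum.empty sum.insert finite.intros empty_iff)
  qed
  have pp: "theta_prod b x > 0" using pos by (intro prod_pos) auto
  \<comment> \<open>\<open>infsum\<close> defaults to 0 on families that are not summable, so the
    positive value found above forces summability.\<close>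
  have sm: "(\<lambda>g. \<Prod>i\<in>UNIV. ?f i (g i)) summable_on UNIV"
  proof (rule ccontr)
    assume "\<not> (\<lambda>g. \<Prod>i\<in>UNIV. ?f i (g i)) summable_on UNIV"
    then have "infsum (\<lambda>g. \<Prod>i\<in>UNIV. ?f i (g i)) UNIV = 0" by (rule infsum_not_exists)
    then show False unfolding 1 using pp by (simp only: less_irrefl)
  qed
  have 2: "((\<lambda>g. \<Prod>i\<in>UNIV. ?f i (g i)) has_sum theta_prod b x) UNIV"
    using has_sum_infsum[OF sm] unfolding 1 .
  have e: "exp (- b * (norm (x + int_vec m))\<^sup>2) = (\<Prod>i\<in>UNIV. ?f i (m $ i))" for m
  proof -
    have "(norm (x + int_vec m))\<^sup>2 = (\<Sum>i\<in>UNIV. (x $ i + of_int (m $ i))\<^sup>2)"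
      unfolding power2_norm_eq_inner by (simp add: inner_vec_def int_vec_def power2_eq_square)
    then show ?thesis by (simp add: exp_sum[symmetric] sum_distrib_left sum_negf)
  qed
  have bij: "bij_betw vec_nth (UNIV :: (int ^ 'n) set) UNIV"
    by (rule bij_betw_byWitness[where f' = vec_lambda]) auto
  show ?thesis unfolding e
    by (subst has_sum_reindex_bij_betw[OF bij, of "\<lambda>g. \<Prod>i\<in>UNIV. ?f i (g i)"]) (rule 2)
qed

text \<open>Up to normalisation, the Gamma density of shape \<open>\<nu>\<close> and rate
  \<open>1/2\<close> in the logarithmic variable.\<close>

definition matern_weight :: "real \<Rightarrow> real \<Rightarrow> real" where
  "matern_weight \<nu> u = exp (\<nu> * u - exp u / 2)"

text \<open>\<open>theta (\<beta> * exp (- u)) 0\<close> grows at most linearly in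
  \<open>exp u\<close>, so its \<open>d\<close>-th power uses up only half of the decay
  \<open>exp (- exp u / 2)\<close> of the weight.\<close>

lemma matern_weight_theta_bound:
  assumes "\<beta> > 0"
  obtains C where "C > 0" "\<And>\<nu> u. matern_weight \<nu> u * theta (\<beta> * exp (- u)) 0 ^ d \<le> C * exp (\<nu> * u - (1/4) * exp u)"
proof -
  define S where "S = int_inverse_squares_sum"
  have S0: "S \<ge> 0" unfolding S_def int_inverse_squares_sum_def by (intro infsum_nonneg) auto
  \<comment> \<open>The successor keeps \<open>D\<close> positive for \<open>d = 0\<close>. With
    \<open>exp u / (4 * D)\<close> in the exponent, the \<open>d\<close>-th power stays below
    \<open>exp (exp u / 4)\<close>.\<close>
  define D where "D = real (Suc d)"
  define K where "K = max 1 (8 * D / \<beta>)"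
  have K: "K \<ge> 1" "8 * D / \<beta> \<le> K" by (auto simp: K_def)
  have D: "D > 0" by (simp add: D_def)
  have bd: "theta (\<beta> * exp (- u)) 0 ^ d \<le> (K * S) ^ d * exp ((1/4) * exp u)" for u
  proof -
    have "theta (\<beta> * exp (- u)) 0 \<le> (1 + 2 / (\<beta> * exp (- u))) * S"
      unfolding S_def by (rule theta_0_le) (use assms in simp)
    also have "1 + 2 / (\<beta> * exp (- u)) = 1 + (8 * D / \<beta>) * (exp u / (4 * D))"
      using assms D by (simp add: exp_minus field_simps)
    also have "\<dots> \<le> K * (1 + exp u / (4 * D))"
      using K D unfolding distrib_left by (intro add_mono mult_right_mono) auto
    also have "\<dots> \<le> K * exp (exp u / (4 * D))"
      using K by (intro mult_left_mono exp_ge_add_one_self) auto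
    finally have 1: "theta (\<beta> * exp (- u)) 0 \<le> K * S * exp (exp u / (4 * D))"
      using S0 by (simp add: mult_right_mono mult_ac)
    have "theta (\<beta> * exp (- u)) 0 ^ d \<le> (K * S * exp (exp u / (4 * D))) ^ d"
      using theta_nonneg[of "\<beta> * exp (- u)" 0] assms by (intro power_mono 1) auto
    also have "\<dots> = (K * S) ^ d * exp (real d * (exp u / (4 * D)))"
      by (subst exp_of_nat_mult) (rule power_mult_distrib)
    also have "\<dots> \<le> (K * S) ^ d * exp ((1/4) * exp u)"
    proof -
      have "real d * (exp u / (4 * D)) \<le> (1/4) * exp u"
        using D by (simp add: field_simps D_def)
      then show ?thesis using K S0 by (intro mult_left_mono) auto
    qed
    finally show ?thesis .
  qed
  show thesis
  proof (rule that[of "(K * S) ^ d + 1"])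
    show "(K * S) ^ d + 1 > 0" using K S0 by (simp add: add_nonneg_pos)
    fix \<nu> u
    have "matern_weight \<nu> u * theta (\<beta> * exp (- u)) 0 ^ d \<le> matern_weight \<nu> u * ((K * S) ^ d * exp ((1/4) * exp u))"
      by (intro mult_left_mono bd) (simp add: matern_weight_def)
    also have "\<dots> = (K * S) ^ d * exp (\<nu> * u - (1/4) * exp u)"
      by (simp add: matern_weight_def exp_add[symmetric] mult_ac)
    also have "\<dots> \<le> ((K * S) ^ d + 1) * exp (\<nu> * u - (1/4) * exp u)"
      by (intro mult_right_mono) auto
    finally show "matern_weight \<nu> u * theta (\<beta> * exp (- u)) 0 ^ d \<le> ((K * S) ^ d + 1) * exp (\<nu> * u - (1/4) * exp u)" .
  qed
qed

lemma prod_theta_le: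
  assumes "b > 0" "finite A"
  shows "0 \<le> (\<Prod>i\<in>A. theta b (s i))" "(\<Prod>i\<in>A. theta b (s i)) \<le> theta b 0 ^ card A"
  using assms theta_nonneg[of b] theta_le_theta_0[of b]
  by (auto intro: prod_nonneg) (use prod_mono[of A "\<lambda>i. theta b (s i)" "\<lambda>_. theta b 0"] in auto)

lemma matern_theta_integrable:
  fixes x :: "real ^ 'n"
  assumes "\<nu> > 0" "\<beta> > 0"
  shows "integrable lborel (\<lambda>u. matern_weight \<nu> u * theta_prod (\<beta> * exp (- u)) x)"
proof -
  obtain C where C: "C > 0" "\<And>u. matern_weight \<nu> u * theta (\<beta> * exp (- u)) 0 ^ CARD('n) \<le> C * exp (\<nu> * u - (1/4) * exp u)"
    using matern_weight_theta_bound[OF assms(2), of "CARD('n)"] by metis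
  show ?thesis
  proof (rule Bochner_Integration.integrable_bound)
    show "integrable lborel (\<lambda>u. C * exp (\<nu> * u - (1/4) * exp u))"
      using has_bochner_integral_Gamma_exp_scaled[OF assms(1), of "1/4"] by (simp add: has_bochner_integral_iff)
    show "(\<lambda>u. matern_weight \<nu> u * theta_prod (\<beta> * exp (- u)) x) \<in> borel_measurable lborel"
      unfolding matern_weight_def using assms(2)
      by (intro borel_measurable_times borel_measurable_prod theta_measurable) measurable
    show "AE u in lborel. norm (matern_weight \<nu> u * theta_prod (\<beta> * exp (- u)) x) \<le> norm (C * exp (\<nu> * u - (1/4) * exp u))"
    proof (rule AE_I2)
      fix u
      have b: "\<beta> * exp (- u) > 0" using assms by simp
      have "matern_weight \<nu> u * theta_prod (\<beta> * exp (- u)) x \<le> matern_weight \<nu> u * theta (\<beta> * exp (- u)) 0 ^ CARD('n)"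
        using prod_theta_le(2)[OF b, of UNIV "\<lambda>i. x $ i"] by (intro mult_left_mono) (auto simp: matern_weight_def)
      also note C(2)[of u]
      finally show "norm (matern_weight \<nu> u * theta_prod (\<beta> * exp (- u)) x) \<le> norm (C * exp (\<nu> * u - (1/4) * exp u))"
        using prod_theta_le(1)[OF b, of UNIV "\<lambda>i. x $ i"] C(1) by (simp add: abs_mult matern_weight_def)
    qed
  qed
qed

text \<open>Half the square of the Bessel argument is \<open>\<nu> / l\<^sup>2\<close> times the
  squared distance, which fixes the Gaussian rate; lattice sum and mixture integral are exchanged by
  nonnegativity.\<close>

lemma torus_matern_integral:
  fixes x y :: "real ^ 'n"
  assumes nu: "\<nu> > 0" and l: "l > 0"
  shows "torus_matern \<nu> l \<sigma> (to_torus x) (to_torus y) = matern_const \<nu> \<sigma> / 2 *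
    (LINT u|lborel. matern_weight \<nu> u * (\<Prod>i\<in>UNIV. theta (\<nu> / l\<^sup>2 * exp (- u)) ((x - y) $ i)))"
proof -
  define \<beta> where "\<beta> = \<nu> / l\<^sup>2"
  have beta: "\<beta> > 0" using nu l by (simp add: \<beta>_def)
  have pb: "powr_bessel_K \<nu> (sqrt (2 * \<nu>) * norm (x - y + int_vec m) / l) =
      (1/2) * (LINT u|lborel. matern_weight \<nu> u * exp (- (\<beta> * exp (- u)) * (norm (x - y + int_vec m))\<^sup>2))" for m
  proof -
    have "(sqrt (2 * \<nu>) * norm (x - y + int_vec m) / l)\<^sup>2 / 2 = \<beta> * (norm (x - y + int_vec m))\<^sup>2"
      using nu by (simp add: \<beta>_def power_mult_distrib power_divide)
    then show ?thesis
      using powr_bessel_K_integral[OF nu, of "sqrt (2 * \<nu>) * norm (x - y + int_vec m) / l"] nu l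
      by (simp add: matern_weight_def mult_ac)
  qed
  have "((\<lambda>m. LINT u|lborel. matern_weight \<nu> u * exp (- (\<beta> * exp (- u)) * (norm (x - y + int_vec m))\<^sup>2))
     has_sum (LINT u|lborel. matern_weight \<nu> u * theta_prod (\<beta> * exp (- u)) (x - y))) UNIV"
  proof (rule has_sum_integral_nonneg)
    show "(\<lambda>u. matern_weight \<nu> u * exp (- (\<beta> * exp (- u)) * (norm (x - y + int_vec m))\<^sup>2)) \<in> borel_measurable lborel" for m
      unfolding matern_weight_def by measurable
    show "0 \<le> matern_weight \<nu> u * exp (- (\<beta> * exp (- u)) * (norm (x - y + int_vec m))\<^sup>2)" for m u
      by (simp add: matern_weight_def)
    show "((\<lambda>m. matern_weight \<nu> u * exp (- (\<beta> * exp (- u)) * (norm (x - y + int_vec m))\<^sup>2)) has_sum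
         matern_weight \<nu> u * theta_prod (\<beta> * exp (- u)) (x - y)) UNIV" for u
      by (intro has_sum_cmult_right theta_prod_has_sum) (use beta in simp)
  qed (rule matern_theta_integrable[OF nu beta])
  from has_sum_cmult_right[OF this, of "1/2"]
  have "(\<Sum>\<^sub>\<infinity>m\<in>UNIV. powr_bessel_K \<nu> (sqrt (2 * \<nu>) * norm (x - y + int_vec m) / l))
     = (1/2) * (LINT u|lborel. matern_weight \<nu> u * theta_prod (\<beta> * exp (- u)) (x - y))"
    unfolding pb by (rule infsumI)
  then show ?thesis by (simp add: torus_matern.abs_eq \<beta>_def)
qed

section \<open>Centred Gaussian processes\<close>

text \<open>\<open>gaussian_rv\<close> admits degenerate laws, which have no density. The variance
  tells the two cases apart.\<close>

lemma gaussian_rv_centred_cases: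
  assumes M: "prob_space M" and X: "gaussian_rv M X" and mean: "(\<integral>\<omega>. X \<omega> \<partial>M) = 0"
  shows "integrable M (\<lambda>\<omega>. (X \<omega>)\<^sup>2)" (is ?I)
    and "(AE \<omega> in M. X \<omega> = 0) \<and> (\<integral>\<omega>. (X \<omega>)\<^sup>2 \<partial>M) = 0 \<or>
      (\<integral>\<omega>. (X \<omega>)\<^sup>2 \<partial>M) > 0 \<and> distributed M lborel X (normal_density 0 (sqrt (\<integral>\<omega>. (X \<omega>)\<^sup>2 \<partial>M)))" (is ?C)
proof -
  interpret prob_space M by (rule M)
  have meas: "X \<in> borel_measurable M" using X by (simp add: gaussian_rv_def)
  consider \<mu> where "AE \<omega> in M. X \<omega> = \<mu>" | \<mu> s where "s > 0" "distributed M lborel X (normal_density \<mu> s)"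
    using X unfolding gaussian_rv_def by blast
  then have "?I \<and> ?C"
  proof cases
    case 1
    have "(\<integral>\<omega>. X \<omega> \<partial>M) = (\<integral>\<omega>. \<mu> \<partial>M)" by (rule integral_cong_AE) (use 1 meas in auto)
    then have "\<mu> = 0" using mean prob_space by simp
    then have ae: "AE \<omega> in M. X \<omega> = 0" using 1 by simp
    then have ae2: "AE \<omega> in M. (X \<omega>)\<^sup>2 = 0" by eventually_elim simp
    have "integrable M (\<lambda>\<omega>. (X \<omega>)\<^sup>2) \<longleftrightarrow> integrable M (\<lambda>\<omega>. 0::real)"
      by (rule integrable_cong_AE) (use ae2 meas in auto)
    moreover have "(\<integral>\<omega>. (X \<omega>)\<^sup>2 \<partial>M) = (\<integral>\<omega>. 0 \<partial>M)"
      by (rule integral_cong_AE) (use ae2 meas in auto)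
    ultimately show ?thesis using ae by simp
  next
    case 2
    have "\<mu> = 0" using normal_distributed_expectation[OF 2] mean by simp
    then have d: "distributed M lborel X (normal_density 0 s)" using 2 by simp
    have "variance X = s\<^sup>2" by (rule normal_distributed_variance[OF 2(1) d])
    then have v: "(\<integral>\<omega>. (X \<omega>)\<^sup>2 \<partial>M) = s\<^sup>2" using mean by simp
    have "integrable lborel (\<lambda>x. normal_density 0 s x * (x - 0) ^ 2)"
      by (rule integrable_normal_moment[OF 2(1)])
    then have "integrable M (\<lambda>\<omega>. (X \<omega>)\<^sup>2)"
      using distributed_integrable[OF d, of "\<lambda>x. x\<^sup>2"] by (simp add: normal_density_nonneg)
    then show ?thesis using v d 2(1) by simp
  qed
  then show ?I and ?C
    by blast+
qed

text \<open>Markov's inequality for the moment of order \<open>2 * p\<close>. Decay of any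
  prescribed polynomial order is enough against polynomially many grid points.\<close>

lemma gaussian_tail_bound:
  assumes M: "prob_space M" and X: "gaussian_rv M X" and mean: "(\<integral>\<omega>. X \<omega> \<partial>M) = 0"
    and V: "(\<integral>\<omega>. (X \<omega>)\<^sup>2 \<partial>M) \<le> V" and u: "u > 0"
  shows "measure M {\<omega> \<in> space M. \<bar>X \<omega>\<bar> \<ge> u} \<le> fact (2 * p) / (2 ^ p * fact p) * V ^ p / u ^ (2 * p)"
proof -
  interpret prob_space M by (rule M)
  have meas[measurable]: "X \<in> borel_measurable M" using X by (simp add: gaussian_rv_def)
  define v where "v = (\<integral>\<omega>. (X \<omega>)\<^sup>2 \<partial>M)"
  have v0: "v \<ge> 0" unfolding v_def by (rule integral_nonneg_AE) simp
  have V0: "V \<ge> 0" using v0 V unfolding v_def by linarith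
  have "(AE \<omega> in M. X \<omega> = 0) \<or> v > 0 \<and> distributed M lborel X (normal_density 0 (sqrt v))"
    using gaussian_rv_centred_cases(2)[OF M X mean] unfolding v_def by blast
  then show ?thesis
  proof (elim disjE conjE)
    assume "AE \<omega> in M. X \<omega> = 0"
    then have "AE \<omega> in M. \<not> \<bar>X \<omega>\<bar> \<ge> u" using u by (auto elim!: eventually_mono)
    then have "measure M {\<omega> \<in> space M. \<bar>X \<omega>\<bar> \<ge> u} = 0"
      by (subst prob_eq_0) auto
    then show ?thesis using V0 u by simp
  next
    assume v: "v > 0" and d: "distributed M lborel X (normal_density 0 (sqrt v))"
    have s: "sqrt v > 0" using v by simp
    have hb: "has_bochner_integral lborel (\<lambda>x. normal_density 0 (sqrt v) x * (x - 0) ^ (2 * p)) (fact (2 * p) / ((2 / (sqrt v)\<^sup>2) ^ p * fact p))"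
      by (rule normal_moment_even[OF s])
    have int: "integrable M (\<lambda>\<omega>. X \<omega> ^ (2 * p))"
      using distributed_integrable[OF d, of "\<lambda>x. x ^ (2 * p)"] hb by (simp add: normal_density_nonneg has_bochner_integral_iff)
    have "(\<integral>\<omega>. X \<omega> ^ (2 * p) \<partial>M) = fact (2 * p) / ((2 / (sqrt v)\<^sup>2) ^ p * fact p)"
      using distributed_integral[OF d, of "\<lambda>x. x ^ (2 * p)"] hb by (simp add: normal_density_nonneg has_bochner_integral_iff)
    also have "\<dots> = fact (2 * p) / (2 ^ p * fact p) * v ^ p"
      using v by (simp add: power_divide)
    finally have E: "(\<integral>\<omega>. X \<omega> ^ (2 * p) \<partial>M) = fact (2 * p) / (2 ^ p * fact p) * v ^ p" .
    have "measure M {\<omega> \<in> space M. \<bar>X \<omega>\<bar> \<ge> u} \<le> measure M {\<omega> \<in> space M. X \<omega> ^ (2 * p) \<ge> u ^ (2 * p)}"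
    proof (rule finite_measure_mono)
      have "u ^ (2 * p) \<le> X \<omega> ^ (2 * p)" if "\<bar>X \<omega>\<bar> \<ge> u" for \<omega>
      proof -
        have "u ^ (2 * p) \<le> \<bar>X \<omega>\<bar> ^ (2 * p)" using that u by (intro power_mono) auto
        then show ?thesis by (simp add: power_even_abs)
      qed
      then show "{\<omega> \<in> space M. u \<le> \<bar>X \<omega>\<bar>} \<subseteq> {\<omega> \<in> space M. u ^ (2 * p) \<le> X \<omega> ^ (2 * p)}" by auto
    qed measurable
    also have "\<dots> \<le> (\<integral>\<omega>. X \<omega> ^ (2 * p) \<partial>M) / u ^ (2 * p)"
      by (rule integral_Markov_inequality_measure[where A="space M"]) (use int u in auto)
    also have "\<dots> \<le> fact (2 * p) / (2 ^ p * fact p) * V ^ p / u ^ (2 * p)"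
      unfolding E using V v0 u by (intro divide_right_mono mult_left_mono power_mono) (auto simp: v_def)
    finally show ?thesis .
  qed
qed

text \<open>The density is at most \<open>1 / (sqrt v * sqrt (2 * pi))\<close> on an interval of
  length \<open>2 * \<epsilon> * sqrt v\<close>, and
  \<open>2 / sqrt (2 * pi) \<le> 1\<close>.\<close>

lemma gaussian_small_ball:
  assumes M: "prob_space M" and X: "gaussian_rv M X" and mean: "(\<integral>\<omega>. X \<omega> \<partial>M) = 0"
    and v: "v = (\<integral>\<omega>. (X \<omega>)\<^sup>2 \<partial>M)" "v > 0" and e: "\<epsilon> > 0"
  shows "measure M {\<omega> \<in> space M. \<bar>X \<omega>\<bar> \<le> \<epsilon> * sqrt v} \<le> \<epsilon>"
proof -
  interpret prob_space M by (rule M)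
  have meas[measurable]: "X \<in> borel_measurable M" using X by (simp add: gaussian_rv_def)
  have d: "distributed M lborel X (normal_density 0 (sqrt v))"
    using gaussian_rv_centred_cases(2)[OF M X mean] v by auto
  define A where "A = {- (\<epsilon> * sqrt v)..\<epsilon> * sqrt v}"
  define c where "c = 1 / (sqrt v * sqrt (2 * pi))"
  have dens: "normal_density 0 (sqrt v) x \<le> c" for x
  proof -
    have "normal_density 0 (sqrt v) x \<le> 1 / sqrt (2 * pi * (sqrt v)\<^sup>2) * 1"
      unfolding normal_density_def by (intro mult_left_mono) auto
    then show ?thesis using v by (simp add: c_def real_sqrt_mult mult_ac)
  qed
  have "measure M {\<omega> \<in> space M. \<bar>X \<omega>\<bar> \<le> \<epsilon> * sqrt v} = (\<integral>\<omega>. indicator A (X \<omega>) \<partial>M)"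
  proof -
    have "(\<integral>\<omega>. indicator A (X \<omega>) \<partial>M) = (\<integral>\<omega>. indicator {\<omega> \<in> space M. \<bar>X \<omega>\<bar> \<le> \<epsilon> * sqrt v} \<omega> \<partial>M)"
      by (intro Bochner_Integration.integral_cong refl) (auto simp: A_def indicator_def abs_le_iff)
    also have "\<dots> = measure M {\<omega> \<in> space M. \<bar>X \<omega>\<bar> \<le> \<epsilon> * sqrt v}"
    proof -
      have "{\<omega> \<in> space M. \<bar>X \<omega>\<bar> \<le> \<epsilon> * sqrt v} \<inter> space M = {\<omega> \<in> space M. \<bar>X \<omega>\<bar> \<le> \<epsilon> * sqrt v}" by auto
      then show ?thesis by (simp only: Bochner_Integration.integral_indicator)
    qed
    finally show ?thesis ..
  qed
  also have "\<dots> = (\<integral>x. normal_density 0 (sqrt v) x * indicator A x \<partial>lborel)"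
    using distributed_integral[OF d, of "indicator A"] by (simp add: normal_density_nonneg A_def)
  also have "\<dots> \<le> (\<integral>x. c * indicator A x \<partial>lborel)"
  proof (rule integral_mono)
    show i: "integrable lborel (\<lambda>x. c * indicator A x)"
      unfolding A_def by (intro integrable_mult_right integrable_real_indicator) (auto simp: emeasure_lborel_Icc_eq)
    show "integrable lborel (\<lambda>x. normal_density 0 (sqrt v) x * indicator A x)"
      by (rule Bochner_Integration.integrable_bound[OF i])
         (use dens in \<open>auto simp: A_def indicator_def normal_density_nonneg intro: order.trans[OF dens abs_ge_self]\<close>)
    show "normal_density 0 (sqrt v) x * indicator A x \<le> c * indicator A x" for x
      using dens by (intro mult_right_mono) auto
  qed
  also have "\<dots> = c * (2 * (\<epsilon> * sqrt v))"
    using e v by (simp add: A_def)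
  also have "\<dots> = \<epsilon> * (2 / sqrt (2 * pi))" using v by (simp add: c_def field_simps)
  also have "\<dots> \<le> \<epsilon> * 1"
  proof (intro mult_left_mono)
    have "sqrt 4 \<le> sqrt (2 * pi)" using pi_gt3 by (intro real_sqrt_le_mono) simp
    then show "2 / sqrt (2 * pi) \<le> 1" by simp
  qed (use e in simp)
  finally show ?thesis by simp
qed

text \<open>\<open>gaussian_process\<close> speaks of sets of distinct indices; where
  \<open>p\<close> repeats a value, the coefficients are merged.\<close>

lemma gaussian_process_linear_combination:
  assumes "gaussian_process M Z" "finite I"
  shows "gaussian_rv M (\<lambda>\<omega>. \<Sum>j\<in>I. c j * Z (p j) \<omega>)"
proof -
  have "(\<Sum>j\<in>I. c j * Z (p j) \<omega>) = (\<Sum>x\<in>p ` I. (\<Sum>j\<in>{j\<in>I. p j = x}. c j) * Z x \<omega>)" for \<omega>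
  proof -
    have "(\<Sum>j\<in>I. c j * Z (p j) \<omega>) = (\<Sum>x\<in>p ` I. \<Sum>j\<in>{j\<in>I. p j = x}. c j * Z (p j) \<omega>)"
      by (rule sum.image_gen[OF assms(2)])
    also have "\<dots> = (\<Sum>x\<in>p ` I. (\<Sum>j\<in>{j\<in>I. p j = x}. c j) * Z x \<omega>)"
      unfolding sum_distrib_right by (intro sum.cong refl) auto
    finally show ?thesis .
  qed
  then show ?thesis using assms unfolding gaussian_process_def by auto
qed

lemma centred_gaussian_process_moments:
  assumes Z: "gaussian_process M Z" and cen: "centred_process M Z" and I: "finite I"
  shows "(\<integral>\<omega>. (\<Sum>j\<in>I. c j * Z (p j) \<omega>) \<partial>M) = 0"
    and "(\<integral>\<omega>. (\<Sum>j\<in>I. c j * Z (p j) \<omega>)\<^sup>2 \<partial>M) = (\<Sum>i\<in>I. \<Sum>j\<in>I. c i * c j * process_covariance M Z (p i) (p j))"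
proof -
  have M: "prob_space M" using Z by (simp add: gaussian_process_def)
  interpret prob_space M by (rule M)
  have g: "gaussian_rv M (Z x)" for x
    using gaussian_process_linear_combination[OF Z, of "{x}" "\<lambda>_. 1" "\<lambda>x. x"] by simp
  have meas[measurable]: "Z x \<in> borel_measurable M" for x using g[of x] by (simp add: gaussian_rv_def)
  have mean: "(\<integral>\<omega>. Z x \<omega> \<partial>M) = 0" for x using cen by (simp add: centred_process_def)
  have sq: "integrable M (\<lambda>\<omega>. (Z x \<omega>)\<^sup>2)" for x
    by (rule gaussian_rv_centred_cases(1)[OF M g mean])
  have pr: "integrable M (\<lambda>\<omega>. Z x \<omega> * Z y \<omega>)" for x y
  proof (rule Bochner_Integration.integrable_bound)
    show "integrable M (\<lambda>\<omega>. (Z x \<omega>)\<^sup>2 + (Z y \<omega>)\<^sup>2)" by (intro Bochner_Integration.integrable_add sq)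
    have "\<bar>a * b\<bar> \<le> a\<^sup>2 + b\<^sup>2" for a b :: real
    proof -
      have "2 * \<bar>a\<bar> * \<bar>b\<bar> \<le> \<bar>a\<bar>\<^sup>2 + \<bar>b\<bar>\<^sup>2" by (rule sum_squares_bound)
      moreover have "0 \<le> \<bar>a\<bar> * \<bar>b\<bar>" by simp
      ultimately show ?thesis unfolding abs_mult power2_abs by linarith
    qed
    then show "AE \<omega> in M. norm (Z x \<omega> * Z y \<omega>) \<le> norm ((Z x \<omega>)\<^sup>2 + (Z y \<omega>)\<^sup>2)" by simp
  qed measurable
  have int: "integrable M (Z x)" for x
    using square_integrable_imp_integrable[OF meas sq] .
  show "(\<integral>\<omega>. (\<Sum>j\<in>I. c j * Z (p j) \<omega>) \<partial>M) = 0"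
    using int mean by simp
  have "(\<integral>\<omega>. (\<Sum>j\<in>I. c j * Z (p j) \<omega>)\<^sup>2 \<partial>M) = (\<integral>\<omega>. (\<Sum>i\<in>I. \<Sum>j\<in>I. (c i * c j) * (Z (p i) \<omega> * Z (p j) \<omega>)) \<partial>M)"
    unfolding power2_eq_square sum_product by (simp add: mult_ac)
  also have "\<dots> = (\<Sum>i\<in>I. \<Sum>j\<in>I. (c i * c j) * (\<integral>\<omega>. Z (p i) \<omega> * Z (p j) \<omega> \<partial>M))"
    using pr by simp
  finally show "(\<integral>\<omega>. (\<Sum>j\<in>I. c j * Z (p j) \<omega>)\<^sup>2 \<partial>M) = (\<Sum>i\<in>I. \<Sum>j\<in>I. c i * c j * process_covariance M Z (p i) (p j))"
    by (simp add: process_covariance_def mean)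
qed

section \<open>Hoelder regularity of dyadic series\<close>

lemma directional_derivative_shift:
  fixes g :: "'v::real_vector \<Rightarrow> real"
  assumes "\<And>x. ((\<lambda>t. g (x + t *\<^sub>R e)) has_real_derivative g' x) (at 0)"
  shows "((\<lambda>t. g (x + t *\<^sub>R e)) has_real_derivative g' (x + t *\<^sub>R e)) (at t)"
  using assms[of "x + t *\<^sub>R e"] DERIV_shift[of "\<lambda>t. g (x + t *\<^sub>R e)" "g' (x + t *\<^sub>R e)" 0 t]
  by (simp add: scaleR_left_distrib add_ac)

text \<open>Coordinates are switched from \<open>x\<close> to \<open>y\<close> one at a time, those
  in \<open>A\<close> being switched in \<open>z A\<close>; each switch is a mean value estimate
  along an axis.\<close>

lemma lipschitz_of_bounded_partials:
  fixes g :: "real ^ 'n \<Rightarrow> real"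
  assumes der: "\<And>x i. ((\<lambda>t. g (x + t *\<^sub>R axis i 1)) has_real_derivative g' i x) (at 0)"
    and bd: "\<And>x i. \<bar>g' i x\<bar> \<le> L i"
  shows "\<bar>g x - g y\<bar> \<le> (\<Sum>i\<in>UNIV. L i) * norm (x - y)"
proof -
  define z where "z A = (\<chi> i. if i \<in> A then y $ i else x $ i)" for A
  have "\<bar>g x - g (z A)\<bar> \<le> (\<Sum>i\<in>A. L i * norm (x - y))" for A
    using finite[of A]
  proof (induction A rule: finite_induct)
    case empty
    then show ?case by (simp add: z_def)
  next
    case (insert a A)
    define \<tau> where "\<tau> = y $ a - x $ a"
    have z': "z (insert a A) = z A + \<tau> *\<^sub>R axis a 1"
      using insert.hyps by (auto simp: z_def \<tau>_def vec_eq_iff axis_def)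
    have "norm (g (z A + \<tau> *\<^sub>R axis a 1) - g (z A + 0 *\<^sub>R axis a 1)) \<le> L a * norm (\<tau> - 0)"
      by (rule field_differentiable_bound[where S=UNIV and f="\<lambda>t. g (z A + t *\<^sub>R axis a 1)" and f'="\<lambda>t. g' a (z A + t *\<^sub>R axis a 1)"])
         (auto intro: directional_derivative_shift der bd)
    moreover have "\<bar>\<tau>\<bar> \<le> norm (x - y)"
      using component_le_norm_cart[of "x - y" a] by (simp add: \<tau>_def abs_minus_commute)
    moreover have "L a \<ge> 0" using bd[of a x] by linarith
    ultimately have "\<bar>g (z (insert a A)) - g (z A)\<bar> \<le> L a * norm (x - y)"
      unfolding z' using mult_left_mono[of "\<bar>\<tau>\<bar>" "norm (x - y)" "L a"] by simp
    then show ?case using insert by simp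
  qed
  from this[of UNIV] show ?thesis by (simp add: z_def sum_distrib_right)
qed

text \<open>The reason is \<open>min 1 y \<le> y powr \<gamma>\<close>. Below, \<open>y\<close> is a
  distance times \<open>4 ^ k\<close>, the ratio between the Lipschitz bound and the trivial bound
  on an increment.\<close>

lemma interpolate_bounds:
  fixes d C a y \<gamma> :: real
  assumes "d \<le> C * a" "d \<le> C * a * y" "0 \<le> \<gamma>" "\<gamma> \<le> 1" "C \<ge> 0" "a \<ge> 0" "y > 0"
  shows "d \<le> C * a * y powr \<gamma>"
proof (cases "y \<le> 1")
  case True
  have "y = y powr 1" using assms by simp
  also have "\<dots> \<le> y powr \<gamma>" using True assms by (intro powr_mono') auto
  finally have "C * a * y \<le> C * a * y powr \<gamma>" using assms by (intro mult_left_mono) auto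
  then show ?thesis using assms by linarith
next
  case False
  then have "1 \<le> y powr \<gamma>" using assms by (intro ge_one_powr_ge_zero) auto
  then have "C * a * 1 \<le> C * a * y powr \<gamma>" using assms by (intro mult_left_mono) auto
  then show ?thesis using assms by linarith
qed

lemma summable_powr_linear:
  assumes "e < 0"
  shows "summable (\<lambda>k. C * 4 powr (real k * e))"
proof -
  have "(4::real) powr (real k * e) = (4 powr e) ^ k" for k
    by (simp add: powr_power mult.commute)
  moreover have "(4::real) powr e < 1" using assms powr_less_mono[of e 0 4] by simp
  ultimately show ?thesis by (intro summable_mult) (simp add: summable_geometric)
qed

text \<open>Littlewood--Paley characterisation of Hoelder functions: summands with frequencies of order
  \<open>4\<^sup>k\<close> and size \<open>4\<^bsup>-ks\<^esup>\<close>. The multi-index \<open>\<alpha>\<close> gives the derivative.\<close>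

lemma holder_loc_dyadic_series:
  fixes G :: "('n::finite \<Rightarrow> nat) \<Rightarrow> nat \<Rightarrow> real ^ 'n \<Rightarrow> real"
  assumes der: "\<And>\<alpha> k x i. ((\<lambda>t. G \<alpha> k (x + t *\<^sub>R axis i 1)) has_real_derivative G (\<alpha>(i := Suc (\<alpha> i))) k x) (at 0)"
    and bd: "\<And>\<alpha> k x. \<bar>G \<alpha> k x\<bar> \<le> A \<alpha> * 4 powr (real k * (real (sum \<alpha> UNIV) - s))"
    and n\<gamma>: "0 \<le> \<gamma>" "\<gamma> \<le> 1" "real n + \<gamma> < s"
  shows "(\<lambda>x. \<Sum>k. G (\<lambda>_. 0) k x) \<in> holder_loc n \<gamma> V"
proof -
  define S where "S \<alpha> x = (\<Sum>k. G \<alpha> k x)" for \<alpha> x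
  have A0: "A \<alpha> \<ge> 0" for \<alpha>
    using bd[of \<alpha> 0 0] by simp
  have sumS: "summable (\<lambda>k. G \<alpha> k x)" if "real (sum \<alpha> UNIV) < s" for \<alpha> x
    by (rule summable_comparison_test'[OF summable_powr_linear[of "real (sum \<alpha> UNIV) - s" "A \<alpha>"]])
       (use that in \<open>simp_all add: bd del: of_nat_sum\<close>)
  have sum_upd: "sum (\<alpha>(i := Suc (\<alpha> i))) UNIV = Suc (sum \<alpha> UNIV)" for \<alpha> :: "'n \<Rightarrow> nat" and i
  proof -
    have "sum (\<alpha>(i := Suc (\<alpha> i))) UNIV = Suc (\<alpha> i) + sum (\<alpha>(i := Suc (\<alpha> i))) (UNIV - {i})"
      by (subst sum.remove[of UNIV i]) auto
    also have "sum (\<alpha>(i := Suc (\<alpha> i))) (UNIV - {i}) = sum \<alpha> (UNIV - {i})" by (intro sum.cong) auto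
    also have "Suc (\<alpha> i) + sum \<alpha> (UNIV - {i}) = Suc (sum \<alpha> UNIV)"
      using sum.remove[of UNIV i \<alpha>] by simp
    finally show ?thesis .
  qed
  have Sder: "((\<lambda>t. S \<alpha> (x + t *\<^sub>R axis i 1)) has_real_derivative S (\<alpha>(i := Suc (\<alpha> i))) x) (at 0)"
    if "real (Suc (sum \<alpha> UNIV)) < s" for \<alpha> x i
  proof -
    let ?\<beta> = "\<alpha>(i := Suc (\<alpha> i))"
    have "uniformly_convergent_on UNIV (\<lambda>m t. \<Sum>k<m. G ?\<beta> k (x + t *\<^sub>R axis i 1))"
    proof (rule Weierstrass_m_test')
      show "norm (G ?\<beta> k (x + t *\<^sub>R axis i 1)) \<le> A ?\<beta> * 4 powr (real k * (real (sum ?\<beta> UNIV) - s))" for k t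
        unfolding real_norm_def by (rule bd)
      show "summable (\<lambda>k. A ?\<beta> * 4 powr (real k * (real (sum ?\<beta> UNIV) - s)))"
        by (rule summable_powr_linear) (unfold sum_upd, use that in linarith)
    qed
    from has_field_derivative_series'(2)[OF convex_UNIV _ this, of "\<lambda>k t. G \<alpha> k (x + t *\<^sub>R axis i 1)" 0 0]
    show ?thesis
      using directional_derivative_shift[OF der, of \<alpha> _ x i] sumS[of \<alpha> x] that unfolding S_def
      by (simp del: of_nat_sum)
  qed
  \<comment> \<open>In \<open>G\<close> the order of differentiation is already forgotten, so the
    derivative along a word depends only on its letter counts.\<close>
  define cnt where "cnt w = (\<lambda>i. count_list w i)" for w :: "'n list"
  have cnt_sum: "sum (cnt w) UNIV = length w" for w
    unfolding cnt_def by (rule sum_count_set) auto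
  have cnt_Cons: "cnt (i # w) = (cnt w)(i := Suc (cnt w i))" for i w
    by (auto simp: cnt_def)
  have it: "iter_partial w (S (\<lambda>_. 0)) = S (cnt w)" if "length w \<le> n" for w
    using that
  proof (induction w)
    case Nil
    then show ?case by (simp add: cnt_def)
  next
    case (Cons i w)
    have "((\<lambda>t. S (cnt w) (x + t *\<^sub>R axis i 1)) has_real_derivative S (cnt (i # w)) x) (at 0)" for x
      unfolding cnt_Cons by (rule Sder) (use Cons.prems n\<gamma> cnt_sum in auto)
    then show ?case using Cons by (auto simp: partial_deriv_def DERIV_imp_deriv)
  qed
  have ex: "iter_partial_exists w (S (\<lambda>_. 0)) V" if "length w \<le> n" for w
    using that
  proof (induction w)
    case Nil
    then show ?case by simp
  next
    case (Cons i w)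
    have "((\<lambda>t. S (cnt w) (x + t *\<^sub>R axis i 1)) has_real_derivative S (cnt (i # w)) x) (at 0)" for x
      unfolding cnt_Cons by (rule Sder) (use Cons.prems n\<gamma> cnt_sum in auto)
    then have "(\<lambda>t. S (cnt w) (x + t *\<^sub>R axis i 1)) differentiable (at 0)" for x
      using real_differentiable_def by blast
    then show ?case using Cons by (simp add: has_partial_deriv_on_def it)
  qed
  have H: "\<exists>C>0. \<forall>x y. \<bar>S \<alpha> x - S \<alpha> y\<bar> \<le> C * norm (x - y) powr \<gamma>" if \<alpha>: "sum \<alpha> UNIV = n" for \<alpha>
  proof -
    define B where "B = (\<Sum>i\<in>UNIV. A (\<alpha>(i := Suc (\<alpha> i))))"
    define C0 where "C0 = 2 * A \<alpha> + B"
    have B0: "B \<ge> 0" unfolding B_def by (intro sum_nonneg A0)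
    have C0: "C0 \<ge> 0" "2 * A \<alpha> \<le> C0" "B \<le> C0" using A0[of \<alpha>] B0 by (auto simp: C0_def)
    have ns: "real (sum \<alpha> UNIV) < s" using \<alpha> n\<gamma> by linarith
    define T where "T = (\<Sum>k. C0 * 4 powr (real k * (real n + \<gamma> - s)))"
    have sT: "summable (\<lambda>k. C0 * 4 powr (real k * (real n + \<gamma> - s)))"
      using n\<gamma> by (intro summable_powr_linear) simp
    have T0: "T \<ge> 0" unfolding T_def by (rule suminf_nonneg[OF sT]) (use C0 in simp)
    have main: "\<bar>S \<alpha> x - S \<alpha> y\<bar> \<le> T * norm (x - y) powr \<gamma>" if "x \<noteq> y" for x y
    proof -
      define D where "D = norm (x - y)"
      have D: "D > 0" using that by (simp add: D_def)
      \<comment> \<open>The derivatives of order \<open>n + 1\<close> need not be summable over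
        \<open>k\<close>. They enter block by block, interpolated with the trivial bound, and the
        exponent \<open>n + \<gamma> - s\<close> that results is negative.\<close>
      have incr: "\<bar>G \<alpha> k x - G \<alpha> k y\<bar> \<le> C0 * 4 powr (real k * (real n + \<gamma> - s)) * D powr \<gamma>" for k
      proof -
        let ?a = "4 powr (real k * (real n - s)) :: real"
        have 1: "\<bar>G \<alpha> k x - G \<alpha> k y\<bar> \<le> C0 * ?a"
        proof -
          have "\<bar>G \<alpha> k x - G \<alpha> k y\<bar> \<le> 2 * A \<alpha> * ?a"
            using bd[of \<alpha> k x] bd[of \<alpha> k y] unfolding \<alpha> by linarith
          also have "\<dots> \<le> C0 * ?a" by (intro mult_right_mono C0) simp
          finally show ?thesis .
        qed
        have 2: "\<bar>G \<alpha> k x - G \<alpha> k y\<bar> \<le> C0 * ?a * (D * 4 ^ k)"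
        proof -
          have "\<bar>G \<alpha> k x - G \<alpha> k y\<bar> \<le> (\<Sum>i\<in>UNIV. A (\<alpha>(i := Suc (\<alpha> i))) * 4 powr (real k * (real (Suc n) - s))) * norm (x - y)"
            by (rule lipschitz_of_bounded_partials[OF der]) (use bd[of "\<alpha>(_ := _)" k] sum_upd \<alpha> in metis)
          also have "\<dots> = B * (4 powr (real k * (real (Suc n) - s)) * D)"
            by (simp add: B_def D_def sum_distrib_right mult.assoc)
          also have "4 powr (real k * (real (Suc n) - s)) = ?a * 4 ^ k"
            by (simp add: powr_realpow[symmetric] powr_add[symmetric] algebra_simps)
          also have "B * (?a * 4 ^ k * D) \<le> C0 * (?a * 4 ^ k * D)"
            using D by (intro mult_right_mono C0) simp
          finally show ?thesis by (simp add: mult_ac)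
        qed
        have "\<bar>G \<alpha> k x - G \<alpha> k y\<bar> \<le> C0 * ?a * (D * 4 ^ k) powr \<gamma>"
          by (rule interpolate_bounds[OF 1 2]) (use n\<gamma> C0 D in auto)
        also have "(D * 4 ^ k) powr \<gamma> = D powr \<gamma> * 4 powr (real k * \<gamma>)"
          using D by (simp add: powr_mult powr_realpow[symmetric] powr_powr)
        also have "C0 * ?a * (D powr \<gamma> * 4 powr (real k * \<gamma>)) = C0 * 4 powr (real k * (real n + \<gamma> - s)) * D powr \<gamma>"
          by (simp add: powr_add[symmetric] algebra_simps)
        finally show ?thesis .
      qed
      have s1: "summable (\<lambda>k. C0 * 4 powr (real k * (real n + \<gamma> - s)) * D powr \<gamma>)"
        by (rule summable_mult2[OF sT])
      have s2: "summable (\<lambda>k. \<bar>G \<alpha> k x - G \<alpha> k y\<bar>)"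
        by (rule summable_comparison_test'[OF s1]) (use incr in auto)
      have "S \<alpha> x - S \<alpha> y = (\<Sum>k. G \<alpha> k x - G \<alpha> k y)"
        unfolding S_def by (rule suminf_diff) (intro sumS ns)+
      then have "\<bar>S \<alpha> x - S \<alpha> y\<bar> \<le> (\<Sum>k. \<bar>G \<alpha> k x - G \<alpha> k y\<bar>)"
        using summable_rabs[OF s2] by simp
      also have "\<dots> \<le> (\<Sum>k. C0 * 4 powr (real k * (real n + \<gamma> - s)) * D powr \<gamma>)"
        by (rule suminf_le[OF incr s2 s1])
      also have "\<dots> = T * D powr \<gamma>" unfolding T_def by (rule suminf_mult2[OF sT, symmetric])
      finally show ?thesis by (simp add: D_def)
    qed
    show ?thesis
    proof (intro exI[of _ "T + 1"] conjI allI)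
      show "T + 1 > 0" using T0 by simp
      fix x y
      show "\<bar>S \<alpha> x - S \<alpha> y\<bar> \<le> (T + 1) * norm (x - y) powr \<gamma>"
      proof (cases "x = y")
        case False
        have "T * norm (x - y) powr \<gamma> \<le> (T + 1) * norm (x - y) powr \<gamma>" by (intro mult_right_mono) auto
        then show ?thesis using main[OF False] by linarith
      qed simp
    qed
  qed
  have "\<exists>C. \<forall>w\<in>{w::'n list. length w = n}. C w > 0 \<and> (\<forall>x y. \<bar>S (cnt w) x - S (cnt w) y\<bar> \<le> C w * norm (x - y) powr \<gamma>)"
  proof (rule bchoice, rule ballI)
    fix w :: "'n list" assume "w \<in> {w. length w = n}"
    then show "\<exists>C>0. \<forall>x y. \<bar>S (cnt w) x - S (cnt w) y\<bar> \<le> C * norm (x - y) powr \<gamma>"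
      by (intro H) (simp only: cnt_sum mem_Collect_eq)
  qed
  then obtain C where C1: "\<forall>w\<in>{w::'n list. length w = n}. C w > 0 \<and> (\<forall>x y. \<bar>S (cnt w) x - S (cnt w) y\<bar> \<le> C w * norm (x - y) powr \<gamma>)"
    by (rule exE)
  have C: "C w > 0 \<and> (\<forall>x y. \<bar>S (cnt w) x - S (cnt w) y\<bar> \<le> C w * norm (x - y) powr \<gamma>)" if "length w = n" for w
    by (rule bspec[OF C1]) (simp only: mem_Collect_eq that)
  \<comment> \<open>There are finitely many words of length \<open>n\<close>, so one constant serves
    all of them, as \<open>holder_loc\<close> demands.\<close>
  define W where "W = {w::'n list. length w = n}"
  have finW: "finite W" unfolding W_def using finite_lists_length_eq[of "UNIV :: 'n set" n] by simp
  define C' where "C' = 1 + sum C W"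
  have C'0: "C' > 0" unfolding C'_def using C by (intro add_pos_nonneg sum_nonneg) (auto simp: W_def less_imp_le)
  have C': "\<bar>S (cnt w) x - S (cnt w) y\<bar> \<le> C' * norm (x - y) powr \<gamma>" if "length w = n" for w x y
  proof -
    have "C w \<le> sum C W" using that C finW by (intro member_le_sum) (auto simp: W_def less_imp_le)
    then have "C w * norm (x - y) powr \<gamma> \<le> C' * norm (x - y) powr \<gamma>" by (intro mult_right_mono) (auto simp: C'_def)
    then show ?thesis using C[OF that] by (meson order.trans)
  qed
  have "S (\<lambda>_. 0) \<in> holder_loc n \<gamma> V"
    unfolding holder_loc_def mem_Collect_eq
  proof (intro conjI allI impI)
    fix w :: "'n list" assume "length w \<le> n"
    then show "iter_partial_exists w (S (\<lambda>_. 0)) V" by (rule ex)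
  next
    fix K :: "(real ^ 'n) set"
    show "\<exists>C>0. \<forall>x\<in>K. \<forall>y\<in>K. \<forall>w. length w = n \<longrightarrow>
        \<bar>iter_partial w (S (\<lambda>_. 0)) x - iter_partial w (S (\<lambda>_. 0)) y\<bar> \<le> C * norm (x - y) powr \<gamma>"
    proof (intro exI[of _ C'] conjI ballI allI impI)
      show "C' > 0" by (rule C'0)
      fix x y and w :: "'n list" assume "length w = n"
      then show "\<bar>iter_partial w (S (\<lambda>_. 0)) x - iter_partial w (S (\<lambda>_. 0)) y\<bar> \<le> C' * norm (x - y) powr \<gamma>"
        using it[of w] C'[of w x y] by simp
    qed
  qed
  then show ?thesis by (simp add: S_def[abs_def])
qed

section \<open>Approximation by low frequencies\<close>

definition theta_trunc :: "real \<Rightarrow> nat \<Rightarrow> real \<Rightarrow> real" where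
  "theta_trunc b N s = theta_coeff b 0 + (\<Sum>n<N. 2 * theta_coeff b (Suc n) * cos (2 * pi * real (Suc n) * s))"

lemma theta_coeff_sums:
  assumes b: "b > 0"
  shows "(\<lambda>n. 2 * theta_coeff b (Suc n)) sums (theta b 0 - theta_coeff b 0)"
  using theta_poisson[OF b, of 0] by simp

lemma theta_coeff_term_le:
  "b > 0 \<Longrightarrow> \<bar>2 * theta_coeff b (Suc n) * cos z\<bar> \<le> 2 * theta_coeff b (Suc n)"
  using theta_coeff_pos[of b "Suc n"] by (simp add: abs_mult)

text \<open>Since \<open>(N + n + 1)^2 \<ge> N^2 + (n + 1)^2\<close>, the tail is at most
  \<open>exp (- pi^2 * N^2 / b)\<close> times the full series of coefficients, with no further
  dependence on \<open>b\<close>.\<close>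

lemma theta_trunc_error:
  assumes b: "b > 0"
  shows "\<bar>theta b s - theta_trunc b N s\<bar> \<le> exp (- pi\<^sup>2 * (real N)\<^sup>2 / b) * theta b 0"
proof -
  let ?t = "\<lambda>n. 2 * theta_coeff b (Suc n) * cos (2 * pi * real (Suc n) * s)"
  let ?E = "exp (- pi\<^sup>2 * (real N)\<^sup>2 / b)"
  have s1: "(\<lambda>n. ?t (n + N)) sums (theta b s - theta_trunc b N s)"
    using sums_split_initial_segment[OF theta_poisson[OF b, of s], of N]
    by (simp add: theta_trunc_def algebra_simps)
  have cle: "theta_coeff b (Suc (n + N)) \<le> ?E * theta_coeff b (Suc n)" for n
  proof -
    have "(real N)\<^sup>2 + (real (Suc n))\<^sup>2 \<le> (real (Suc (n + N)))\<^sup>2"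
      by (simp add: power2_eq_square algebra_simps)
    then have "pi\<^sup>2 * ((real N)\<^sup>2 + (real (Suc n))\<^sup>2) \<le> pi\<^sup>2 * (real (Suc (n + N)))\<^sup>2"
      by (rule mult_left_mono) simp
    then have "- pi\<^sup>2 * (real (Suc (n + N)))\<^sup>2 \<le> - pi\<^sup>2 * (real N)\<^sup>2 + - pi\<^sup>2 * (real (Suc n))\<^sup>2"
      unfolding distrib_left mult_minus_left by linarith
    then have "- pi\<^sup>2 * (real (Suc (n + N)))\<^sup>2 / b \<le> - pi\<^sup>2 * (real N)\<^sup>2 / b + - pi\<^sup>2 * (real (Suc n))\<^sup>2 / b"
      using divide_right_mono[OF _ less_imp_le[OF b]] by (simp only: add_divide_distrib[symmetric])
    then have "exp (- pi\<^sup>2 * (real (Suc (n + N)))\<^sup>2 / b) \<le> ?E * exp (- pi\<^sup>2 * (real (Suc n))\<^sup>2 / b)"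
      unfolding exp_add[symmetric] exp_le_cancel_iff .
    then have "sqrt (pi / b) * exp (- pi\<^sup>2 * (real (Suc (n + N)))\<^sup>2 / b) \<le> sqrt (pi / b) * (?E * exp (- pi\<^sup>2 * (real (Suc n))\<^sup>2 / b))"
      using b by (intro mult_left_mono) auto
    then show ?thesis unfolding theta_coeff_def by (simp only: mult_ac)
  qed
  have s2: "(\<lambda>n. ?E * (2 * theta_coeff b (Suc n))) sums (?E * (theta b 0 - theta_coeff b 0))"
    by (rule sums_mult[OF theta_coeff_sums[OF b]])
  have tle: "\<bar>?t (n + N)\<bar> \<le> ?E * (2 * theta_coeff b (Suc n))" for n
    using theta_coeff_term_le[OF b, of "n + N" "2 * pi * real (Suc (n + N)) * s"] cle[of n] by linarith
  have s3: "summable (\<lambda>n. \<bar>?t (n + N)\<bar>)"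
    by (rule summable_comparison_test'[OF sums_summable[OF s2]]) (use tle in auto)
  have "\<bar>theta b s - theta_trunc b N s\<bar> \<le> (\<Sum>n. \<bar>?t (n + N)\<bar>)"
    using summable_rabs[OF s3] sums_unique[OF s1] by simp
  also have "\<dots> \<le> (\<Sum>n. ?E * (2 * theta_coeff b (Suc n)))"
    by (rule suminf_le[OF tle s3 sums_summable[OF s2]])
  also have "\<dots> = ?E * (theta b 0 - theta_coeff b 0)" using sums_unique[OF s2] by simp
  also have "\<dots> \<le> ?E * theta b 0" using theta_coeff_pos[OF b, of 0] by (intro mult_left_mono) auto
  finally show ?thesis .
qed

lemma theta_trunc_le:
  assumes b: "b > 0"
  shows "\<bar>theta_trunc b N s\<bar> \<le> theta b 0"
proof -
  have "\<bar>theta_trunc b N s\<bar> \<le> theta_coeff b 0 + (\<Sum>n<N. 2 * theta_coeff b (Suc n))"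
    unfolding theta_trunc_def
    using theta_coeff_pos[OF b, of 0]
      sum_abs[of "\<lambda>n. 2 * theta_coeff b (Suc n) * cos (2 * pi * real (Suc n) * s)" "{..<N}"]
      sum_mono[of "{..<N}" "\<lambda>n. \<bar>2 * theta_coeff b (Suc n) * cos (2 * pi * real (Suc n) * s)\<bar>" "\<lambda>n. 2 * theta_coeff b (Suc n)"]
      theta_coeff_term_le[OF b]
    by (smt (verit, best))
  also have "(\<Sum>n<N. 2 * theta_coeff b (Suc n)) \<le> theta b 0 - theta_coeff b 0"
    using sum_le_suminf[OF sums_summable[OF theta_coeff_sums[OF b]], of "{..<N}"] theta_coeff_pos[OF b]
      sums_unique[OF theta_coeff_sums[OF b]] by (simp add: less_imp_le)
  finally show ?thesis by simp
qed

lemma vp_reproduces_theta_trunc: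
  assumes N: "N > 0"
  shows "(\<Sum>j<8*N. vp N 0 (x - real j / real (8*N)) * theta_trunc b N (real j / real (8*N) - s)) = theta_trunc b N (x - s)"
proof -
  let ?v = "\<lambda>j. vp N 0 (x - real j / real (8*N))" and ?y = "\<lambda>j. real j / real (8*N) - s"
  have r: "(\<Sum>j<8*N. ?v j * cos (2 * pi * real m * ?y j)) = cos (2 * pi * real m * (x - s))" if "m \<le> N" for m
    using vp_reproduces_cos[OF N, of "int m" x s] that by simp
  have "(\<Sum>j<8*N. ?v j * theta_trunc b N (?y j)) = (\<Sum>j<8*N. ?v j * theta_coeff b 0)
      + (\<Sum>j<8*N. \<Sum>n<N. 2 * theta_coeff b (Suc n) * (?v j * cos (2 * pi * real (Suc n) * ?y j)))"
    unfolding theta_trunc_def distrib_left sum.distrib sum_distrib_left by (simp only: mult_ac)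
  also have "(\<Sum>j<8*N. ?v j * theta_coeff b 0) = theta_coeff b 0"
    using r[of 0] by (simp add: sum_distrib_right[symmetric])
  also have "(\<Sum>j<8*N. \<Sum>n<N. 2 * theta_coeff b (Suc n) * (?v j * cos (2 * pi * real (Suc n) * ?y j)))
     = (\<Sum>n<N. 2 * theta_coeff b (Suc n) * (\<Sum>j<8*N. ?v j * cos (2 * pi * real (Suc n) * ?y j)))"
    unfolding sum_distrib_left by (rule sum.swap)
  also have "\<dots> = (\<Sum>n<N. 2 * theta_coeff b (Suc n) * cos (2 * pi * real (Suc n) * (x - s)))"
    by (intro sum.cong refl arg_cong2[where f="(*)"] r) auto
  finally show ?thesis by (simp only: theta_trunc_def)
qed

section \<open>Tensor products of the one-dimensional sampling operator\<close>

definition grid :: "nat \<Rightarrow> ('n::finite \<Rightarrow> nat) set" where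
  "grid N = PiE UNIV (\<lambda>_. {..<8*N})"

definition grid_point :: "nat \<Rightarrow> ('n::finite \<Rightarrow> nat) \<Rightarrow> real ^ 'n" where
  "grid_point N j = (\<chi> i. real (j i) / real (8*N))"

text \<open>Counting derivatives per coordinate in \<open>\<alpha>\<close> makes the family closed
  under partial differentiation.\<close>

definition grid_kernel :: "nat \<Rightarrow> ('n::finite \<Rightarrow> nat) \<Rightarrow> real ^ 'n \<Rightarrow> ('n \<Rightarrow> nat) \<Rightarrow> real" where
  "grid_kernel N \<alpha> x j = (\<Prod>i\<in>UNIV. vp N (\<alpha> i) (x $ i - real (j i) / real (8*N)))"

lemma finite_grid: "finite (grid N)"
  unfolding grid_def by (intro finite_PiE) auto

lemma card_grid: "card (grid N :: ('n::finite \<Rightarrow> nat) set) = (8 * N) ^ CARD('n)"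
  unfolding grid_def by (subst card_PiE) auto

lemma sum_abs_grid_kernel_le:
  fixes x :: "real ^ 'n"
  assumes "N > 0"
  shows "(\<Sum>j\<in>grid N. \<bar>grid_kernel N \<alpha> x j\<bar>) \<le> 2 ^ CARD('n) * (2 * pi * (3 * real N)) ^ sum \<alpha> UNIV"
proof -
  have "(\<Sum>j\<in>grid N. \<bar>grid_kernel N \<alpha> x j\<bar>) = (\<Prod>i\<in>UNIV. \<Sum>j<8*N. \<bar>vp N (\<alpha> i) (x $ i - real j / real (8*N))\<bar>)"
    unfolding grid_def grid_kernel_def abs_prod by (rule prod_sum_PiE[symmetric]) auto
  also have "\<dots> \<le> (\<Prod>i\<in>(UNIV::'n set). 2 * (2 * pi * (3 * real N)) ^ \<alpha> i)"
    by (intro prod_mono conjI sum_nonneg sum_abs_vp_le assms) auto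
  also have "\<dots> = 2 ^ CARD('n) * (2 * pi * (3 * real N)) ^ sum \<alpha> UNIV"
    by (simp add: prod.distrib power_sum)
  finally show ?thesis .
qed

text \<open>Sampling a tensor product acts coordinatewise; this carries the one-dimensional
  reproduction properties over to the torus.\<close>

lemma grid_kernel_product:
  fixes x :: "real ^ 'n"
  shows "(\<Sum>j\<in>grid N. grid_kernel N (\<lambda>_. 0) x j * (\<Prod>i\<in>UNIV. f i (real (j i) / real (8*N))))
    = (\<Prod>i\<in>UNIV. \<Sum>j<8*N. vp N 0 (x $ i - real j / real (8*N)) * f i (real j / real (8*N)))"
  unfolding grid_def grid_kernel_def prod.distrib[symmetric] by (rule prod_sum_PiE[symmetric]) auto

lemma grid_kernel_reproduces_theta_trunc:
  fixes x y :: "real ^ 'n"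
  assumes "N > 0"
  shows "(\<Sum>j\<in>grid N. grid_kernel N (\<lambda>_. 0) x j * (\<Prod>i\<in>UNIV. theta_trunc b N ((grid_point N j - y) $ i)))
    = (\<Prod>i\<in>UNIV. theta_trunc b N ((x - y) $ i))"
  using grid_kernel_product[of N x "\<lambda>i s. theta_trunc b N (s - y $ i)"]
  by (simp only: grid_point_def vector_minus_component vec_lambda_beta vp_reproduces_theta_trunc[OF assms])

lemma grid_kernel_reproduces_grid_kernel:
  fixes x :: "real ^ 'n"
  assumes "N > 0" "3 * N \<le> N'"
  shows "(\<Sum>j\<in>grid N'. grid_kernel N' (\<lambda>_. 0) x j * grid_kernel N (\<lambda>_. 0) (grid_point N' j) m)
    = grid_kernel N (\<lambda>_. 0) x m"
  using grid_kernel_product[of N' x "\<lambda>i s. vp N 0 (s - real (m i) / real (8*N))"]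
  by (simp only: grid_point_def grid_kernel_def vec_lambda_beta vp_reproduces_vp[OF assms])

lemma grid_kernel_periodic: "grid_kernel N \<alpha> (x + int_vec m) j = grid_kernel N \<alpha> x j"
proof -
  have "vp N (\<alpha> i) ((x + int_vec m) $ i - real (j i) / real (8*N)) = vp N (\<alpha> i) (x $ i - real (j i) / real (8*N))" for i
    using vp_periodic[of N "\<alpha> i" "x $ i - real (j i) / real (8*N)" "m $ i"]
    by (simp add: int_vec_def algebra_simps)
  then show ?thesis by (simp only: grid_kernel_def)
qed

lemma grid_kernel_has_derivative:
  "((\<lambda>t. grid_kernel N \<alpha> (x + t *\<^sub>R axis i 1) j) has_real_derivative grid_kernel N (\<alpha>(i := Suc (\<alpha> i))) x j) (at 0)"
proof -
  let ?r = "\<lambda>k. real (j k) / real (8*N)"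
  let ?P = "\<Prod>k\<in>UNIV - {i}. vp N (\<alpha> k) (x $ k - ?r k)"
  have 1: "grid_kernel N \<alpha> (x + t *\<^sub>R axis i 1) j = vp N (\<alpha> i) (t + (x $ i - ?r i)) * ?P" for t
  proof -
    have "(\<Prod>k\<in>UNIV - {i}. vp N (\<alpha> k) ((x + t *\<^sub>R axis i 1) $ k - ?r k)) = ?P"
      by (intro prod.cong refl) (auto simp: axis_def)
    then show ?thesis unfolding grid_kernel_def by (subst prod.remove[of UNIV i]) (auto simp: algebra_simps)
  qed
  have 2: "grid_kernel N (\<alpha>(i := Suc (\<alpha> i))) x j = vp N (Suc (\<alpha> i)) (x $ i - ?r i) * ?P"
  proof -
    have "(\<Prod>k\<in>UNIV - {i}. vp N ((\<alpha>(i := Suc (\<alpha> i))) k) (x $ k - ?r k)) = ?P"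
      by (intro prod.cong refl) auto
    then show ?thesis unfolding grid_kernel_def by (subst prod.remove[of UNIV i]) auto
  qed
  have "((\<lambda>t. vp N (\<alpha> i) (t + (x $ i - ?r i))) has_real_derivative vp N (Suc (\<alpha> i)) (x $ i - ?r i)) (at 0)"
    using DERIV_shift[of "vp N (\<alpha> i)" "vp N (Suc (\<alpha> i)) (x $ i - ?r i)" 0 "x $ i - ?r i"] vp_has_derivative by simp
  then show ?thesis unfolding 1 2 by (rule DERIV_cmult_right)
qed

section \<open>Variance of functionals that annihilate low frequencies\<close>

lemma prod_diff_le:
  fixes f g :: "'i \<Rightarrow> real"
  assumes "finite A" "\<And>i. i \<in> A \<Longrightarrow> \<bar>f i\<bar> \<le> T" "\<And>i. i \<in> A \<Longrightarrow> \<bar>g i\<bar> \<le> T"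
    "\<And>i. i \<in> A \<Longrightarrow> \<bar>f i - g i\<bar> \<le> E * T" "T \<ge> 0" "E \<ge> 0"
  shows "\<bar>prod f A - prod g A\<bar> \<le> real (card A) * E * T ^ card A"
  using assms(1-4)
proof (induction A rule: finite_induct)
  case empty
  then show ?case by simp
next
  case (insert a A)
  have IH: "\<bar>prod f A - prod g A\<bar> \<le> real (card A) * E * T ^ card A"
    using insert.IH insert.prems by blast
  have pf: "\<bar>prod f A\<bar> \<le> T ^ card A"
    unfolding abs_prod using prod_mono[of A "\<lambda>i. \<bar>f i\<bar>" "\<lambda>_. T"] insert.prems by auto
  have "prod f (insert a A) - prod g (insert a A) = (f a - g a) * prod f A + g a * (prod f A - prod g A)"
    using insert.hyps by (simp add: algebra_simps)
  then have "\<bar>prod f (insert a A) - prod g (insert a A)\<bar> \<le> \<bar>f a - g a\<bar> * \<bar>prod f A\<bar> + \<bar>g a\<bar> * \<bar>prod f A - prod g A\<bar>"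
    by (metis abs_mult abs_triangle_ineq)
  also have "\<dots> \<le> (E * T) * T ^ card A + T * (real (card A) * E * T ^ card A)"
    using insert.prems assms(5,6) by (intro add_mono mult_mono pf IH) auto
  also have "\<dots> = real (card (insert a A)) * E * T ^ card (insert a A)"
    using insert.hyps by (simp add: algebra_simps)
  finally show ?case .
qed

text \<open>The variance of a functional that annihilates low frequencies is at most the error of the
  best approximation of the covariance by low frequencies.\<close>

lemma quadratic_form_theta_le:
  fixes q :: "'i \<Rightarrow> real ^ 'n"
  assumes b: "b > 0" and I: "finite I" and A: "(\<Sum>p\<in>I. \<bar>c p\<bar>) \<le> A"
    and kill: "\<And>y. (\<Sum>p\<in>I. c p * (\<Prod>i\<in>UNIV. theta_trunc b N ((q p - y) $ i))) = 0"
  shows "(\<Sum>p\<in>I. \<Sum>r\<in>I. c p * c r * theta_prod b (q p - q r))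
    \<le> A\<^sup>2 * (real CARD('n) * exp (- pi\<^sup>2 * (real N)\<^sup>2 / b) * theta b 0 ^ CARD('n))"
proof -
  let ?T = "\<lambda>x::real^'n. \<Prod>i\<in>UNIV. theta b (x $ i)" and ?U = "\<lambda>x::real^'n. \<Prod>i\<in>UNIV. theta_trunc b N (x $ i)"
  let ?B = "real CARD('n) * exp (- pi\<^sup>2 * (real N)\<^sup>2 / b) * theta b 0 ^ CARD('n)"
  have th0: "theta b 0 \<ge> 0" by (rule theta_nonneg[OF b])
  have B0: "?B \<ge> 0" using th0 by simp
  have A0: "A \<ge> 0" using A sum_nonneg[of I "\<lambda>p. \<bar>c p\<bar>"] by linarith
  have d: "\<bar>?T x - ?U x\<bar> \<le> ?B" for x
    using theta_nonneg[OF b] theta_le_theta_0[OF b] theta_trunc_le[OF b] theta_trunc_error[OF b] th0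
    by (intro prod_diff_le) auto
  \<comment> \<open>With \<open>r\<close> frozen, \<open>q r\<close> plays the role of
    \<open>y\<close> in \<open>kill\<close>, so the truncated kernel contributes nothing to the
    quadratic form.\<close>
  have "(\<Sum>p\<in>I. \<Sum>r\<in>I. c p * c r * ?U (q p - q r)) = (\<Sum>r\<in>I. c r * (\<Sum>p\<in>I. c p * ?U (q p - q r)))"
    unfolding sum_distrib_left by (subst sum.swap) (simp only: mult_ac)
  then have "(\<Sum>p\<in>I. \<Sum>r\<in>I. c p * c r * ?U (q p - q r)) = 0" unfolding kill by simp
  then have "(\<Sum>p\<in>I. \<Sum>r\<in>I. c p * c r * ?T (q p - q r)) = (\<Sum>p\<in>I. \<Sum>r\<in>I. c p * c r * (?T (q p - q r) - ?U (q p - q r)))"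
    by (simp add: right_diff_distrib sum_subtractf)
  also have "\<dots> \<le> (\<Sum>p\<in>I. \<Sum>r\<in>I. \<bar>c p\<bar> * \<bar>c r\<bar> * ?B)"
  proof (intro sum_mono)
    fix p r
    have "c p * c r * (?T (q p - q r) - ?U (q p - q r)) \<le> \<bar>c p\<bar> * \<bar>c r\<bar> * \<bar>?T (q p - q r) - ?U (q p - q r)\<bar>"
      by (metis abs_ge_self abs_mult)
    also have "\<dots> \<le> \<bar>c p\<bar> * \<bar>c r\<bar> * ?B" by (intro mult_left_mono d) auto
    finally show "c p * c r * (?T (q p - q r) - ?U (q p - q r)) \<le> \<bar>c p\<bar> * \<bar>c r\<bar> * ?B" .
  qed
  also have "\<dots> = (\<Sum>p\<in>I. \<bar>c p\<bar>)\<^sup>2 * ?B"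
    by (subst power2_eq_square, subst sum_product) (simp only: sum_distrib_right)
  also have "\<dots> \<le> A\<^sup>2 * ?B"
    using A B0 A0 by (intro mult_right_mono power_mono sum_nonneg) auto
  finally show ?thesis .
qed

text \<open>Integration of the previous bound over the mixture. Annihilation is asked for every
  \<open>b\<close> because \<open>b = \<beta> * exp (- u)\<close> runs through all scales;
  \<open>K\<close> depends neither on the functional nor on \<open>N\<close>.\<close>

lemma quadratic_form_matern_le:
  assumes nu: "\<nu> > 0" and l: "l > 0"
  obtains K where "K > 0"
    "\<And>(I::'i set) c (q :: 'i \<Rightarrow> real ^ 'n) A N. N > 0 \<Longrightarrow> finite I \<Longrightarrow> (\<Sum>p\<in>I. \<bar>c p\<bar>) \<le> A \<Longrightarrow>
      (\<And>b y. (\<Sum>p\<in>I. c p * (\<Prod>i\<in>UNIV. theta_trunc b N ((q p - y) $ i))) = 0) \<Longrightarrow>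
      (\<Sum>p\<in>I. \<Sum>r\<in>I. c p * c r * torus_matern \<nu> l \<sigma> (to_torus (q p)) (to_torus (q r))) \<le> A\<^sup>2 * K * real N powr (- (2 * \<nu>))"
proof -
  define \<beta> where "\<beta> = \<nu> / l\<^sup>2"
  have beta: "\<beta> > 0" using nu l by (simp add: \<beta>_def)
  define \<kappa> where "\<kappa> = pi\<^sup>2 / \<beta>"
  have kappa: "\<kappa> > 0" using beta by (simp add: \<kappa>_def)
  obtain C where C: "C > 0" "\<And>\<nu> u. matern_weight \<nu> u * theta (\<beta> * exp (- u)) 0 ^ CARD('n) \<le> C * exp (\<nu> * u - (1/4) * exp u)"
    using matern_weight_theta_bound[OF beta, of "CARD('n)"] by metis
  define m where "m = matern_const \<nu> \<sigma> / 2"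
  have m0: "m \<ge> 0" using nu by (simp add: m_def matern_const_def Gamma_real_pos less_imp_le)
  \<comment> \<open>The summand 1 keeps \<open>K\<close> positive also when
    \<open>\<sigma> = 0\<close>.\<close>
  define K where "K = m * real CARD('n) * C * \<kappa> powr (- \<nu>) * Gamma \<nu> + 1"
  have K0: "m * real CARD('n) * C * \<kappa> powr (- \<nu>) * Gamma \<nu> \<ge> 0"
    using m0 C nu by (simp add: Gamma_real_pos less_imp_le)
  show thesis
  proof (rule that[of K])
    show "K > 0" unfolding K_def using K0 by linarith
    fix I :: "'i set" and c and q :: "'i \<Rightarrow> real ^ 'n" and A and N :: nat
    assume N: "N > 0" and I: "finite I" and A: "(\<Sum>p\<in>I. \<bar>c p\<bar>) \<le> A"
      and kill: "\<And>b y. (\<Sum>p\<in>I. c p * (\<Prod>i\<in>UNIV. theta_trunc b N ((q p - y) $ i))) = 0"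
    let ?T = "\<lambda>u (x::real^'n). \<Prod>i\<in>UNIV. theta (\<beta> * exp (- u)) (x $ i)"
    have int: "integrable lborel (\<lambda>u. c p * c r * (matern_weight \<nu> u * ?T u (q p - q r)))" for p r
      by (intro integrable_mult_right matern_theta_integrable nu beta)
    have int2: "integrable lborel (\<lambda>u. \<Sum>p\<in>I. \<Sum>r\<in>I. c p * c r * (matern_weight \<nu> u * ?T u (q p - q r)))"
      by (intro Bochner_Integration.integrable_sum int)
    have hb: "has_bochner_integral lborel (\<lambda>u. exp (\<nu> * u - (\<kappa> * (real N)\<^sup>2) * exp u)) ((\<kappa> * (real N)\<^sup>2) powr (- \<nu>) * Gamma \<nu>)"
      by (rule has_bochner_integral_Gamma_exp_scaled) (use nu kappa N in auto)
    have "(\<Sum>p\<in>I. \<Sum>r\<in>I. c p * c r * torus_matern \<nu> l \<sigma> (to_torus (q p)) (to_torus (q r)))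
       = (\<Sum>p\<in>I. \<Sum>r\<in>I. m * (LINT u|lborel. c p * c r * (matern_weight \<nu> u * ?T u (q p - q r))))"
      unfolding torus_matern_integral[OF nu l] m_def \<beta>_def by (simp add: mult_ac)
    also have "\<dots> = m * (LINT u|lborel. (\<Sum>p\<in>I. \<Sum>r\<in>I. c p * c r * (matern_weight \<nu> u * ?T u (q p - q r))))"
      using int by (simp add: Bochner_Integration.integrable_sum sum_distrib_left)
    also have "\<dots> \<le> m * (LINT u|lborel. A\<^sup>2 * real CARD('n) * C * exp (\<nu> * u - (\<kappa> * (real N)\<^sup>2) * exp u))"
    proof (intro mult_left_mono m0 integral_mono int2)
      show "integrable lborel (\<lambda>u. A\<^sup>2 * real CARD('n) * C * exp (\<nu> * u - (\<kappa> * (real N)\<^sup>2) * exp u))"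
        using hb by (intro integrable_mult_right) (simp add: has_bochner_integral_iff)
      fix u
      have b: "\<beta> * exp (- u) > 0" using beta by simp
      have e: "- pi\<^sup>2 * (real N)\<^sup>2 / (\<beta> * exp (- u)) = - (\<kappa> * (real N)\<^sup>2 * exp u)"
        using beta by (simp add: \<kappa>_def exp_minus field_simps)
      have "(\<Sum>p\<in>I. \<Sum>r\<in>I. c p * c r * (matern_weight \<nu> u * ?T u (q p - q r)))
         = matern_weight \<nu> u * (\<Sum>p\<in>I. \<Sum>r\<in>I. c p * c r * ?T u (q p - q r))"
        unfolding sum_distrib_left by (simp only: mult_ac)
      also have "\<dots> \<le> matern_weight \<nu> u * (A\<^sup>2 * (real CARD('n) * exp (- (\<kappa> * (real N)\<^sup>2 * exp u)) * theta (\<beta> * exp (- u)) 0 ^ CARD('n)))"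
        using quadratic_form_theta_le[OF b I A kill] unfolding e
        by (intro mult_left_mono) (auto simp: matern_weight_def)
      also have "\<dots> = A\<^sup>2 * real CARD('n) * exp (- (\<kappa> * (real N)\<^sup>2 * exp u)) * (matern_weight \<nu> u * theta (\<beta> * exp (- u)) 0 ^ CARD('n))"
        by (simp only: mult_ac)
      also have "\<dots> \<le> A\<^sup>2 * real CARD('n) * exp (- (\<kappa> * (real N)\<^sup>2 * exp u)) * (C * exp (\<nu> * u))"
      proof (intro mult_left_mono)
        \<comment> \<open>The leftover decay \<open>exp (- exp u / 4)\<close> is given up:
          \<open>exp (- \<kappa> * N^2 * exp u)\<close> already makes the integral converge, and its
          value contains the power \<open>N powr (- 2 * \<nu>)\<close>.\<close>
        have "C * exp (\<nu> * u - (1/4) * exp u) \<le> C * exp (\<nu> * u)" using C(1) by (intro mult_left_mono) auto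
        then show "matern_weight \<nu> u * theta (\<beta> * exp (- u)) 0 ^ CARD('n) \<le> C * exp (\<nu> * u)" using C(2)[of \<nu> u] by linarith
      qed simp
      also have "\<dots> = A\<^sup>2 * real CARD('n) * C * exp (\<nu> * u - (\<kappa> * (real N)\<^sup>2) * exp u)"
        by (simp add: exp_diff exp_minus field_simps)
      finally show "(\<Sum>p\<in>I. \<Sum>r\<in>I. c p * c r * (matern_weight \<nu> u * ?T u (q p - q r))) \<le> \<dots>" .
    qed
    also have "\<dots> = A\<^sup>2 * (m * real CARD('n) * C * ((\<kappa> * (real N)\<^sup>2) powr (- \<nu>) * Gamma \<nu>))"
      using hb by (simp add: has_bochner_integral_iff)
    also have "(\<kappa> * (real N)\<^sup>2) powr (- \<nu>) = \<kappa> powr (- \<nu>) * real N powr (- (2 * \<nu>))"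
      using kappa N by (simp add: powr_mult powr_powr flip: powr_numeral)
    also have "A\<^sup>2 * (m * real CARD('n) * C * (\<kappa> powr (- \<nu>) * real N powr (- (2 * \<nu>)) * Gamma \<nu>))
      = A\<^sup>2 * (m * real CARD('n) * C * \<kappa> powr (- \<nu>) * Gamma \<nu>) * real N powr (- (2 * \<nu>))"
      by (simp only: mult_ac)
    also have "\<dots> \<le> A\<^sup>2 * K * real N powr (- (2 * \<nu>))"
      unfolding K_def by (intro mult_right_mono mult_left_mono) auto
    finally show "(\<Sum>p\<in>I. \<Sum>r\<in>I. c p * c r * torus_matern \<nu> l \<sigma> (to_torus (q p)) (to_torus (q r))) \<le> A\<^sup>2 * K * real N powr (- (2 * \<nu>))" .
  qed
qed

section \<open>Existence of regular samples\<close>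

definition grid_interp :: "nat \<Rightarrow> (real ^ 'n::finite \<Rightarrow> real) \<Rightarrow> real ^ 'n \<Rightarrow> real" where
  "grid_interp N z x = (\<Sum>j\<in>grid N. z (grid_point N j) * grid_kernel N (\<lambda>_. 0) x j)"

definition residual :: "nat \<Rightarrow> (real ^ 'n::finite \<Rightarrow> real) \<Rightarrow> real ^ 'n \<Rightarrow> real" where
  "residual k z x = z x - grid_interp (4 ^ k) z x"

text \<open>Level 0 holds plain values; later levels hold residuals of the preceding interpolation
  at the points of the new grid. In this form a bound on residuals controls the whole block and all
  its derivatives.\<close>

primrec block_coeff :: "nat \<Rightarrow> (real ^ 'n::finite \<Rightarrow> real) \<Rightarrow> ('n \<Rightarrow> nat) \<Rightarrow> real" where
  "block_coeff 0 z j = z (grid_point 1 j)"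
| "block_coeff (Suc k) z j = residual k z (grid_point (4 ^ Suc k) j)"

definition block :: "('n::finite \<Rightarrow> nat) \<Rightarrow> nat \<Rightarrow> (real ^ 'n \<Rightarrow> real) \<Rightarrow> real ^ 'n \<Rightarrow> real" where
  "block \<alpha> k z x = (\<Sum>j\<in>grid (4 ^ k). block_coeff k z j * grid_kernel (4 ^ k) \<alpha> x j)"

definition block_series :: "(real ^ 'n::finite \<Rightarrow> real) \<Rightarrow> real ^ 'n \<Rightarrow> real" where
  "block_series z x = (\<Sum>k. block (\<lambda>_. 0) k z x)"

lemma grid_interp_grid_interp:
  fixes z :: "real ^ 'n \<Rightarrow> real"
  assumes "N > 0" "3 * N \<le> N'"
  shows "grid_interp N' (grid_interp N z) x = grid_interp N z x"
proof -
  have "grid_interp N' (grid_interp N z) x = (\<Sum>j\<in>grid N'. \<Sum>m\<in>grid N. z (grid_point N m) *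
      (grid_kernel N' (\<lambda>_. 0) x j * grid_kernel N (\<lambda>_. 0) (grid_point N' j) m))"
    unfolding grid_interp_def sum_distrib_right by (simp only: mult_ac)
  also have "\<dots> = (\<Sum>m\<in>grid N. z (grid_point N m) *
      (\<Sum>j\<in>grid N'. grid_kernel N' (\<lambda>_. 0) x j * grid_kernel N (\<lambda>_. 0) (grid_point N' j) m))"
    unfolding sum_distrib_left by (rule sum.swap)
  also have "\<dots> = grid_interp N z x"
    unfolding grid_interp_def grid_kernel_reproduces_grid_kernel[OF assms] ..
  finally show ?thesis .
qed

lemma sum_blocks:
  fixes z :: "real ^ 'n \<Rightarrow> real"
  shows "(\<Sum>k<Suc K. block (\<lambda>_. 0) k z x) = grid_interp (4 ^ K) z x"
proof (induction K)
  case 0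
  show ?case by (simp add: block_def grid_interp_def)
next
  case (Suc K)
  have "block (\<lambda>_. 0) (Suc K) z x = grid_interp (4 ^ Suc K) z x - grid_interp (4 ^ Suc K) (grid_interp (4 ^ K) z) x"
    unfolding block_def block_coeff.simps residual_def left_diff_distrib sum_subtractf by (simp only: grid_interp_def)
  \<comment> \<open>Here the ratio 4 between levels covers the bandwidth factor 3 of the
    kernel.\<close>
  also have "grid_interp (4 ^ Suc K) (grid_interp (4 ^ K) z) x = grid_interp (4 ^ K) z x"
    by (rule grid_interp_grid_interp) auto
  finally show ?case using Suc.IH by (simp only: sum.lessThan_Suc)
qed

lemma block_series_eq:
  fixes z :: "real ^ 'n \<Rightarrow> real"
  assumes "(\<lambda>k. residual k z x) \<longlonglongrightarrow> 0"
  shows "block_series z x = z x"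
proof -
  have "(\<lambda>k. z x - residual k z x) \<longlonglongrightarrow> z x - 0" by (intro tendsto_diff tendsto_const assms)
  then have "(\<lambda>K. \<Sum>k<Suc K. block (\<lambda>_. 0) k z x) \<longlonglongrightarrow> z x"
    unfolding sum_blocks residual_def by simp
  then have "(\<lambda>k. block (\<lambda>_. 0) k z x) sums z x"
    unfolding sums_def by (rule LIMSEQ_imp_Suc)
  then show ?thesis unfolding block_series_def by (rule sums_unique[symmetric])
qed

lemma block_series_periodic: "block_series z (x + int_vec m) = block_series z x"
  unfolding block_series_def block_def grid_kernel_periodic ..

text \<open>One derivative at level \<open>k\<close> costs \<open>6 * pi * 4 ^ k\<close> by
  \<open>sum_abs_grid_kernel_le\<close>, so the decay of the coefficients supplies the bounds that
  \<open>holder_loc_dyadic_series\<close> expects.\<close>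

lemma block_series_holder_loc:
  fixes z :: "real ^ 'n \<Rightarrow> real"
  assumes C: "\<And>k j. j \<in> grid (4 ^ k) \<Longrightarrow> \<bar>block_coeff k z j\<bar> \<le> C * 4 powr (- (real k * s))"
    and n\<gamma>: "0 \<le> \<gamma>" "\<gamma> \<le> 1" "real n + \<gamma> < s"
  shows "block_series z \<in> holder_loc n \<gamma> V"
proof -
  let ?A = "\<lambda>\<alpha>::'n \<Rightarrow> nat. C * 2 ^ CARD('n) * (6 * pi) ^ sum \<alpha> UNIV"
  \<comment> \<open>The coarsest grid is nonempty, so the hypothesis at level 0 forces
    \<open>C\<close> to be nonnegative.\<close>
  have "(\<lambda>_. 0) \<in> (grid (4 ^ 0) :: ('n \<Rightarrow> nat) set)" by (auto simp: grid_def)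
  from C[OF this] have C0: "C \<ge> 0" by simp
  have "(\<lambda>x. \<Sum>k. block (\<lambda>_. 0) k z x) \<in> holder_loc n \<gamma> V"
  proof (rule holder_loc_dyadic_series[where G="\<lambda>\<alpha> k x. block \<alpha> k z x" and A="?A", OF _ _ n\<gamma>])
    show "((\<lambda>t. block \<alpha> k z (x + t *\<^sub>R axis i 1)) has_real_derivative block (\<alpha>(i := Suc (\<alpha> i))) k z x) (at 0)" for \<alpha> k x i
      unfolding block_def by (intro DERIV_sum DERIV_cmult grid_kernel_has_derivative)
    fix \<alpha> :: "'n \<Rightarrow> nat" and k and x :: "real ^ 'n"
    have "\<bar>block \<alpha> k z x\<bar> \<le> (\<Sum>j\<in>grid (4 ^ k). \<bar>block_coeff k z j\<bar> * \<bar>grid_kernel (4 ^ k) \<alpha> x j\<bar>)"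
      unfolding block_def abs_mult[symmetric] by (rule sum_abs)
    also have "\<dots> \<le> (\<Sum>j\<in>grid (4 ^ k). C * 4 powr (- (real k * s)) * \<bar>grid_kernel (4 ^ k) \<alpha> x j\<bar>)"
      by (intro sum_mono mult_right_mono C) auto
    also have "\<dots> = C * 4 powr (- (real k * s)) * (\<Sum>j\<in>grid (4 ^ k). \<bar>grid_kernel (4 ^ k) \<alpha> x j\<bar>)"
      by (rule sum_distrib_left[symmetric])
    also have "\<dots> \<le> C * 4 powr (- (real k * s)) * (2 ^ CARD('n) * (2 * pi * (3 * real (4 ^ k))) ^ sum \<alpha> UNIV)"
      by (intro mult_left_mono sum_abs_grid_kernel_le) (use C0 in auto)
    also have "(2 * pi * (3 * real (4 ^ k))) ^ sum \<alpha> UNIV = (6 * pi) ^ sum \<alpha> UNIV * 4 powr (real k * real (sum \<alpha> UNIV))"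
    proof -
      have e: "2 * pi * (3 * real (4 ^ k)) = 6 * pi * 4 ^ k" by simp
      have "(2 * pi * (3 * real (4 ^ k))) ^ sum \<alpha> UNIV = (6 * pi * 4 ^ k) ^ sum \<alpha> UNIV" unfolding e ..
      also have "\<dots> = (6 * pi) ^ sum \<alpha> UNIV * 4 ^ (k * sum \<alpha> UNIV)" by (simp add: power_mult_distrib power_mult)
      also have "(4::real) ^ (k * sum \<alpha> UNIV) = 4 powr (real k * real (sum \<alpha> UNIV))"
        by (subst powr_realpow[symmetric]) (simp_all del: of_nat_sum)
      finally show ?thesis .
    qed
    also have "C * 4 powr (- (real k * s)) * (2 ^ CARD('n) * ((6 * pi) ^ sum \<alpha> UNIV * 4 powr (real k * real (sum \<alpha> UNIV))))
       = ?A \<alpha> * (4 powr (- (real k * s)) * 4 powr (real k * real (sum \<alpha> UNIV)))" by (simp only: mult_ac)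
    also have "4 powr (- (real k * s)) * 4 powr (real k * real (sum \<alpha> UNIV)) = 4 powr (real k * (real (sum \<alpha> UNIV) - s))"
      unfolding powr_add[symmetric] by (simp add: right_diff_distrib del: of_nat_sum)
    finally show "\<bar>block \<alpha> k z x\<bar> \<le> ?A \<alpha> * 4 powr (real k * (real (sum \<alpha> UNIV) - s))" .
  qed
  then show ?thesis unfolding block_series_def[abs_def] .
qed

text \<open>The union bound over \<open>J k\<close> costs \<open>4 powr (k * d)\<close>, the tail
  bound gains \<open>4 powr (- 2 * k * p * (\<nu> - s))\<close>, and Borel--Cantelli leaves only
  finitely many bad levels.\<close>

lemma AE_gaussian_family_bound:
  fixes X :: "nat \<Rightarrow> 'j \<Rightarrow> 'a \<Rightarrow> real"
  assumes M: "prob_space M" and fin: "\<And>k. finite (J k)" and card: "\<And>k. real (card (J k)) \<le> D * 4 powr (real k * d)"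
    and X: "\<And>k j. gaussian_rv M (X k j)" and mean: "\<And>k j. (\<integral>\<omega>. X k j \<omega> \<partial>M) = 0"
    and var: "\<And>k j. (\<integral>\<omega>. (X k j \<omega>)\<^sup>2 \<partial>M) \<le> K * 4 powr (- (2 * real k * \<nu>))"
    and s: "s < \<nu>"
  shows "AE \<omega> in M. \<exists>C. \<forall>k. \<forall>j\<in>J k. \<bar>X k j \<omega>\<bar> \<le> C * 4 powr (- (real k * s))"
proof -
  interpret prob_space M by (rule M)
  have meas[measurable]: "X k j \<in> borel_measurable M" for k j using X[of k j] by (simp add: gaussian_rv_def)
  have D0: "D \<ge> 0" using card[of 0] by simp
  have K0: "K \<ge> 0"
  proof -
    have "0 \<le> (\<integral>\<omega>. (X 0 undefined \<omega>)\<^sup>2 \<partial>M)" by (rule integral_nonneg_AE) simp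
    also have "\<dots> \<le> K" using var[of 0 undefined] by simp
    finally show ?thesis .
  qed
  \<comment> \<open>The moment order is taken so large that the net exponent per level is at most
    \<open>-1\<close>.\<close>
  obtain p :: nat where p: "(d + 1) / (2 * (\<nu> - s)) \<le> real p" using real_arch_simple by blast
  then have p': "d - 2 * real p * (\<nu> - s) \<le> -1" using s by (simp add: field_simps)
  define F where "F k j = {\<omega> \<in> space M. \<bar>X k j \<omega>\<bar> \<ge> 4 powr (- (real k * s))}" for k j
  define A where "A k = (\<Union>j\<in>J k. F k j)" for k
  have Fm[measurable]: "F k j \<in> sets M" for k j unfolding F_def by measurable
  have Am[measurable]: "A k \<in> sets M" for k unfolding A_def using fin by auto
  define cp where "cp = (fact (2 * p) / (2 ^ p * fact p) :: real)"
  have cp0: "cp \<ge> 0" by (simp add: cp_def)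
  have A_le: "measure M (A k) \<le> (D * cp * K ^ p) * 4 powr (real k * (-1))" for k
  proof -
    have "measure M (A k) \<le> (\<Sum>j\<in>J k. measure M (F k j))"
      unfolding A_def by (intro finite_measure_subadditive_finite fin) auto
    also have "\<dots> \<le> (\<Sum>j\<in>J k. cp * (K * 4 powr (- (2 * real k * \<nu>))) ^ p / (4 powr (- (real k * s))) ^ (2 * p))"
      unfolding F_def cp_def by (intro sum_mono gaussian_tail_bound M X mean var) auto
    also have "\<dots> = real (card (J k)) * (cp * K ^ p * ((4 powr (- (2 * real k * \<nu>))) ^ p / (4 powr (- (real k * s))) ^ (2 * p)))"
      by (simp add: power_mult_distrib)
    also have "(4 powr (- (2 * real k * \<nu>))) ^ p / (4 powr (- (real k * s))) ^ (2 * p) = 4 powr (real k * (- (2 * real p * (\<nu> - s))))"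
      by (simp add: powr_power powr_diff[symmetric] algebra_simps)
    also have "real (card (J k)) * (cp * K ^ p * 4 powr (real k * (- (2 * real p * (\<nu> - s)))))
       \<le> (D * 4 powr (real k * d)) * (cp * K ^ p * 4 powr (real k * (- (2 * real p * (\<nu> - s)))))"
      using card cp0 K0 by (intro mult_right_mono) auto
    also have "\<dots> = (D * cp * K ^ p) * (4 powr (real k * d) * 4 powr (real k * (- (2 * real p * (\<nu> - s)))))"
      by (simp only: mult_ac)
    also have "4 powr (real k * d) * 4 powr (real k * (- (2 * real p * (\<nu> - s)))) = 4 powr (real k * (d - 2 * real p * (\<nu> - s)))"
      unfolding powr_add[symmetric] by (simp add: algebra_simps)
    also have "(D * cp * K ^ p) * 4 powr (real k * (d - 2 * real p * (\<nu> - s))) \<le> (D * cp * K ^ p) * 4 powr (real k * (-1))"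
      using D0 cp0 K0 p' by (intro mult_left_mono powr_mono) auto
    finally show ?thesis .
  qed
  have "summable (\<lambda>k. measure M (A k))"
    by (rule summable_comparison_test'[OF summable_powr_linear[of "-1" "D * cp * K ^ p"]]) (use A_le in auto)
  then have "AE \<omega> in M. \<forall>\<^sub>F k in sequentially. \<omega> \<in> space M - A k"
    by (intro borel_cantelli_AE1) (auto simp: emeasure_eq_measure)
  then show ?thesis
  proof (eventually_elim)
    fix \<omega> assume "\<forall>\<^sub>F k in sequentially. \<omega> \<in> space M - A k"
    then obtain K1 where K1: "\<And>k. k \<ge> K1 \<Longrightarrow> \<omega> \<in> space M - A k" by (auto simp: eventually_sequentially)
    let ?w = "\<lambda>k. 4 powr (- (real k * s)) :: real"
    \<comment> \<open>The finitely many exceptional levels are absorbed into a constant that depends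
      on \<open>\<omega>\<close>.\<close>
    define C where "C = 1 + (\<Sum>k<K1. \<Sum>j\<in>J k. \<bar>X k j \<omega>\<bar> / ?w k)"
    have "\<bar>X k j \<omega>\<bar> \<le> C * ?w k" if j: "j \<in> J k" for k j
    proof (cases "k < K1")
      case True
      have "\<bar>X k j \<omega>\<bar> / ?w k \<le> (\<Sum>j\<in>J k. \<bar>X k j \<omega>\<bar> / ?w k)" using fin j by (intro member_le_sum) auto
      also have "\<dots> \<le> (\<Sum>k<K1. \<Sum>j\<in>J k. \<bar>X k j \<omega>\<bar> / ?w k)"
        using True by (intro member_le_sum[where f="\<lambda>k. \<Sum>j\<in>J k. \<bar>X k j \<omega>\<bar> / ?w k"] sum_nonneg) auto
      finally have "\<bar>X k j \<omega>\<bar> / ?w k \<le> C" by (simp add: C_def)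
      then show ?thesis by (simp add: divide_le_eq)
    next
      case False
      have "\<bar>X k j \<omega>\<bar> \<le> 1 * ?w k" using K1[of k] False j by (force simp: A_def F_def not_le)
      also have "\<dots> \<le> C * ?w k"
        unfolding C_def by (intro mult_right_mono) (auto intro!: sum_nonneg)
      finally show ?thesis .
    qed
    then show "\<exists>C. \<forall>k. \<forall>j\<in>J k. \<bar>X k j \<omega>\<bar> \<le> C * ?w k" by blast
  qed
qed

section \<open>Construction of the regular modification\<close>

lemma torus_rel_rep: "\<exists>m. rep_torus (to_torus v) = v + int_vec m"
proof -
  have "to_torus (rep_torus (to_torus v)) = to_torus v"
    by (rule Quotient3_abs_rep[OF Quotient3_torus])
  then have "torus_rel (rep_torus (to_torus v)) v" by (simp add: torus.abs_eq_iff)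
  then show ?thesis unfolding torus_rel_def by (metis add.commute diff_add_cancel)
qed

text \<open>A residual is a single finite functional of the process; it annihilates the truncated
  kernels because interpolation reproduces them for every \<open>b\<close>.\<close>

lemma residual_gaussian:
  fixes Z :: "('n::finite) torus \<Rightarrow> 'a \<Rightarrow> real"
  assumes nu: "\<nu> > 0" and l: "l > 0" and Z: "gaussian_process M Z" and cen: "centred_process M Z"
    and cov: "\<forall>x x'. process_covariance M Z x x' = torus_matern \<nu> l \<sigma> x x'"
  obtains K where "\<And>k x. gaussian_rv M (\<lambda>\<omega>. residual k (\<lambda>v. Z (to_torus v) \<omega>) x)"
    "\<And>k x. (\<integral>\<omega>. residual k (\<lambda>v. Z (to_torus v) \<omega>) x \<partial>M) = 0"
    "\<And>k x. (\<integral>\<omega>. (residual k (\<lambda>v. Z (to_torus v) \<omega>) x)\<^sup>2 \<partial>M) \<le> K * 4 powr (- (2 * real k * \<nu>))"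
proof -
  obtain K where K: "\<And>(I::('n \<Rightarrow> nat) option set) c (q :: ('n \<Rightarrow> nat) option \<Rightarrow> real ^ 'n) A N. N > 0 \<Longrightarrow> finite I \<Longrightarrow> (\<Sum>p\<in>I. \<bar>c p\<bar>) \<le> A \<Longrightarrow>
      (\<And>b y. (\<Sum>p\<in>I. c p * (\<Prod>i\<in>UNIV. theta_trunc b N ((q p - y) $ i))) = 0) \<Longrightarrow>
      (\<Sum>p\<in>I. \<Sum>r\<in>I. c p * c r * torus_matern \<nu> l \<sigma> (to_torus (q p)) (to_torus (q r))) \<le> A\<^sup>2 * K * real N powr (- (2 * \<nu>))"
  proof (rule quadratic_form_matern_le[OF nu l, where 'i="('n \<Rightarrow> nat) option" and 'n='n and \<sigma>=\<sigma>])
    fix K assume H: "\<And>(I::('n \<Rightarrow> nat) option set) c (q :: ('n \<Rightarrow> nat) option \<Rightarrow> real ^ 'n) A N. N > 0 \<Longrightarrow> finite I \<Longrightarrow> (\<Sum>p\<in>I. \<bar>c p\<bar>) \<le> A \<Longrightarrow>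
      (\<And>b y. (\<Sum>p\<in>I. c p * (\<Prod>i\<in>UNIV. theta_trunc b N ((q p - y) $ i))) = 0) \<Longrightarrow>
      (\<Sum>p\<in>I. \<Sum>r\<in>I. c p * c r * torus_matern \<nu> l \<sigma> (to_torus (q p)) (to_torus (q r))) \<le> A\<^sup>2 * K * real N powr (- (2 * \<nu>))"
    show thesis by (rule that, rule H; (assumption | blast))
  qed
  \<comment> \<open>Evaluation at the point contributes 1, the interpolation weights at most
    \<open>2 ^ CARD('n)\<close>.\<close>
  define A where "A = (1 + 2 ^ CARD('n) :: real)"
  have main: "gaussian_rv M (\<lambda>\<omega>. residual k (\<lambda>v. Z (to_torus v) \<omega>) x) \<and>
    (\<integral>\<omega>. residual k (\<lambda>v. Z (to_torus v) \<omega>) x \<partial>M) = 0 \<and>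
    (\<integral>\<omega>. (residual k (\<lambda>v. Z (to_torus v) \<omega>) x)\<^sup>2 \<partial>M) \<le> (A\<^sup>2 * K) * 4 powr (- (2 * real k * \<nu>))" for k x
  proof -
    let ?N = "4 ^ k :: nat"
    \<comment> \<open>\<open>None\<close> stands for \<open>x\<close> and \<open>Some j\<close> for
      a grid point, so the indices stay distinct even when \<open>x\<close> lies on the
      grid.\<close>
    define I where "I = insert None (Some ` (grid ?N :: ('n \<Rightarrow> nat) set))"
    define c where "c p = (case p of None \<Rightarrow> 1 | Some j \<Rightarrow> - grid_kernel ?N (\<lambda>_. 0) x j)" for p
    define q where "q p = (case p of None \<Rightarrow> x | Some j \<Rightarrow> grid_point ?N j)" for p
    have fI: "finite I" by (simp add: I_def finite_grid)
    have sumI: "(\<Sum>p\<in>I. f p) = f None + (\<Sum>j\<in>grid ?N. f (Some j))" for f :: "('n \<Rightarrow> nat) option \<Rightarrow> real"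
      unfolding I_def by (subst sum.insert) (auto simp: finite_grid sum.reindex)
    have res: "residual k (\<lambda>v. Z (to_torus v) \<omega>) x = (\<Sum>p\<in>I. c p * Z (to_torus (q p)) \<omega>)" for \<omega>
      unfolding sumI by (simp add: residual_def grid_interp_def c_def q_def sum_negf mult_ac)
    have "gaussian_rv M (\<lambda>\<omega>. residual k (\<lambda>v. Z (to_torus v) \<omega>) x)"
      unfolding res by (rule gaussian_process_linear_combination[OF Z fI])
    moreover have "(\<integral>\<omega>. residual k (\<lambda>v. Z (to_torus v) \<omega>) x \<partial>M) = 0"
      unfolding res by (rule centred_gaussian_process_moments(1)[OF Z cen fI])
    moreover have "(\<integral>\<omega>. (residual k (\<lambda>v. Z (to_torus v) \<omega>) x)\<^sup>2 \<partial>M)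
       = (\<Sum>p\<in>I. \<Sum>r\<in>I. c p * c r * torus_matern \<nu> l \<sigma> (to_torus (q p)) (to_torus (q r)))"
      unfolding res centred_gaussian_process_moments(2)[OF Z cen fI] using cov by simp
    moreover have "\<dots> \<le> A\<^sup>2 * K * real ?N powr (- (2 * \<nu>))"
    proof (rule K[OF _ fI])
      show "?N > 0" by simp
      show "(\<Sum>p\<in>I. \<bar>c p\<bar>) \<le> A"
        unfolding sumI using sum_abs_grid_kernel_le[of ?N "\<lambda>_. 0" x] by (simp add: c_def A_def)
      show "(\<Sum>p\<in>I. c p * (\<Prod>i\<in>UNIV. theta_trunc b ?N ((q p - y) $ i))) = 0" for b y
        unfolding sumI using grid_kernel_reproduces_theta_trunc[of ?N x b y]
        by (simp add: c_def q_def sum_negf)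
    qed
    moreover have "real ?N powr (- (2 * \<nu>)) = 4 powr (- (2 * real k * \<nu>))"
      by (simp add: powr_realpow[symmetric] powr_powr mult_ac)
    ultimately show ?thesis by simp
  qed
  show thesis by (rule that[of "A\<^sup>2 * K"]) (use main in blast)+
qed

lemma matern_has_samples:
  fixes M :: "'a measure" and Z :: "('n :: finite) torus \<Rightarrow> 'a \<Rightarrow> real"
  assumes nu: "\<nu> > 0" and l: "l > 0" and Z: "gaussian_process M Z" and cen: "centred_process M Z"
    and cov: "\<forall>x x'. process_covariance M Z x x' = torus_matern \<nu> l \<sigma> x x'"
  shows "has_samples_in M Z (torus_almost_holder_loc \<nu> U)"
proof -
  have M: "prob_space M" using Z by (simp add: gaussian_process_def)
  have measZ[measurable]: "Z x \<in> borel_measurable M" for x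
    using gaussian_process_linear_combination[OF Z, of "{x}" "\<lambda>_. 1" "\<lambda>x. x"] by (simp add: gaussian_rv_def)
  let ?z = "\<lambda>\<omega> v. Z (to_torus v) \<omega>"
  let ?J = "\<lambda>k. grid (4 ^ Suc k) :: ('n \<Rightarrow> nat) set"
  let ?R = "\<lambda>k j \<omega>. residual k (?z \<omega>) (grid_point (4 ^ Suc k) j)"
  obtain K where K: "\<And>k x. gaussian_rv M (\<lambda>\<omega>. residual k (?z \<omega>) x)"
    "\<And>k x. (\<integral>\<omega>. residual k (?z \<omega>) x \<partial>M) = 0"
    "\<And>k x. (\<integral>\<omega>. (residual k (?z \<omega>) x)\<^sup>2 \<partial>M) \<le> K * 4 powr (- (2 * real k * \<nu>))"
    using residual_gaussian[OF nu l Z cen cov] by metis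
  have resm: "(\<lambda>\<omega>. residual k (?z \<omega>) x) \<in> borel_measurable M" for k x
    using K(1)[of k x] by (simp add: gaussian_rv_def)
  \<comment> \<open>\<open>suminf\<close> is total and preserves measurability, so \<open>Y\<close>
    is defined for every \<open>\<omega>\<close>, whether or not the series converges there.\<close>
  define Y where "Y p \<omega> = block_series (?z \<omega>) (rep_torus p)" for p \<omega>
  have Ymeas: "Y p \<in> borel_measurable M" for p
  proof -
    have "(\<lambda>\<omega>. block_coeff k (?z \<omega>) j) \<in> borel_measurable M" for k j
      by (cases k) (use resm in auto)
    then show ?thesis unfolding Y_def[abs_def] block_series_def block_def
      by (intro borel_measurable_suminf borel_measurable_sum borel_measurable_times) auto
  qed
  have YZ: "AE \<omega> in M. Y p \<omega> = Z p \<omega>" for p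
  proof -
    \<comment> \<open>At a fixed point there is one residual per level, and any positive rate below
      \<open>\<nu>\<close>, here \<open>\<nu> / 2\<close>, sends it to 0.\<close>
    have "AE \<omega> in M. \<exists>C. \<forall>k. \<forall>j\<in>{()}. \<bar>residual k (?z \<omega>) (rep_torus p)\<bar> \<le> C * 4 powr (- (real k * (\<nu> / 2)))"
      by (rule AE_gaussian_family_bound[OF M, where X="\<lambda>k (j::unit) \<omega>. residual k (?z \<omega>) (rep_torus p)" and D=1 and d=0, OF _ _ K])
         (use nu in auto)
    then show ?thesis
    proof eventually_elim
      fix \<omega> assume "\<exists>C. \<forall>k. \<forall>j\<in>{()}. \<bar>residual k (?z \<omega>) (rep_torus p)\<bar> \<le> C * 4 powr (- (real k * (\<nu> / 2)))"
      then obtain C where C: "\<And>k. \<bar>residual k (?z \<omega>) (rep_torus p)\<bar> \<le> C * 4 powr (real k * (- (\<nu> / 2)))" by auto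
      have "(\<lambda>k. C * 4 powr (real k * (- (\<nu> / 2)))) \<longlonglongrightarrow> 0"
        by (rule summable_LIMSEQ_zero[OF summable_powr_linear]) (use nu in simp)
      then have "(\<lambda>k. residual k (?z \<omega>) (rep_torus p)) \<longlonglongrightarrow> 0"
        by (rule Lim_null_comparison[rotated]) (use C in auto)
      then have "block_series (?z \<omega>) (rep_torus p) = ?z \<omega> (rep_torus p)" by (rule block_series_eq)
      then show "Y p \<omega> = Z p \<omega>" unfolding Y_def by (simp add: Quotient3_abs_rep[OF Quotient3_torus])
    qed
  qed
  \<comment> \<open>The countably many exponents \<open>\<nu> - 1 / (q + 1)\<close> approach
    \<open>\<nu>\<close>, so a single null set serves all orders below it.\<close>
  have ae: "AE \<omega> in M. \<exists>C. \<forall>k. \<forall>j\<in>?J k.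
      \<bar>?R k j \<omega>\<bar> \<le> C * 4 powr (- (real k * (\<nu> - 1 / real (Suc q))))" for q
  proof (rule AE_gaussian_family_bound[OF M, where X="?R"
        and D="32 ^ CARD('n)" and d="real CARD('n)", OF _ _ K])
    show "finite (?J k)" for k by (rule finite_grid)
    \<comment> \<open>The grid has \<open>(8 * 4 ^ Suc k) ^ CARD('n)\<close> points, and
      \<open>8 * 4 = 32\<close>.\<close>
    show "real (card (?J k)) \<le> 32 ^ CARD('n) * 4 powr (real k * real CARD('n))" for k
    proof -
      have "(4::real) powr (real k * real CARD('n)) = 4 ^ (k * CARD('n))"
        by (subst powr_realpow[symmetric]) simp_all
      then show ?thesis by (simp add: card_grid power_mult_distrib power_mult)
    qed
  qed simp
  have "AE \<omega> in M. \<forall>q. \<exists>C. \<forall>k. \<forall>j\<in>?J k.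
      \<bar>?R k j \<omega>\<bar> \<le> C * 4 powr (- (real k * (\<nu> - 1 / real (Suc q))))"
    unfolding AE_all_countable by (rule allI) (rule ae)
  then have "AE \<omega> in M. (\<lambda>p. Y p \<omega>) \<in> torus_almost_holder_loc \<nu> U"
  proof eventually_elim
    fix \<omega>
    assume H: "\<forall>q. \<exists>C. \<forall>k. \<forall>j\<in>?J k.
      \<bar>?R k j \<omega>\<bar> \<le> C * 4 powr (- (real k * (\<nu> - 1 / real (Suc q))))"
    \<comment> \<open>By periodicity the chosen representative does not matter: in every chart the
      path is \<open>block_series\<close> itself.\<close>
    have comp: "(\<lambda>p. Y p \<omega>) \<circ> to_torus = block_series (?z \<omega>)"
    proof
      fix v :: "real ^ 'n"
      obtain m where "rep_torus (to_torus v) = v + int_vec m" using torus_rel_rep by blast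
      then show "((\<lambda>p. Y p \<omega>) \<circ> to_torus) v = block_series (?z \<omega>) v"
        by (simp add: Y_def block_series_periodic)
    qed
    show "(\<lambda>p. Y p \<omega>) \<in> torus_almost_holder_loc \<nu> U"
      unfolding torus_almost_holder_loc_def torus_holder_loc_def mem_Collect_eq comp
    proof (intro allI impI)
      fix n \<gamma> and V :: "(real ^ 'n) set"
      assume n\<gamma>: "0 \<le> \<gamma> \<and> \<gamma> \<le> 1 \<and> real n + \<gamma> < \<nu>"
      then obtain q where q: "1 / real (Suc q) < \<nu> - (real n + \<gamma>)"
        using reals_Archimedean[of "\<nu> - (real n + \<gamma>)"] by (auto simp: inverse_eq_divide)
      define s where "s = \<nu> - 1 / real (Suc q)"
      obtain C where C: "\<And>k j. j \<in> ?J k \<Longrightarrow>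
          \<bar>?R k j \<omega>\<bar> \<le> C * 4 powr (- (real k * s))"
        using H unfolding s_def by metis
      define C0 where "C0 = (\<Sum>j\<in>(grid 1 :: ('n \<Rightarrow> nat) set). \<bar>?z \<omega> (grid_point 1 j)\<bar>)"
      have C00: "C0 \<ge> 0" unfolding C0_def by (rule sum_nonneg) auto
      \<comment> \<open>\<open>C0\<close> handles block 0, whose coefficients are values and not
        residuals; the factor \<open>4 powr s\<close> pays for the shift from residual level
        \<open>k - 1\<close> to block \<open>k\<close>.\<close>
      define C' where "C' = C0 + \<bar>C\<bar> * 4 powr s"
      show "block_series (?z \<omega>) \<in> holder_loc n \<gamma> V"
      proof (rule block_series_holder_loc[where C=C' and s=s])
        fix k and j :: "'n \<Rightarrow> nat" assume j: "j \<in> grid (4 ^ k)"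
        show "\<bar>block_coeff k (?z \<omega>) j\<bar> \<le> C' * 4 powr (- (real k * s))"
        proof (cases k)
          case 0
          have "\<bar>?z \<omega> (grid_point 1 j)\<bar> \<le> C0" unfolding C0_def
            using j 0 by (intro member_le_sum[where f="\<lambda>j. \<bar>?z \<omega> (grid_point 1 j)\<bar>"] finite_grid) auto
          also have "\<dots> \<le> C'" by (simp add: C'_def)
          finally show ?thesis using 0 by simp
        next
          case (Suc k')
          have "\<bar>block_coeff k (?z \<omega>) j\<bar> \<le> C * 4 powr (- (real k' * s))"
            using C[of j k'] j Suc by simp
          also have "\<dots> \<le> \<bar>C\<bar> * 4 powr (- (real k' * s))" by (intro mult_right_mono) auto
          also have "\<dots> = \<bar>C\<bar> * 4 powr s * 4 powr (- (real k * s))"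
            unfolding Suc mult.assoc powr_add[symmetric] by (simp add: algebra_simps)
          also have "\<dots> \<le> C' * 4 powr (- (real k * s))"
            unfolding C'_def using C00 by (intro mult_right_mono) auto
          finally show ?thesis .
        qed
      qed (use n\<gamma> q in \<open>auto simp: s_def\<close>)
    qed
  qed
  then show ?thesis unfolding has_samples_in_def modification_of_def using Ymeas YZ by (intro exI[of _ Y]) auto
qed

section \<open>Finite differences and the lower bound\<close>

definition fdiff :: "real \<Rightarrow> (real \<Rightarrow> real) \<Rightarrow> real \<Rightarrow> real" where
  "fdiff h g t = g (t + h) - g t"

lemma fdiff_has_derivative:
  assumes "(f has_real_derivative f' t) (at t)" "(f has_real_derivative f' (t + h)) (at (t + h))"
  shows "(fdiff h f has_real_derivative fdiff h f' t) (at t)"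
  unfolding fdiff_def[abs_def]
  using assms DERIV_shift[of f "f' (t + h)" t h] by (intro DERIV_diff) auto

text \<open>Differencing commutes with differentiation, so the functions
  \<open>fdiff h (G j)\<close> again form a chain of derivatives, on an interval shortened by
  \<open>h\<close>; one mean value step then remains.\<close>

lemma fdiff_mean_value:
  assumes h: "h > 0"
    and der: "\<And>j t. j < n \<Longrightarrow> a \<le> t \<Longrightarrow> t \<le> b \<Longrightarrow> (G j has_real_derivative G (Suc j) t) (at t)"
    and t: "a \<le> t" "t + real n * h \<le> b"
  shows "\<exists>\<xi>\<ge>t. \<xi> \<le> t + real n * h \<and> (fdiff h ^^ n) (G 0) t = h ^ n * G n \<xi>"
  using der t
proof (induction n arbitrary: G b)
  case 0
  then show ?case by auto
next
  case (Suc n)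
  define H where "H j = fdiff h (G j)" for j
  have "\<exists>\<xi>\<ge>t. \<xi> \<le> t + real n * h \<and> (fdiff h ^^ n) (H 0) t = h ^ n * H n \<xi>"
  proof (rule Suc.IH[where b="b - h"])
    show "t + real n * h \<le> b - h" using Suc.prems(3) by (simp add: algebra_simps)
    fix j s assume j: "j < n" "a \<le> s" "s \<le> b - h"
    then show "(H j has_real_derivative H (Suc j) s) (at s)"
      unfolding H_def using h by (intro fdiff_has_derivative Suc.prems(1)) auto
  qed (use Suc.prems in auto)
  then obtain \<xi> where \<xi>: "t \<le> \<xi>" "\<xi> \<le> t + real n * h" "(fdiff h ^^ n) (H 0) t = h ^ n * H n \<xi>" by blast
  have "\<exists>z. \<xi> < z \<and> z < \<xi> + h \<and> G n (\<xi> + h) - G n \<xi> = (\<xi> + h - \<xi>) * G (Suc n) z"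
  proof (rule MVT2)
    show "\<xi> < \<xi> + h" using h by simp
    fix x assume "\<xi> \<le> x" "x \<le> \<xi> + h"
    then show "(G n has_real_derivative G (Suc n) x) (at x)"
      using Suc.prems \<xi> by (intro Suc.prems(1)) (auto simp: algebra_simps)
  qed
  then obtain z where z: "\<xi> < z" "z < \<xi> + h" "G n (\<xi> + h) - G n \<xi> = h * G (Suc n) z" by auto
  have "(fdiff h ^^ Suc n) (G 0) t = h ^ Suc n * G (Suc n) z"
    using \<xi>(3) z(3) unfolding funpow_Suc_right comp_def H_def by (simp add: fdiff_def)
  moreover have "t \<le> z" "z \<le> t + real (Suc n) * h" using \<xi> z by (auto simp: algebra_simps)
  ultimately show ?case by blast
qed

text \<open>Of the \<open>n + 1\<close> differences, \<open>n\<close> are turned into derivatives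
  and give \<open>h ^ n\<close>; the last one meets the Hoelder condition and gives
  \<open>h powr \<gamma>\<close>.\<close>

lemma fdiff_holder:
  assumes h: "h > 0"
    and der: "\<And>j t. j < n \<Longrightarrow> a \<le> t \<Longrightarrow> t \<le> b \<Longrightarrow> (G j has_real_derivative G (Suc j) t) (at t)"
    and hol: "\<And>s t. a \<le> s \<Longrightarrow> s \<le> b \<Longrightarrow> a \<le> t \<Longrightarrow> t \<le> b \<Longrightarrow> \<bar>G n s - G n t\<bar> \<le> C * \<bar>s - t\<bar> powr \<gamma>"
    and t: "a \<le> t" "t + real (Suc n) * h \<le> b"
  shows "\<bar>(fdiff h ^^ Suc n) (G 0) t\<bar> \<le> C * h powr (real n + \<gamma>)"
proof -
  define H where "H j = fdiff h (G j)" for j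
  have "\<exists>\<xi>\<ge>t. \<xi> \<le> t + real n * h \<and> (fdiff h ^^ n) (H 0) t = h ^ n * H n \<xi>"
  proof (rule fdiff_mean_value[where a=a and b="b - h"])
    show "t + real n * h \<le> b - h" using t by (simp add: algebra_simps)
    fix j s assume j: "j < n" "a \<le> s" "s \<le> b - h"
    then show "(H j has_real_derivative H (Suc j) s) (at s)"
      unfolding H_def using h by (intro fdiff_has_derivative der) auto
  qed (use t h in auto)
  then obtain \<xi> where \<xi>: "t \<le> \<xi>" "\<xi> \<le> t + real n * h" "(fdiff h ^^ n) (H 0) t = h ^ n * H n \<xi>" by blast
  have "\<bar>G n (\<xi> + h) - G n \<xi>\<bar> \<le> C * \<bar>(\<xi> + h) - \<xi>\<bar> powr \<gamma>"
    by (rule hol) (use \<xi> t h in \<open>auto simp: algebra_simps\<close>)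
  then have "h ^ n * \<bar>G n (\<xi> + h) - G n \<xi>\<bar> \<le> h ^ n * (C * h powr \<gamma>)"
    using h by (intro mult_left_mono) auto
  moreover have "\<bar>(fdiff h ^^ Suc n) (G 0) t\<bar> = h ^ n * \<bar>G n (\<xi> + h) - G n \<xi>\<bar>"
    using \<xi>(3) h unfolding funpow_Suc_right comp_def H_def by (simp add: fdiff_def abs_mult)
  moreover have "h ^ n * (C * h powr \<gamma>) = C * h powr (real n + \<gamma>)"
    using h by (simp add: powr_add powr_realpow)
  ultimately show ?thesis by simp
qed

text \<open>The signed binomial coefficients of \<open>(w - 1) ^ m\<close>, through Pascal's
  recursion.\<close>

primrec diff_coeff :: "nat \<Rightarrow> nat \<Rightarrow> real" where
  "diff_coeff 0 j = (if j = 0 then 1 else 0)"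
| "diff_coeff (Suc m) j = (case j of 0 \<Rightarrow> 0 | Suc i \<Rightarrow> diff_coeff m i) - diff_coeff m j"

lemma diff_coeff_eq_0: "m < j \<Longrightarrow> diff_coeff m j = 0"
proof (induction m arbitrary: j)
  case (Suc m)
  then show ?case by (cases j) auto
qed simp

text \<open>The generality of real vector spaces serves both the real differences
  \<open>fdiff\<close> and the complex generating polynomial.\<close>

lemma diff_coeff_sum_Suc:
  fixes g :: "nat \<Rightarrow> 'v::real_vector"
  shows "(\<Sum>j\<le>Suc m. diff_coeff (Suc m) j *\<^sub>R g j) = (\<Sum>j\<le>m. diff_coeff m j *\<^sub>R g (Suc j)) - (\<Sum>j\<le>m. diff_coeff m j *\<^sub>R g j)"
proof -
  have "(\<Sum>j\<le>Suc m. diff_coeff (Suc m) j *\<^sub>R g j) =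
     (\<Sum>j\<le>Suc m. (case j of 0 \<Rightarrow> 0 | Suc i \<Rightarrow> diff_coeff m i) *\<^sub>R g j) - (\<Sum>j\<le>Suc m. diff_coeff m j *\<^sub>R g j)"
    by (simp only: diff_coeff.simps scaleR_left_diff_distrib sum_subtractf)
  also have "(\<Sum>j\<le>Suc m. (case j of 0 \<Rightarrow> 0 | Suc i \<Rightarrow> diff_coeff m i) *\<^sub>R g j) = (\<Sum>j\<le>m. diff_coeff m j *\<^sub>R g (Suc j))"
    by (subst sum.atMost_Suc_shift) simp
  also have "(\<Sum>j\<le>Suc m. diff_coeff m j *\<^sub>R g j) = (\<Sum>j\<le>m. diff_coeff m j *\<^sub>R g j)"
    by (simp add: diff_coeff_eq_0)
  finally show ?thesis .
qed

lemma fdiff_eq_sum: "(fdiff h ^^ m) g t = (\<Sum>j\<le>m. diff_coeff m j * g (t + real j * h))"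
proof (induction m arbitrary: t)
  case 0
  then show ?case by simp
next
  case (Suc m)
  have "(fdiff h ^^ Suc m) g t = (fdiff h ^^ m) g (t + h) - (fdiff h ^^ m) g t" by (simp add: fdiff_def)
  also have "\<dots> = (\<Sum>j\<le>m. diff_coeff m j * g (t + real (Suc j) * h)) - (\<Sum>j\<le>m. diff_coeff m j * g (t + real j * h))"
    unfolding Suc.IH by (simp add: algebra_simps)
  also have "\<dots> = (\<Sum>j\<le>Suc m. diff_coeff (Suc m) j * g (t + real j * h))"
    using diff_coeff_sum_Suc[of m "\<lambda>j. g (t + real j * h)"] by simp
  finally show ?case .
qed

lemma diff_coeff_generating:
  fixes w :: complex
  shows "(\<Sum>j\<le>m. diff_coeff m j *\<^sub>R w ^ j) = (w - 1) ^ m"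
proof (induction m)
  case (Suc m)
  have "(\<Sum>j\<le>Suc m. diff_coeff (Suc m) j *\<^sub>R w ^ j) = w * (\<Sum>j\<le>m. diff_coeff m j *\<^sub>R w ^ j) - (\<Sum>j\<le>m. diff_coeff m j *\<^sub>R w ^ j)"
    unfolding diff_coeff_sum_Suc sum_distrib_left by simp
  then show ?case unfolding Suc.IH by (simp add: algebra_simps)
qed simp

text \<open>On the exponential with angle \<open>x\<close> the \<open>m\<close>-th difference acts
  as multiplication by \<open>(cis x - 1) ^ m\<close>; the quadratic form is the squared modulus of
  this multiplier.\<close>

lemma quadratic_form_cos:
  "(\<Sum>j\<le>m. \<Sum>k\<le>m. diff_coeff m j * diff_coeff m k * cos (x * (real j - real k))) = (cmod (cis x - 1)) ^ (2 * m)"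
proof -
  let ?S = "\<Sum>j\<le>m. diff_coeff m j *\<^sub>R cis x ^ j"
  have "complex_of_real ((cmod ?S)\<^sup>2) = (\<Sum>j\<le>m. \<Sum>k\<le>m. of_real (diff_coeff m j * diff_coeff m k) * cis (x * (real j - real k)))"
    unfolding complex_norm_square cnj_sum sum_product
    by (intro sum.cong refl) (simp add: Complex.DeMoivre cis_cnj cis_mult scaleR_conv_of_real algebra_simps)
  then have "(cmod ?S)\<^sup>2 = Re (\<Sum>j\<le>m. \<Sum>k\<le>m. of_real (diff_coeff m j * diff_coeff m k) * cis (x * (real j - real k)))"
    by (metis Re_complex_of_real)
  also have "\<dots> = (\<Sum>j\<le>m. \<Sum>k\<le>m. diff_coeff m j * diff_coeff m k * cos (x * (real j - real k)))" by simp
  finally show ?thesis unfolding diff_coeff_generating by (simp add: norm_power power_mult[symmetric] mult.commute)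
qed

section \<open>Spectral lower bound for finite differences\<close>

lemma norm_cis_minus_1_ge:
  assumes "pi / 2 \<le> x" "x \<le> pi"
  shows "cmod (cis x - 1) \<ge> 1"
proof -
  have "cos x \<le> cos (pi / 2)" using assms by (intro cos_monotone_0_pi_le) auto
  then have "Re (cis x - 1) \<le> -1" by simp
  then have "1 \<le> \<bar>Re (cis x - 1)\<bar>" by linarith
  then show ?thesis using abs_Re_le_cmod[of "cis x - 1"] by linarith
qed

text \<open>All terms of the cosine series are nonnegative, so one range of frequencies suffices.
  For step \<open>1 / (4 * L)\<close> the frequencies from \<open>L + 1\<close> to
  \<open>2 * L\<close> have angles between \<open>pi / 2\<close> and \<open>pi\<close>, where the
  multiplier is at least 1; these are \<open>L\<close> terms, each at least
  \<open>2 * theta_coeff b (2 * L)\<close>.\<close>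

lemma quadratic_form_theta_ge:
  assumes b: "b > 0" and L: "L > 0"
  shows "(\<Sum>j\<le>m. \<Sum>k\<le>m. diff_coeff m j * diff_coeff m k * theta b ((real j - real k) / (4 * real L))) \<ge> 2 * real L * theta_coeff b (2 * L)"
proof -
  let ?a = "\<lambda>j k. diff_coeff m j * diff_coeff m k" and ?y = "\<lambda>j k. (real j - real k) / (4 * real L)"
  let ?x = "\<lambda>n. 2 * pi * real (Suc n) / (4 * real L)"
  have t: "(\<lambda>n. 2 * theta_coeff b (Suc n) * (cmod (cis (?x n) - 1)) ^ (2 * m)) sums
     (\<Sum>j\<le>m. \<Sum>k\<le>m. ?a j k * (theta b (?y j k) - theta_coeff b 0))"
  proof -
    have "(\<lambda>n. \<Sum>j\<le>m. \<Sum>k\<le>m. ?a j k * (2 * theta_coeff b (Suc n) * cos (2 * pi * real (Suc n) * ?y j k))) sums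
       (\<Sum>j\<le>m. \<Sum>k\<le>m. ?a j k * (theta b (?y j k) - theta_coeff b 0))"
      by (intro sums_sum sums_mult theta_poisson b)
    moreover have "(\<Sum>j\<le>m. \<Sum>k\<le>m. ?a j k * (2 * theta_coeff b (Suc n) * cos (2 * pi * real (Suc n) * ?y j k)))
      = 2 * theta_coeff b (Suc n) * (cmod (cis (?x n) - 1)) ^ (2 * m)" for n
      unfolding quadratic_form_cos[symmetric] sum_distrib_left by (intro sum.cong refl) (simp add: mult_ac)
    ultimately show ?thesis by simp
  qed
  have c0: "(\<Sum>j\<le>m. \<Sum>k\<le>m. ?a j k * theta_coeff b 0) \<ge> 0"
  proof -
    have "(\<Sum>j\<le>m. \<Sum>k\<le>m. ?a j k * theta_coeff b 0) = (cmod (cis 0 - 1)) ^ (2 * m) * theta_coeff b 0"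
      unfolding quadratic_form_cos[symmetric] sum_distrib_right by simp
    also have "\<dots> \<ge> 0" using theta_coeff_pos[OF b, of 0] by simp
    finally show ?thesis .
  qed
  have "2 * real L * theta_coeff b (2 * L) = (\<Sum>n\<in>{L..<2*L}. 2 * theta_coeff b (2 * L))" by simp
  also have "\<dots> \<le> (\<Sum>n\<in>{L..<2*L}. 2 * theta_coeff b (Suc n) * (cmod (cis (?x n) - 1)) ^ (2 * m))"
  proof (rule sum_mono)
    fix n assume n: "n \<in> {L..<2*L}"
    have "(1::real) \<le> (cmod (cis (?x n) - 1)) ^ (2 * m)"
    proof (intro one_le_power norm_cis_minus_1_ge)
      have "real L \<le> real (Suc n)" "real (Suc n) \<le> 2 * real L" using n by auto
      then have r: "1 / 2 \<le> real (Suc n) / (2 * real L)" "real (Suc n) / (2 * real L) \<le> 1"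
        using L by (simp_all add: field_simps)
      have x: "?x n = pi * (real (Suc n) / (2 * real L))" by simp
      show "pi / 2 \<le> ?x n" "?x n \<le> pi"
        unfolding x using mult_left_mono[OF r(1), of pi] mult_left_mono[OF r(2), of pi] by simp_all
    qed
    moreover have "theta_coeff b (2 * L) \<le> theta_coeff b (Suc n)"
    proof -
      have "(real (Suc n))\<^sup>2 \<le> (real (2 * L))\<^sup>2" using n by (intro power_mono) auto
      then have "pi\<^sup>2 * (real (Suc n))\<^sup>2 / b \<le> pi\<^sup>2 * (real (2 * L))\<^sup>2 / b"
        using b by (intro divide_right_mono mult_left_mono) auto
      then show ?thesis unfolding theta_coeff_def using b by (intro mult_left_mono) auto
    qed
    ultimately have "2 * theta_coeff b (2 * L) * 1 \<le> 2 * theta_coeff b (Suc n) * (cmod (cis (?x n) - 1)) ^ (2 * m)"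
      using theta_coeff_pos[OF b] by (intro mult_mono) (auto simp: less_imp_le)
    then show "2 * theta_coeff b (2 * L) \<le> 2 * theta_coeff b (Suc n) * (cmod (cis (?x n) - 1)) ^ (2 * m)" by simp
  qed
  also have "\<dots> \<le> (\<Sum>n. 2 * theta_coeff b (Suc n) * (cmod (cis (?x n) - 1)) ^ (2 * m))"
    using theta_coeff_pos[OF b] by (intro sum_le_suminf sums_summable[OF t]) (auto simp: less_imp_le)
  also have "\<dots> = (\<Sum>j\<le>m. \<Sum>k\<le>m. ?a j k * (theta b (?y j k) - theta_coeff b 0))"
    by (rule sums_unique[OF t, symmetric])
  also have "\<dots> \<le> (\<Sum>j\<le>m. \<Sum>k\<le>m. ?a j k * theta b (?y j k))"
    using c0 by (simp add: right_diff_distrib sum_subtractf)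
  finally show ?thesis .
qed

text \<open>The differences run along one axis, so the other coordinates contribute factors
  \<open>theta b 0 \<ge> 1\<close>. The mixture is bounded below on a window of length 1 where
  \<open>exp u\<close> is comparable to \<open>1 / L^2\<close>, the scale at which frequency
  \<open>2 * L\<close> is not yet damped.\<close>

lemma quadratic_form_matern_ge:
  fixes i0 :: "'n::finite" and x0 :: "real ^ 'n"
  assumes nu: "\<nu> > 0" and l: "l > 0" and s: "\<sigma> > 0"
  obtains \<kappa> where "\<kappa> > 0" "\<And>L. L > 0 \<Longrightarrow> (\<Sum>j\<le>m. \<Sum>k\<le>m. diff_coeff m j * diff_coeff m k *
       torus_matern \<nu> l \<sigma> (to_torus (x0 + (real j / (4 * real L)) *\<^sub>R axis i0 1)) (to_torus (x0 + (real k / (4 * real L)) *\<^sub>R axis i0 1)))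
     \<ge> \<kappa> * real L powr (- (2 * \<nu>))"
proof -
  define \<beta> where "\<beta> = \<nu> / l\<^sup>2"
  have beta: "\<beta> > 0" using nu l by (simp add: \<beta>_def)
  define mc where "mc = matern_const \<nu> \<sigma> / 2"
  have mc: "mc > 0" using nu s by (simp add: mc_def matern_const_def Gamma_real_pos)
  \<comment> \<open>A lower bound, uniform in \<open>L\<close>, for
    \<open>2 * L * theta_coeff (\<beta> * exp (- u)) (2 * L)\<close> when
    \<open>1 \<le> L^2 * exp u \<le> exp 1\<close>.\<close>
  define q0 where "q0 = 2 * sqrt (pi / \<beta>) * exp (- (4 * pi\<^sup>2 * exp 1 / \<beta>))"
  have q0: "q0 > 0" using beta by (simp add: q0_def)
  define \<kappa> where "\<kappa> = mc * (q0 * exp (- (exp 1 / 2)))"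
  show thesis
  proof (rule that[of \<kappa>])
    show "\<kappa> > 0" using mc q0 by (simp add: \<kappa>_def)
    fix L :: nat assume L: "L > 0"
    let ?a = "\<lambda>j k. diff_coeff m j * diff_coeff m k" and ?y = "\<lambda>j k. (real j - real k) / (4 * real L)"
    let ?p = "\<lambda>j. x0 + (real j / (4 * real L)) *\<^sub>R axis i0 1 :: real ^ 'n"
    let ?T = "\<lambda>u (x::real^'n). \<Prod>i\<in>UNIV. theta (\<beta> * exp (- u)) (x $ i)"
    have diff: "(?p j - ?p k) $ i = (if i = i0 then ?y j k else 0)" for j k i
      by (simp add: axis_def diff_divide_distrib)
    have T: "?T u (?p j - ?p k) = theta (\<beta> * exp (- u)) (?y j k) * theta (\<beta> * exp (- u)) 0 ^ (CARD('n) - 1)" for u j k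
      unfolding diff by (subst prod.remove[of UNIV i0]) auto
    let ?Q = "\<lambda>u. \<Sum>j\<le>m. \<Sum>k\<le>m. ?a j k * theta (\<beta> * exp (- u)) (?y j k)"
    let ?F = "\<lambda>u. \<Sum>j\<le>m. \<Sum>k\<le>m. ?a j k * (matern_weight \<nu> u * ?T u (?p j - ?p k))"
    have int: "integrable lborel (\<lambda>u. ?a j k * (matern_weight \<nu> u * ?T u (?p j - ?p k)))" for j k
      by (intro integrable_mult_right matern_theta_integrable nu beta)
    have F_eq: "?F u = matern_weight \<nu> u * theta (\<beta> * exp (- u)) 0 ^ (CARD('n) - 1) * ?Q u" for u
      unfolding T sum_distrib_left by (simp only: mult_ac)
    have Fge: "?F u \<ge> matern_weight \<nu> u * (2 * real L * theta_coeff (\<beta> * exp (- u)) (2 * L))" for u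
    proof -
      have b: "\<beta> * exp (- u) > 0" using beta by simp
      have "1 * (2 * real L * theta_coeff (\<beta> * exp (- u)) (2 * L)) \<le> theta (\<beta> * exp (- u)) 0 ^ (CARD('n) - 1) * ?Q u"
        using quadratic_form_theta_ge[OF b L] theta_0_ge_1[OF b] theta_coeff_pos[OF b, of "2 * L"]
        by (intro mult_mono one_le_power) auto
      then have "matern_weight \<nu> u * (1 * (2 * real L * theta_coeff (\<beta> * exp (- u)) (2 * L))) \<le> matern_weight \<nu> u * (theta (\<beta> * exp (- u)) 0 ^ (CARD('n) - 1) * ?Q u)"
        by (intro mult_left_mono) (auto simp: matern_weight_def)
      then show ?thesis unfolding F_eq by (simp only: mult_1 mult.assoc)
    qed
    \<comment> \<open>Chosen so that \<open>exp a = 1 / L^2\<close>; then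
      \<open>exp (\<nu> * a)\<close> is the desired power
      \<open>L powr (- 2 * \<nu>)\<close>.\<close>
    define a where "a = - (2 * ln (real L))"
    define W where "W = {a..a + 1}"
    define c where "c = q0 * exp (- (exp 1 / 2)) * real L powr (- (2 * \<nu>))"
    have c0: "c \<ge> 0" using q0 by (simp add: c_def)
    have low: "c * indicator W u \<le> ?F u" for u
    proof (cases "u \<in> W")
      case False
      have "0 \<le> matern_weight \<nu> u * (2 * real L * theta_coeff (\<beta> * exp (- u)) (2 * L))"
        using theta_coeff_pos[of "\<beta> * exp (- u)" "2 * L"] beta by (simp add: matern_weight_def less_imp_le)
      moreover have "c * indicator W u = 0" using False by simp
      ultimately show ?thesis using Fge[of u] by linarith
    next
      case True
      have ea: "exp a = 1 / (real L)\<^sup>2" unfolding a_def exp_minus exp_double using L by (simp add: inverse_eq_divide)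
      have eu: "exp u \<le> exp 1 / (real L)\<^sup>2"
      proof -
        have "exp u \<le> exp (a + 1)" using True by (simp add: W_def)
        then show ?thesis by (simp add: exp_add ea)
      qed
      have eu1: "exp u \<le> exp 1"
      proof -
        have "1 \<le> (real L)\<^sup>2" using L by (intro one_le_power) simp
        then have "exp 1 / (real L)\<^sup>2 \<le> exp 1 / (1::real)" using L by (intro divide_left_mono) auto
        with eu show ?thesis unfolding div_by_1 by (rule order.trans)
      qed
      have w: "real L powr (- (2 * \<nu>)) * exp (- (exp 1 / 2)) \<le> matern_weight \<nu> u"
      proof -
        have "real L powr (- (2 * \<nu>)) = exp (\<nu> * a)" using L by (simp add: powr_def a_def)
        moreover have "\<nu> * a + - (exp 1 / 2) \<le> \<nu> * u - exp u / 2"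
        proof -
          have "\<nu> * a \<le> \<nu> * u" using True nu by (intro mult_left_mono) (auto simp: W_def)
          then show ?thesis using eu1 by linarith
        qed
        ultimately show ?thesis unfolding matern_weight_def by (simp only: mult_exp_exp exp_le_cancel_iff)
      qed
      have th: "q0 \<le> 2 * real L * theta_coeff (\<beta> * exp (- u)) (2 * L)"
      proof -
        have 1: "sqrt (pi / \<beta>) \<le> real L * sqrt (pi / (\<beta> * exp (- u)))"
        proof -
          have "exp a \<le> exp u" using True by (simp add: W_def)
          then have "1 \<le> (real L)\<^sup>2 * exp u" using L unfolding ea by (simp add: field_simps)
          then have "pi / \<beta> * 1 \<le> pi / \<beta> * ((real L)\<^sup>2 * exp u)" using beta by (intro mult_left_mono) auto
          then have "sqrt (pi / \<beta>) \<le> sqrt ((real L)\<^sup>2 * (pi / (\<beta> * exp (- u))))"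
            using beta by (intro real_sqrt_le_mono) (simp add: exp_minus field_simps)
          then show ?thesis by (simp only: real_sqrt_mult real_sqrt_abs abs_of_nat)
        qed
        have 2: "exp (- (4 * pi\<^sup>2 * exp 1 / \<beta>)) \<le> exp (- pi\<^sup>2 * (real (2 * L))\<^sup>2 / (\<beta> * exp (- u)))"
        proof -
          have "pi\<^sup>2 * (real (2 * L))\<^sup>2 / (\<beta> * exp (- u)) = (4 * pi\<^sup>2 / \<beta>) * ((real L)\<^sup>2 * exp u)"
            using beta by (simp add: exp_minus power_mult_distrib field_simps)
          also have "\<dots> \<le> (4 * pi\<^sup>2 / \<beta>) * exp 1"
            using eu L beta by (intro mult_left_mono) (auto simp: field_simps)
          finally show ?thesis by simp
        qed
        have "q0 = 2 * (sqrt (pi / \<beta>) * exp (- (4 * pi\<^sup>2 * exp 1 / \<beta>)))" by (simp add: q0_def)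
        also have "\<dots> \<le> 2 * ((real L * sqrt (pi / (\<beta> * exp (- u)))) * exp (- pi\<^sup>2 * (real (2 * L))\<^sup>2 / (\<beta> * exp (- u))))"
          using beta by (intro mult_left_mono mult_mono 1 2) auto
        finally show ?thesis unfolding theta_coeff_def by (simp only: mult_ac)
      qed
      have "c = (real L powr (- (2 * \<nu>)) * exp (- (exp 1 / 2))) * q0" by (simp add: c_def)
      also have "\<dots> \<le> matern_weight \<nu> u * (2 * real L * theta_coeff (\<beta> * exp (- u)) (2 * L))"
        using q0 by (intro mult_mono w th) (auto simp: matern_weight_def)
      finally have "c \<le> matern_weight \<nu> u * (2 * real L * theta_coeff (\<beta> * exp (- u)) (2 * L))" .
      moreover have "c * indicator W u = c" using True by simp
      ultimately show ?thesis using Fge[of u] by linarith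
    qed
    have "c = (LINT u|lborel. c * indicator W u)" by (simp add: W_def)
    also have "\<dots> \<le> (LINT u|lborel. ?F u)"
    proof (intro integral_mono low)
      show "integrable lborel (\<lambda>u. c * indicator W u)"
        unfolding W_def by (intro integrable_mult_right integrable_real_indicator) (auto simp: emeasure_lborel_Icc_eq)
      show "integrable lborel ?F" by (intro Bochner_Integration.integrable_sum int)
    qed
    finally have cF: "c \<le> (LINT u|lborel. ?F u)" .
    have tm: "torus_matern \<nu> l \<sigma> (to_torus x) (to_torus y) = mc * (LINT u|lborel. matern_weight \<nu> u * ?T u (x - y))" for x y
      unfolding mc_def \<beta>_def by (rule torus_matern_integral[OF nu l])
    have e: "(LINT u|lborel. ?a j k * (matern_weight \<nu> u * ?T u (?p j - ?p k)))
       = ?a j k * (LINT u|lborel. matern_weight \<nu> u * ?T u (?p j - ?p k))" for j k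
      by (rule integral_mult_right_zero)
    have F_int: "(LINT u|lborel. ?F u) = (\<Sum>j\<le>m. \<Sum>k\<le>m. LINT u|lborel. ?a j k * (matern_weight \<nu> u * ?T u (?p j - ?p k)))"
      by (simp only: Bochner_Integration.integral_sum Bochner_Integration.integrable_sum int)
    have "(\<Sum>j\<le>m. \<Sum>k\<le>m. ?a j k * torus_matern \<nu> l \<sigma> (to_torus (?p j)) (to_torus (?p k)))
       = (\<Sum>j\<le>m. \<Sum>k\<le>m. mc * (LINT u|lborel. ?a j k * (matern_weight \<nu> u * ?T u (?p j - ?p k))))"
      unfolding tm e by (intro sum.cong refl) (rule mult.left_commute)
    also have "\<dots> = mc * (LINT u|lborel. ?F u)"
      unfolding F_int sum_distrib_left ..
    also have "\<dots> \<ge> mc * c" using cF mc by (intro mult_left_mono) auto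
    also have "mc * c = \<kappa> * real L powr (- (2 * \<nu>))" by (simp add: \<kappa>_def c_def)
    finally show "(\<Sum>j\<le>m. \<Sum>k\<le>m. ?a j k * torus_matern \<nu> l \<sigma> (to_torus (?p j)) (to_torus (?p k))) \<ge> \<kappa> * real L powr (- (2 * \<nu>))" .
  qed
qed

section \<open>Failure of smoother samples\<close>

lemma inj_on_to_torus_ball:
  fixes x0 :: "real ^ 'n::finite"
  assumes "\<rho> \<le> 1 / 2"
  shows "inj_on to_torus (ball x0 \<rho>)"
proof (rule inj_onI)
  fix x y :: "real ^ 'n" assume x: "x \<in> ball x0 \<rho>" and y: "y \<in> ball x0 \<rho>" and eq: "to_torus x = to_torus y"
  obtain m where m: "x - y = int_vec m" using eq unfolding torus.abs_eq_iff torus_rel_def by blast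
  have "norm (x - y) \<le> dist x0 x + dist x0 y"
    using dist_triangle[of x y x0] by (simp add: dist_norm norm_minus_commute)
  then have n: "norm (x - y) < 1" using x y assms by simp
  have "m $ i = 0" for i
  proof -
    have "\<bar>of_int (m $ i)\<bar> < (1::real)"
      using component_le_norm_cart[of "x - y" i] n unfolding m by (simp add: int_vec_def)
    then show ?thesis by linarith
  qed
  then show "x = y" using m by (simp add: int_vec_def vec_eq_iff)
qed

text \<open>On a line along axis \<open>i\<close> the words \<open>replicate j i\<close> become
  ordinary derivatives. The ball of half the radius is the compact set that provides the Hoelder
  constant.\<close>

lemma holder_loc_fdiff_le:
  fixes F :: "real ^ 'n::finite \<Rightarrow> real"
  assumes F: "F \<in> holder_loc n \<gamma> (ball x0 \<rho>)" and \<rho>: "\<rho> > 0"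
  obtains C where "\<And>h. h > 0 \<Longrightarrow> real (Suc n) * h \<le> \<rho> / 2 \<Longrightarrow>
    \<bar>(fdiff h ^^ Suc n) (\<lambda>t. F (x0 + t *\<^sub>R axis i 1)) 0\<bar> \<le> C * h powr (real n + \<gamma>)"
proof -
  let ?e = "axis i 1 :: real ^ 'n"
  define G where "G j t = iter_partial (replicate j i) F (x0 + t *\<^sub>R ?e)" for j t
  have mem: "x0 + t *\<^sub>R ?e \<in> cball x0 (\<rho> / 2)" if "\<bar>t\<bar> \<le> \<rho> / 2" for t
    using that by (simp add: dist_norm norm_axis_1)
  have sub: "cball x0 (\<rho> / 2) \<subseteq> ball x0 \<rho>" using \<rho> by auto
  have ex: "iter_partial_exists w F (ball x0 \<rho>)" if "length w \<le> n" for w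
    using F that unfolding holder_loc_def by blast
  have der: "(G j has_real_derivative G (Suc j) t) (at t)" if "j < n" "\<bar>t\<bar> \<le> \<rho> / 2" for j t
  proof -
    let ?x = "x0 + t *\<^sub>R ?e"
    have "iter_partial_exists (replicate (Suc j) i) F (ball x0 \<rho>)"
      by (rule ex) (use that(1) in simp)
    then have "(\<lambda>s. iter_partial (replicate j i) F (?x + s *\<^sub>R ?e)) differentiable (at 0)"
      using mem[OF that(2)] sub by (auto simp: has_partial_deriv_on_def)
    then have "((\<lambda>s. iter_partial (replicate j i) F (?x + s *\<^sub>R ?e)) has_real_derivative
        deriv (\<lambda>s. iter_partial (replicate j i) F (?x + s *\<^sub>R ?e)) 0) (at 0)"
      by (simp add: DERIV_deriv_iff_real_differentiable)
    then have "((\<lambda>s. G j (s + t)) has_real_derivative G (Suc j) t) (at 0)"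
      by (simp add: G_def partial_deriv_def scaleR_left_distrib add_ac)
    then show ?thesis using DERIV_shift[of "G j" "G (Suc j) t" 0 t] by simp
  qed
  have "\<exists>C>0. \<forall>x\<in>cball x0 (\<rho> / 2). \<forall>y\<in>cball x0 (\<rho> / 2). \<forall>is. length is = n \<longrightarrow>
          \<bar>iter_partial is F x - iter_partial is F y\<bar> \<le> C * norm (x - y) powr \<gamma>"
  proof -
    have all: "\<forall>K. compact K \<and> K \<subseteq> ball x0 \<rho> \<longrightarrow> (\<exists>C>0. \<forall>x\<in>K. \<forall>y\<in>K. \<forall>is. length is = n \<longrightarrow>
          \<bar>iter_partial is F x - iter_partial is F y\<bar> \<le> C * norm (x - y) powr \<gamma>)"
      using F unfolding holder_loc_def mem_Collect_eq by (rule conjunct2)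
    have h: "compact (cball x0 (\<rho> / 2)) \<and> cball x0 (\<rho> / 2) \<subseteq> ball x0 \<rho>" using sub by simp
    show ?thesis by (rule mp[OF spec[OF all] h])
  qed
  then obtain C where C: "\<And>x y is. x \<in> cball x0 (\<rho> / 2) \<Longrightarrow> y \<in> cball x0 (\<rho> / 2) \<Longrightarrow> length is = n \<Longrightarrow>
          \<bar>iter_partial is F x - iter_partial is F y\<bar> \<le> C * norm (x - y) powr \<gamma>" by blast
  have hol: "\<bar>G n s - G n t\<bar> \<le> C * \<bar>s - t\<bar> powr \<gamma>" if "\<bar>s\<bar> \<le> \<rho> / 2" "\<bar>t\<bar> \<le> \<rho> / 2" for s t
  proof -
    have "(x0 + s *\<^sub>R ?e) - (x0 + t *\<^sub>R ?e) = (s - t) *\<^sub>R ?e" by (simp add: scaleR_left_diff_distrib)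
    then have "norm ((x0 + s *\<^sub>R ?e) - (x0 + t *\<^sub>R ?e)) = \<bar>s - t\<bar>" by (simp add: norm_axis_1)
    then show ?thesis using C[OF mem[OF that(1)] mem[OF that(2)], of "replicate n i"] by (simp add: G_def)
  qed
  show thesis
  proof (rule that)
    fix h :: real assume h: "h > 0" "real (Suc n) * h \<le> \<rho> / 2"
    have "\<bar>(fdiff h ^^ Suc n) (G 0) 0\<bar> \<le> C * h powr (real n + \<gamma>)"
      by (rule fdiff_holder[where a=0 and b="\<rho> / 2"]) (use h der hol in auto)
    then show "\<bar>(fdiff h ^^ Suc n) (\<lambda>t. F (x0 + t *\<^sub>R axis i 1)) 0\<bar> \<le> C * h powr (real n + \<gamma>)"
      by (simp add: G_def[abs_def])
  qed
qed

text \<open>Almost sure eventual smallness sends the probabilities of the events \<open>E L\<close>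
  to 1, while \<open>gaussian_small_ball\<close> keeps each of them at most
  \<open>1/2\<close>.\<close>

lemma not_eventually_small:
  fixes X :: "nat \<Rightarrow> 'a \<Rightarrow> real"
  assumes M: "prob_space M" and X: "\<And>L. gaussian_rv M (X L)" and mean: "\<And>L. (\<integral>\<omega>. X L \<omega> \<partial>M) = 0"
    and var: "\<And>L. (\<integral>\<omega>. (X L \<omega>)\<^sup>2 \<partial>M) > 0"
    and small: "AE \<omega> in M. \<forall>\<^sub>F L in sequentially. \<bar>X L \<omega>\<bar> \<le> 1 / 2 * sqrt (\<integral>\<omega>. (X L \<omega>)\<^sup>2 \<partial>M)"
  shows False
proof -
  interpret prob_space M by (rule M)
  have meas[measurable]: "X L \<in> borel_measurable M" for L using X[of L] by (simp add: gaussian_rv_def)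
  define E where "E L = {\<omega> \<in> space M. \<bar>X L \<omega>\<bar> \<le> 1 / 2 * sqrt (\<integral>\<omega>. (X L \<omega>)\<^sup>2 \<partial>M)}" for L
  have Em[measurable]: "E L \<in> sets M" for L unfolding E_def by measurable
  have "(\<lambda>L. \<integral>\<omega>. indicator (E L) \<omega> \<partial>M) \<longlonglongrightarrow> (\<integral>\<omega>. 1 \<partial>M :: real)"
  proof (rule integral_dominated_convergence[where w="\<lambda>_. 1"])
    show "AE \<omega> in M. (\<lambda>L. indicator (E L) \<omega>) \<longlonglongrightarrow> (1::real)"
      using small AE_space
    proof eventually_elim
      fix \<omega> assume w: "\<forall>\<^sub>F L in sequentially. \<bar>X L \<omega>\<bar> \<le> 1 / 2 * sqrt (\<integral>\<omega>. (X L \<omega>)\<^sup>2 \<partial>M)" "\<omega> \<in> space M"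
      then have "\<forall>\<^sub>F L in sequentially. indicator (E L) \<omega> = (1::real)"
        by (auto simp: E_def elim!: eventually_mono)
      then show "(\<lambda>L. indicator (E L) \<omega>) \<longlonglongrightarrow> (1::real)" by (rule tendsto_eventually)
    qed
  qed (auto simp: indicator_def)
  then have lim: "(\<lambda>L. measure M (E L)) \<longlonglongrightarrow> 1" using prob_space by (simp add: sets.Int_space_eq2)
  have "measure M (E L) \<le> 1 / 2" for L
    unfolding E_def by (rule gaussian_small_ball[OF M X mean refl var]) simp
  then have "(1::real) \<le> 1 / 2" using LIMSEQ_le_const2[OF lim] by blast
  then show False by simp
qed

lemma matern_not_has_samples:
  fixes M :: "'a measure" and Z :: "('n :: finite) torus \<Rightarrow> 'a \<Rightarrow> real"
  assumes nu: "\<nu> > 0" and l: "l > 0" and \<sigma>: "\<sigma> > 0" and U: "open U" "U \<noteq> {}"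
    and Z: "gaussian_process M Z" and cen: "centred_process M Z"
    and cov: "\<forall>x x'. process_covariance M Z x x' = torus_matern \<nu> l \<sigma> x x'"
    and nu': "\<nu> < \<nu>'"
  shows "\<not> has_samples_in M Z (torus_almost_holder_loc \<nu>' U)"
proof
  assume "has_samples_in M Z (torus_almost_holder_loc \<nu>' U)"
  then obtain Y where Ymod: "\<And>x. AE \<omega> in M. Y x \<omega> = Z x \<omega>" and Ysam: "AE \<omega> in M. (\<lambda>x. Y x \<omega>) \<in> torus_almost_holder_loc \<nu>' U"
    unfolding has_samples_in_def modification_of_def by blast
  have M: "prob_space M" using Z by (simp add: gaussian_process_def)
  define n where "n = nat \<lfloor>\<nu>\<rfloor>"
  have n: "real n \<le> \<nu>" "\<nu> < real n + 1" using nu by (auto simp: n_def)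
  \<comment> \<open>Thus \<open>n + \<gamma>\<close> is the smaller of \<open>n + 1\<close> and the
    midpoint of \<open>\<nu>\<close> and \<open>\<nu>'\<close>; as \<open>n\<close> is the floor of
    \<open>\<nu>\<close>, it lies strictly between the two.\<close>
  define \<gamma> where "\<gamma> = min 1 ((\<nu> + \<nu>') / 2 - real n)"
  have \<gamma>: "0 \<le> \<gamma>" "\<gamma> \<le> 1" "\<nu> < real n + \<gamma>" "real n + \<gamma> < \<nu>'"
    using n nu' by (auto simp: \<gamma>_def min_def field_simps)
  obtain p where p: "p \<in> U" using U by blast
  define x0 where "x0 = rep_torus p"
  have tx0: "to_torus x0 = p" unfolding x0_def by (rule Quotient3_abs_rep[OF Quotient3_torus])
  have "open (to_torus -` U)" using U(1) by (simp add: open_torus_def)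
  moreover have "x0 \<in> to_torus -` U" using p tx0 by simp
  ultimately obtain \<rho>0 where \<rho>0: "\<rho>0 > 0" "ball x0 \<rho>0 \<subseteq> to_torus -` U" by (rule openE)
  define \<rho> where "\<rho> = min \<rho>0 (1/2)"
  have \<rho>: "\<rho> > 0" "\<rho> \<le> 1/2" "ball x0 \<rho> \<subseteq> to_torus -` U"
    using \<rho>0 by (auto simp: \<rho>_def)
  define i0 where "i0 = (undefined :: 'n)"
  define m where "m = Suc n"
  define h where "h L = 1 / (4 * real (Suc L))" for L
  define pt where "pt L j = (to_torus (x0 + (real j / (4 * real (Suc L))) *\<^sub>R axis i0 1) :: 'n torus)" for L j
  define X where "X L \<omega> = (\<Sum>j\<le>m. diff_coeff m j * Z (pt L j) \<omega>)" for L \<omega>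
  obtain \<kappa> where \<kappa>: "\<kappa> > 0" "\<And>L. L > 0 \<Longrightarrow> (\<Sum>j\<le>m. \<Sum>k\<le>m. diff_coeff m j * diff_coeff m k *
       torus_matern \<nu> l \<sigma> (to_torus (x0 + (real j / (4 * real L)) *\<^sub>R axis i0 1)) (to_torus (x0 + (real k / (4 * real L)) *\<^sub>R axis i0 1)))
     \<ge> \<kappa> * real L powr (- (2 * \<nu>))"
    by (rule quadratic_form_matern_ge[OF nu l \<sigma>, where ?i0.0=i0 and m=m and ?x0.0=x0]) (rule that; (assumption | blast))
  have var: "(\<integral>\<omega>. (X L \<omega>)\<^sup>2 \<partial>M) \<ge> \<kappa> * real (Suc L) powr (- (2 * \<nu>))" for L
    unfolding X_def centred_gaussian_process_moments(2)[OF Z cen finite_atMost] pt_def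
    using \<kappa>(2)[of "Suc L"] cov by simp
  show False
  proof (rule not_eventually_small[OF M])
    show "gaussian_rv M (X L)" for L
      unfolding X_def by (rule gaussian_process_linear_combination[OF Z finite_atMost])
    show "(\<integral>\<omega>. X L \<omega> \<partial>M) = 0" for L
      unfolding X_def by (rule centred_gaussian_process_moments(1)[OF Z cen finite_atMost])
    show "(\<integral>\<omega>. (X L \<omega>)\<^sup>2 \<partial>M) > 0" for L
    proof -
      have "0 < \<kappa> * real (Suc L) powr (- (2 * \<nu>))" using \<kappa>(1) by (simp add: powr_gt_zero del: of_nat_Suc)
      then show ?thesis using var[of L] by linarith
    qed
    \<comment> \<open>Only countably many points occur in the differences, so \<open>Y\<close> and
      \<open>Z\<close> agree at all of them outside one null set.\<close>
    have "AE \<omega> in M. \<forall>L. \<forall>j. Y (pt L j) \<omega> = Z (pt L j) \<omega>"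
      unfolding AE_all_countable using Ymod by blast
    then show "AE \<omega> in M. \<forall>\<^sub>F L in sequentially. \<bar>X L \<omega>\<bar> \<le> 1 / 2 * sqrt (\<integral>\<omega>. (X L \<omega>)\<^sup>2 \<partial>M)"
      using Ysam
    proof eventually_elim
      fix \<omega> assume eq: "\<forall>L. \<forall>j. Y (pt L j) \<omega> = Z (pt L j) \<omega>"
        and sam: "(\<lambda>x. Y x \<omega>) \<in> torus_almost_holder_loc \<nu>' U"
      let ?F = "(\<lambda>x. Y x \<omega>) \<circ> to_torus"
      have "(\<lambda>x. Y x \<omega>) \<in> torus_holder_loc n \<gamma> U"
        using sam \<gamma> unfolding torus_almost_holder_loc_def by blast
      then have "?F \<in> holder_loc n \<gamma> (ball x0 \<rho>)"
        using inj_on_to_torus_ball[OF \<rho>(2), of x0] \<rho>(3) unfolding torus_holder_loc_def by blast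
      then obtain C where C: "\<And>h. h > 0 \<Longrightarrow> real (Suc n) * h \<le> \<rho> / 2 \<Longrightarrow>
          \<bar>(fdiff h ^^ Suc n) (\<lambda>t. ?F (x0 + t *\<^sub>R axis i0 1)) 0\<bar> \<le> C * h powr (real n + \<gamma>)"
        using holder_loc_fdiff_le[OF _ \<rho>(1)] by metis
      have Xeq: "X L \<omega> = (fdiff (h L) ^^ Suc n) (\<lambda>t. ?F (x0 + t *\<^sub>R axis i0 1)) 0" for L
        unfolding X_def fdiff_eq_sum m_def using eq by (simp add: pt_def h_def del: of_nat_Suc)
      have hlim: "h \<longlonglongrightarrow> 0"
      proof -
        have "(\<lambda>L. (1/4) * (1 / real (Suc L))) \<longlonglongrightarrow> (1/4) * 0"
          by (intro tendsto_mult tendsto_const) (use LIMSEQ_inverse_real_of_nat in \<open>simp add: inverse_eq_divide\<close>)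
        then show ?thesis by (simp add: h_def[abs_def] del: of_nat_Suc)
      qed
      have hpos: "h L > 0" for L by (simp add: h_def)
      \<comment> \<open>The surplus of the assumed smoothness over \<open>\<nu>\<close>, which makes
        the difference negligible against its standard deviation.\<close>
      define e where "e = real n + \<gamma> - \<nu>"
      have e: "e > 0" using \<gamma> by (simp add: e_def)
      \<comment> \<open>The standard deviation is at least \<open>sqrt \<kappa> * (L + 1) powr (-
        \<nu>) = sqrt \<kappa> * (4 * h L) powr \<nu>\<close>, and half of it is the
        threshold.\<close>
      define c where "c = sqrt \<kappa> * 4 powr \<nu> / 2"
      have c: "c > 0" using \<kappa>(1) by (simp add: c_def)
      have sd: "c * h L powr \<nu> \<le> 1 / 2 * sqrt (\<integral>\<omega>. (X L \<omega>)\<^sup>2 \<partial>M)" for L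
      proof -
        have "h L powr \<nu> = 4 powr (- \<nu>) * real (Suc L) powr (- \<nu>)"
          by (simp add: h_def powr_divide powr_mult powr_minus_divide del: of_nat_Suc)
        moreover have "4 powr \<nu> * (4::real) powr (- \<nu>) = 1" by (simp add: powr_minus)
        ultimately have "c * h L powr \<nu> = 1 / 2 * (sqrt \<kappa> * real (Suc L) powr (- \<nu>))"
          by (simp add: c_def del: of_nat_Suc)
        also have "sqrt \<kappa> * real (Suc L) powr (- \<nu>) = sqrt (\<kappa> * real (Suc L) powr (- (2 * \<nu>)))"
        proof -
          have "real (Suc L) powr (- (2 * \<nu>)) = (real (Suc L) powr (- \<nu>))\<^sup>2"
            by (simp add: power2_eq_square powr_add[symmetric] del: of_nat_Suc)
          then show ?thesis by (simp add: real_sqrt_mult del: of_nat_Suc)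
        qed
        also have "1 / 2 * \<dots> \<le> 1 / 2 * sqrt (\<integral>\<omega>. (X L \<omega>)\<^sup>2 \<partial>M)"
          using var[of L] by (intro mult_left_mono real_sqrt_le_mono) auto
        finally show ?thesis .
      qed
      have "(\<lambda>L. C * h L powr e) \<longlonglongrightarrow> C * 0"
        by (intro tendsto_mult tendsto_const tendsto_zero_powrI[OF hlim tendsto_const]) (use e hpos in \<open>auto intro: always_eventually less_imp_le\<close>)
      then have "\<forall>\<^sub>F L in sequentially. C * h L powr e < c"
        using c by (intro order_tendstoD(2)) auto
      moreover have hl: "(\<lambda>L. real (Suc n) * h L) \<longlonglongrightarrow> real (Suc n) * 0"
        by (intro tendsto_mult tendsto_const hlim)
      have "\<forall>\<^sub>F L in sequentially. real (Suc n) * h L < \<rho> / 2"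
        by (rule order_tendstoD(2)[OF hl]) (use \<rho>(1) in simp)
      ultimately show "\<forall>\<^sub>F L in sequentially. \<bar>X L \<omega>\<bar> \<le> 1 / 2 * sqrt (\<integral>\<omega>. (X L \<omega>)\<^sup>2 \<partial>M)"
      proof eventually_elim
        fix L assume L1: "C * h L powr e < c" and L2: "real (Suc n) * h L < \<rho> / 2"
        have "\<bar>X L \<omega>\<bar> \<le> C * h L powr (real n + \<gamma>)"
          unfolding Xeq by (rule C) (use hpos L2 in auto)
        also have "h L powr (real n + \<gamma>) = h L powr e * h L powr \<nu>"
          unfolding powr_add[symmetric] by (simp add: e_def)
        also have "C * (h L powr e * h L powr \<nu>) = (C * h L powr e) * h L powr \<nu>" by simp
        also have "\<dots> \<le> c * h L powr \<nu>"
          using L1 by (intro mult_right_mono) auto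
        finally show "\<bar>X L \<omega>\<bar> \<le> 1 / 2 * sqrt (\<integral>\<omega>. (X L \<omega>)\<^sup>2 \<partial>M)" using sd[of L] by linarith
      qed
    qed
  qed
qed

theorem proposition3p4:
  fixes M :: "'a measure"
    and Z :: "('n :: finite) torus \<Rightarrow> 'a \<Rightarrow> real"
    and U :: "'n torus set"
    and \<nu> l \<sigma> :: real
  assumes "\<nu> > 0" and "l > 0" and "\<sigma> > 0"
    and "open U" and "U \<noteq> {}"
    and "gaussian_process M Z"
    and "centred_process M Z"
    and "\<forall>x x'. process_covariance M Z x x' = torus_matern \<nu> l \<sigma> x x'"
  shows "has_samples_in M Z (torus_almost_holder_loc \<nu> U) \<and>
    (\<forall>\<nu>'>\<nu>. \<not> has_samples_in M Z (torus_almost_holder_loc \<nu>' U))"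
  using matern_has_samples[OF assms(1,2,6,7,8), of U]
    matern_not_has_samples[OF assms(1-8)] by blast

end
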